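(* Let $n\ge5$. There exists a constant $\bar\theta=\bar\theta(n)>0$ such that: for every $\sigma\in(0,2]$ and every $\theta\in[0,\bar\theta]$ the cone $\mathcal C_{\sigma,\theta}$ is invariant under the Hamilton ODE; and for every $\sigma\in(0,1)\cup(1,2)$ and every $\theta\in(0,\bar\theta)$ the cone $\mathcal C_{\sigma,\theta}$ is transversally invariant away from $0$.
   Context: An algebraic curvature tensor on $\mathbb{R}^n$ is a tensor $R=(R_{ijkl})$ with $R_{ijkl}=-R_{jikl}=R_{klij}$ and $R_{ijkl}+R_{jkil}+R_{kijl}=0$; the unit round sphere has $R_{ijkl}=\delta_{ik}\delta_{jl}-\delta_{il}\delta_{jk}$. We write $\mathrm{Ric}(R)_{ik}=\sum_j R_{ijkj}$, $\mathrm{scal}(R)=\sum_i\mathrm{Ric}(R)_{ii}$, $\mathrm{Ric}_0(R)=\mathrm{Ric}(R)-\frac1n\mathrm{scal}(R)\,\mathrm{id}$. For symmetric bilinear forms $A,B$, $(A\odot B)_{ijkl}=A_{ik}B_{jl}-A_{il}B_{jk}-A_{jk}B_{il}+A_{jl}B_{ik}$; $\mathrm{id}=(\delta_{ij})$. The PIC2 cone is the set of algebraic curvature tensors $R$ with $R(z,w,\bar z,\bar w)\ge0$ for all $z,w\in\mathbb{C}^n$ ($R$ extended complex-multilinearly). For $\sigma\in(0,2]$ and $\theta\ge0$, $\mathcal{C}_{\sigma,\theta}$ denotes the set of algebraic curvature tensors $R$ that can be written $R=S+H\odot\mathrm{id}$, where $S$ is an algebraic curvature tensor in the PIC2 cone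 with $\mathrm{Ric}_0(S)=0$ and $H$ is a symmetric bilinear form with $\mathrm{tr}(H)\,\mathrm{id}-(n-2\sigma)H$ positive semidefinite and $\mathrm{tr}(H)-\theta\,\mathrm{scal}(S)\ge0$. For algebraic curvature tensors $S,T$ let $B(S,T)_{ijkl}=\frac12\sum_{p,q}(S_{ijpq}T_{klpq}+S_{klpq}T_{ijpq})+\sum_{p,q}(S_{ipkq}T_{jplq}-S_{iplq}T_{jpkq}-S_{jpkq}T_{iplq}+S_{jplq}T_{ipkq})$ and $Q(R)=B(R,R)$. The Hamilton ODE is $\frac{d}{dt}R=Q(R)$. A set $F$ of algebraic curvature tensors is invariant under the Hamilton ODE if every solution $R(t)$ with $R(0)\in F$ satisfies $R(t)\in F$ for all $t\ge0$ in its interval of existence. A closed convex cone $\mathcal C$ is transversally invariant away from $0$ if for every $R\in\partial\mathcal C\setminus\{0\}$, $Q(R)$ lies in the interior of the tangent cone of $\mathcal C$ at $R$. *)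

theory Defs
  imports "HOL-Analysis.Analysis"
begin

text \<open>4-tensors on R^n, with n = CARD('n), are elements of the Euclidean space
  real^('n \<times> 'n \<times> 'n \<times> 'n); component R_ijkl is R $ (i,j,k,l).
  Symmetric bilinear forms are matrices real^'n^'n.\<close>

type_synonym 'n tensor4 = "real ^ ('n \<times> 'n \<times> 'n \<times> 'n)"

definition acurv :: "('n::finite) tensor4 \<Rightarrow> bool" where
  "acurv R \<longleftrightarrow> (\<forall>i j k l.
      R $ (i,j,k,l) = - R $ (j,i,k,l) \<and>
      R $ (i,j,k,l) = R $ (k,l,i,j) \<and>
      R $ (i,j,k,l) + R $ (j,k,i,l) + R $ (k,i,j,l) = 0)"

definition ACT :: "('n::finite) tensor4 set" where
  "ACT = {R. acurv R}"

definition Ric :: "('n::finite) tensor4 \<Rightarrow> real^'n^'n" where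
  "Ric R = (\<chi> i k. \<Sum>j\<in>UNIV. R $ (i,j,k,j))"

definition scal :: "('n::finite) tensor4 \<Rightarrow> real" where
  "scal R = (\<Sum>i\<in>UNIV. Ric R $ i $ i)"

definition Ric0 :: "('n::finite) tensor4 \<Rightarrow> real^'n^'n" where
  "Ric0 R = Ric R - (scal R / real CARD('n)) *\<^sub>R mat 1"

definition odot :: "real^'n^'n \<Rightarrow> real^'n^'n \<Rightarrow> ('n::finite) tensor4" where
  "odot A B = (\<chi> x. case x of (i,j,k,l) \<Rightarrow>
      A$i$k * B$j$l - A$i$l * B$j$k - A$j$k * B$i$l + A$j$l * B$i$k)"

definition PIC2 :: "('n::finite) tensor4 set" where
  "PIC2 = {R. acurv R \<and> (\<forall>z w :: complex^'n.
     let s = (\<Sum>i\<in>UNIV. \<Sum>j\<in>UNIV. \<Sum>k\<in>UNIV. \<Sum>l\<in>UNIV.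
                complex_of_real (R $ (i,j,k,l)) * z$i * w$j * cnj (z$k) * cnj (w$l))
     in Im s = 0 \<and> 0 \<le> Re s)}"

definition psd :: "real^'n^'n \<Rightarrow> bool" where
  "psd M \<longleftrightarrow> (\<forall>x::real^'n. 0 \<le> x \<bullet> (M *v x))"

definition Ccone :: "real \<Rightarrow> real \<Rightarrow> ('n::finite) tensor4 set" where
  "Ccone \<sigma> \<theta> = {R. acurv R \<and> (\<exists>S H.
      S \<in> PIC2 \<and> Ric0 S = 0 \<and> transpose H = H \<and>
      psd (trace H *\<^sub>R mat 1 - (real CARD('n) - 2 * \<sigma>) *\<^sub>R H) \<and>
      0 \<le> trace H - \<theta> * scal S \<and>
      R = S + odot H (mat 1))}"

definition Bq :: "('n::finite) tensor4 \<Rightarrow> 'n tensor4 \<Rightarrow> 'n tensor4" where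
  "Bq S T = (\<chi> x. case x of (i,j,k,l) \<Rightarrow>
      (1/2) * (\<Sum>p\<in>UNIV. \<Sum>q\<in>UNIV. S$(i,j,p,q) * T$(k,l,p,q) + S$(k,l,p,q) * T$(i,j,p,q))
    + (\<Sum>p\<in>UNIV. \<Sum>q\<in>UNIV. S$(i,p,k,q) * T$(j,p,l,q) - S$(i,p,l,q) * T$(j,p,k,q)
                            - S$(j,p,k,q) * T$(i,p,l,q) + S$(j,p,l,q) * T$(i,p,k,q)))"

definition Qmap :: "('n::finite) tensor4 \<Rightarrow> 'n tensor4" where
  "Qmap R = Bq R R"

text \<open>Invariance under dR/dt = Q(R): every solution on a forward interval [0,T]
  starting in F stays in F.  (Solutions on any interval of existence restrict to
  such compact intervals.)\<close>
definition ode_invariant :: "('n::finite) tensor4 set \<Rightarrow> bool" where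
  "ode_invariant F \<longleftrightarrow> (\<forall>T::real. \<forall>R :: real \<Rightarrow> 'n tensor4.
      0 \<le> T \<and> R 0 \<in> F \<and>
      (\<forall>t\<in>{0..T}. (R has_vector_derivative Qmap (R t)) (at t within {0..T}))
      \<longrightarrow> (\<forall>t\<in>{0..T}. R t \<in> F))"

definition tangent_cone :: "('n::finite) tensor4 set \<Rightarrow> 'n tensor4 \<Rightarrow> 'n tensor4 set" where
  "tangent_cone C R = closure {c *\<^sub>R (X - R) | c X. 0 \<le> c \<and> X \<in> C}"

definition transv_invariant :: "('n::finite) tensor4 set \<Rightarrow> bool" where
  "transv_invariant C \<longleftrightarrow> closed C \<and> convex C \<and> cone C \<and>
     (\<forall>R \<in> ((top_of_set ACT) frontier_of C) - {0}.
        Qmap R \<in> (top_of_set ACT) interior_of (tangent_cone C R))"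

end

theory Submission
  imports Defs
begin

text \<open>
Write \<open>H = \<Lambda> id - K\<close> with \<open>\<Lambda> = tr H / (n - 2\<sigma>)\<close>, so that \<open>K\<close> is positive semidefinite with trace
\<open>2\<sigma>\<Lambda>\<close>. For Einstein \<open>S\<close>, the tensor \<open>Q (S + H \<odot> id)\<close> is again of the form \<open>S' + H' \<odot> id\<close>, where
\<open>S' = Q(S) + (n - 2) K \<odot> K - 2 (tr K) K \<odot> id + 2 K\<^sup>2 \<odot> id + c id \<odot> id\<close> is Einstein and \<open>c\<close> is free.
Where the PIC2 condition for \<open>S\<close> degenerates, \<open>Q(S)\<close> is nonnegative by the second variation
argument; in an eigenbasis of \<open>K\<close> the remaining terms of \<open>S'\<close> form a diagonal curvature operator, which is
nonnegative once \<open>c\<close> is large. On the kernel of \<open>K\<close>, the derivative of \<open>K\<close> is nonnegative once \<open>c\<close> is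
small, because \<open>S\<close> has nonnegative sectional curvature. The two constraints on \<open>c\<close> are compatible for
all \<open>\<sigma> \<in> (0,2]\<close>, strictly so unless \<open>\<sigma> \<in> {1,2}\<close>. The last condition \<open>tr H \<ge> \<theta> scal S\<close> is preserved
for small \<open>\<theta>\<close>, since to leading order \<open>tr H' = (4/n) scal(S) tr H\<close> while \<open>scal S' = (2/n) scal(S)\<^sup>2\<close>.
\<close>

section \<open>Perturbation on compact sets and flow-invariance of convex sets\<close>

text \<open>Membership in the cone is existential, so there are no defining inequalities of
  \<open>R\<close> to differentiate. The argument works on triples \<open>(S, \<Lambda>, K)\<close>,
  where three explicit conditions hold, and projects back: one decomposition of
  \<open>Qmap R\<close> whose components point into the active conditions suffices. Decompositions
  are not unique since \<open>odot id id\<close> is Einstein; this is the freedom behind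
  \<open>c\<close>. With \<open>\<tau> = tr K\<close> and \<open>N = tr (K\<^sup>2)\<close>, the
  kernel of \<open>K\<close> admits \<open>c\<close> up to
  \<open>4 \<Lambda>\<^sup>2 - ((2 - \<sigma>)/\<sigma>) N\<close>. At this value the PIC2 condition
  for two eigenvalues of \<open>K\<close> with sum \<open>s\<close> is bounded below by an affine
  function of \<open>A = s (\<tau> - s)\<close>, where
  \<open>0 \<le> A \<le> \<sigma>\<^sup>2 \<Lambda>\<^sup>2\<close>. Its end values are
  \<open>4 \<Lambda>\<^sup>2 (1 - \<sigma>)\<^sup>2\<close> and
  \<open>4 \<Lambda>\<^sup>2 (1 - \<sigma>/2)\<^sup>2\<close>: hence the exceptional 1 and 2. The
  strict gains for \<open>S\<close> and \<open>K\<close> are multiples of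
  \<open>\<Lambda>\<^sup>2\<close>; for transversality \<open>\<theta> > 0\<close> excludes
  \<open>\<Lambda> = 0\<close> away from the origin.\<close>

text \<open>On the compact set where \<open>g\<close> is nonpositive, \<open>f\<close> cannot vanish
  and has a positive minimum \<open>m\<close>; with \<open>M\<close> bounding \<open>g\<close> in
  modulus, steps up to \<open>m / M\<close> are safe there, and elsewhere both terms are
  nonnegative. This turns first-order conditions into one step size for all frames or unit
  vectors.\<close>

lemma nonneg_perturb_on_compact:
  fixes f g :: "'a::topological_space \<Rightarrow> real"
  assumes X: "compact X" and cf: "continuous_on X f" and cg: "continuous_on X g"
    and f0: "\<And>x. x \<in> X \<Longrightarrow> 0 \<le> f x"
    and g0: "\<And>x. x \<in> X \<Longrightarrow> f x = 0 \<Longrightarrow> 0 < g x"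
  shows "\<exists>\<delta>>0. \<forall>d. 0 \<le> d \<and> d \<le> \<delta> \<longrightarrow> (\<forall>x\<in>X. 0 \<le> f x + d * g x)"
proof -
  define Y where "Y = {x \<in> X. g x \<le> 0}"
  have "closedin (top_of_set X) {x \<in> X. g x \<in> {..0}}"
    using continuous_closedin_preimage[OF cg, of "{..0}"] by (simp add: vimage_def Int_def)
  then have Y: "compact Y"
    using X closedin_compact unfolding Y_def by fastforce
  have YX: "Y \<subseteq> X" by (auto simp: Y_def)
  have fp: "0 < f x" if "x \<in> Y" for x
    using f0[of x] g0[of x] that by (fastforce simp: Y_def)
  obtain m where m: "m > 0" "\<And>x. x \<in> Y \<Longrightarrow> m \<le> f x"
  proof (cases "Y = {}")
    case True
    then show ?thesis using that[of 1] by auto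
  next
    case False
    then obtain y where "y \<in> Y" "\<forall>x\<in>Y. f y \<le> f x"
      using continuous_attains_inf[OF Y False continuous_on_subset[OF cf YX]] by blast
    then show ?thesis using that[of "f y"] fp by auto
  qed
  have "bounded (g ` X)" by (intro compact_imp_bounded compact_continuous_image cg X)
  then obtain M where M: "M > 0" "\<And>x. x \<in> X \<Longrightarrow> \<bar>g x\<bar> \<le> M"
    unfolding bounded_pos by auto
  show ?thesis
  proof (intro exI[of _ "m / M"] conjI allI impI ballI)
    show "0 < m / M" using m M by simp
    fix d x assume d: "0 \<le> d \<and> d \<le> m / M" and x: "x \<in> X"
    show "0 \<le> f x + d * g x"
    proof (cases "g x \<le> 0")
      case True
      then have "m \<le> f x" using m x by (simp add: Y_def)
      moreover have "d * \<bar>g x\<bar> \<le> m / M * M"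
        using d M x by (intro mult_mono) auto
      ultimately show ?thesis using True M(1) by auto
    next
      case False
      then show ?thesis using f0[OF x] d by simp
    qed
  qed
qed

text \<open>The preceding lemma applied to \<open>g\<close> and \<open>h\<close> on the zero set of
  \<open>f\<close>. It expresses that strict inwardness at active constraints survives small
  perturbations.\<close>

lemma pos_perturb_on_zero_set:
  fixes f g h :: "'a::topological_space \<Rightarrow> real"
  assumes X: "compact X" and cf: "continuous_on X f" and cg: "continuous_on X g"
    and ch: "continuous_on X h"
    and g0: "\<And>x. x \<in> X \<Longrightarrow> f x = 0 \<Longrightarrow> 0 < g x"
  shows "\<exists>\<delta>>0. \<forall>d. 0 \<le> d \<and> d \<le> \<delta> \<longrightarrow> (\<forall>x\<in>X. f x = 0 \<longrightarrow> 0 < g x + d * h x)"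
proof -
  define Y where "Y = {x \<in> X. f x = 0}"
  have "closedin (top_of_set X) {x \<in> X. f x \<in> {0}}"
    using continuous_closedin_preimage[OF cf, of "{0}"] by (simp add: vimage_def Int_def)
  then have Y: "compact Y"
    using X closedin_compact unfolding Y_def by fastforce
  have YX: "Y \<subseteq> X" by (auto simp: Y_def)
  have gY: "0 < g x" if "x \<in> Y" for x using that g0 by (auto simp: Y_def)
  obtain \<delta> where d: "\<delta> > 0" "\<And>d x. 0 \<le> d \<Longrightarrow> d \<le> \<delta> \<Longrightarrow> x \<in> Y \<Longrightarrow> 0 \<le> g x + d * h x"
    using nonneg_perturb_on_compact[OF Y continuous_on_subset[OF cg YX] continuous_on_subset[OF ch YX]]
      gY by (metis less_eq_real_def less_irrefl)
  show ?thesis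
  proof (intro exI[of _ "\<delta> / 2"] conjI allI impI ballI)
    show "0 < \<delta> / 2" using d by simp
    fix e x assume e: "0 \<le> e \<and> e \<le> \<delta> / 2" and x: "x \<in> X" "f x = 0"
    \<comment> \<open>Strictness comes from halving: the value at \<open>e\<close> is the mean of
      the positive \<open>g x\<close> and the nonnegative value at \<open>2 * e\<close>.\<close>
    have "0 \<le> g x + (2 * e) * h x" using d e x by (auto simp: Y_def)
    moreover have "0 < g x" using g0 x by blast
    ultimately show "0 < g x + e * h x" by linarith
  qed
qed

text \<open>The point \<open>p x\<close> competes for the distance from \<open>y\<close>, which
  bounds the increment above; the obtuse angle of the projection at \<open>p x\<close> bounds it
  below. The error thus lies between 0 and the square of \<open>norm (y - x)\<close>, with no
  differentiability of \<open>p\<close> involved.\<close>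

lemma has_derivative_dist_square_convex:
  fixes F :: "'a::euclidean_space set"
  assumes F: "closed F" "convex F" "F \<noteq> {}"
  defines "p \<equiv> closest_point F"
  shows "((\<lambda>x. (norm (x - p x))\<^sup>2) has_derivative (\<lambda>h. 2 * ((x - p x) \<bullet> h))) (at x)"
  unfolding has_derivative_at_alt
proof (intro conjI allI impI)
  show "bounded_linear (\<lambda>h. 2 * ((x - p x) \<bullet> h))"
    by (intro bounded_linear_intros)
  fix e :: real assume e: "e > 0"
  show "\<exists>d>0. \<forall>y. norm (y - x) < d \<longrightarrow>
     norm ((norm (y - p y))\<^sup>2 - (norm (x - p x))\<^sup>2 - 2 * ((x - p x) \<bullet> (y - x))) \<le> e * norm (y - x)"
  proof (intro exI[of _ e] conjI e allI impI)
    fix y assume y: "norm (y - x) < e"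
    define h where "h = y - x"
    have pF: "p x \<in> F" "p y \<in> F" using F unfolding p_def by (auto intro: closest_point_in_set)
    have "norm (y - p y) \<le> norm (y - p x)"
      using closest_point_le[OF F(1) pF(1), of y] unfolding p_def dist_norm by simp
    then have "(norm (y - p y))\<^sup>2 \<le> (norm ((x - p x) + h))\<^sup>2"
      unfolding h_def by (intro power_mono) auto
    also have "\<dots> = (norm (x - p x))\<^sup>2 + 2 * ((x - p x) \<bullet> h) + (norm h)\<^sup>2"
      by (simp add: power2_norm_eq_inner algebra_simps inner_commute)
    finally have up: "(norm (y - p y))\<^sup>2 - (norm (x - p x))\<^sup>2 - 2 * ((x - p x) \<bullet> h) \<le> (norm h)\<^sup>2"
      by simp
    have "(x - p x) \<bullet> (p y - p x) \<le> 0"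
      using closest_point_dot[OF F(2,1) pF(2)] unfolding p_def .
    moreover have "(norm (y - p y))\<^sup>2 = (norm (x - p x))\<^sup>2 + 2 * ((x - p x) \<bullet> h)
        - 2 * ((x - p x) \<bullet> (p y - p x)) + (norm (h + (p x - p y)))\<^sup>2"
      unfolding h_def by (simp add: power2_norm_eq_inner algebra_simps inner_commute)
    ultimately have lo: "0 \<le> (norm (y - p y))\<^sup>2 - (norm (x - p x))\<^sup>2 - 2 * ((x - p x) \<bullet> h)"
      using zero_le_power2[of "norm (h + (p x - p y))"] by linarith
    have "(norm h)\<^sup>2 \<le> e * norm h"
      using y unfolding h_def power2_eq_square by (intro mult_right_mono) auto
    then show "norm ((norm (y - p y))\<^sup>2 - (norm (x - p x))\<^sup>2 - 2 * ((x - p x) \<bullet> (y - x))) \<le> e * norm (y - x)"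
      using up lo unfolding h_def by simp
  qed
qed

text \<open>The squared distance \<open>u\<close> to the convex set is differentiable along a solution, and the tangency
  condition at the closest point yields \<open>u' \<le> 2 L u\<close>.\<close>

lemma closed_convex_flow_invariant:
  fixes F :: "'a::euclidean_space set" and f :: "'a \<Rightarrow> 'a"
  assumes F: "closed F" "convex F"
    and tangent: "\<And>P N. P \<in> F \<Longrightarrow> (\<And>X. X \<in> F \<Longrightarrow> N \<bullet> (X - P) \<le> 0) \<Longrightarrow> N \<bullet> f P \<le> 0"
    and lip: "\<And>B. \<exists>L. \<forall>x y. norm x \<le> B \<longrightarrow> norm y \<le> B \<longrightarrow> norm (f x - f y) \<le> L * norm (x - y)"
    and R0: "R 0 \<in> F"
    and R: "\<And>t. t \<in> {0..T} \<Longrightarrow> (R has_vector_derivative f (R t)) (at t within {0..T})"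
    and t: "t \<in> {0..T}"
  shows "R t \<in> F"
proof -
  have Fne: "F \<noteq> {}" using R0 by auto
  define p where "p = closest_point F"
  define u where "u = (\<lambda>s. (norm (R s - p (R s)))\<^sup>2)"
  have pF: "p x \<in> F" for x using F Fne unfolding p_def by (auto intro: closest_point_in_set)
  have contR: "continuous_on {0..T} R"
    unfolding continuous_on_eq_continuous_within using R has_vector_derivative_continuous by blast
  have contp: "continuous_on {0..T} (\<lambda>s. p (R s))"
    unfolding p_def
    by (rule continuous_on_compose2[OF continuous_on_closest_point[OF F(2,1) Fne, of UNIV] contR]) auto
  obtain B1 where B1: "\<And>s. s \<in> {0..T} \<Longrightarrow> norm (R s) \<le> B1"
    using compact_imp_bounded[OF compact_continuous_image[OF contR compact_Icc]]
    unfolding bounded_iff by (metis imageI)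
  obtain B2 where B2: "\<And>s. s \<in> {0..T} \<Longrightarrow> norm (p (R s)) \<le> B2"
    using compact_imp_bounded[OF compact_continuous_image[OF contp compact_Icc]]
    unfolding bounded_iff by (metis imageI)
  obtain L where L: "\<And>x y. norm x \<le> max B1 B2 \<Longrightarrow> norm y \<le> max B1 B2 \<Longrightarrow> norm (f x - f y) \<le> L * norm (x - y)"
    using lip[of "max B1 B2"] by blast
  define v where "v = (\<lambda>s. 2 * ((R s - p (R s)) \<bullet> f (R s)))"
  have du: "(u has_real_derivative v s) (at s within {0..T})" if "s \<in> {0..T}" for s
  proof -
    have "(R has_derivative (\<lambda>h. h *\<^sub>R f (R s))) (at s within {0..T})"
      using R[OF that] by (simp add: has_vector_derivative_def)
    from has_derivative_compose[OF this has_derivative_dist_square_convex[OF F Fne]]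
    have "(u has_derivative (\<lambda>h. 2 * ((R s - p (R s)) \<bullet> (h *\<^sub>R f (R s))))) (at s within {0..T})"
      unfolding u_def p_def by simp
    then show ?thesis
      unfolding has_field_derivative_def v_def
      by (rule has_derivative_eq_rhs) (auto simp: fun_eq_iff)
  qed
  have vle: "v s \<le> 2 * L * u s" if s: "s \<in> {0..T}" for s
  proof -
    let ?N = "R s - p (R s)"
    have "?N \<bullet> f (p (R s)) \<le> 0"
      using tangent[OF pF] closest_point_dot[OF F(2,1)] unfolding p_def by blast
    moreover have "?N \<bullet> (f (R s) - f (p (R s))) \<le> norm ?N * norm (f (R s) - f (p (R s)))"
      by (rule norm_cauchy_schwarz)
    moreover have "norm ?N * norm (f (R s) - f (p (R s))) \<le> norm ?N * (L * norm ?N)"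
      using L[of "R s" "p (R s)"] B1[OF s] B2[OF s] by (intro mult_left_mono) auto
    ultimately have "?N \<bullet> f (R s) \<le> L * (norm ?N)\<^sup>2"
      by (simp add: inner_diff_right power2_eq_square mult_ac)
    then show ?thesis unfolding v_def u_def by simp
  qed
  \<comment> \<open>Gronwall factor: it turns \<open>u' \<le> 2 L u\<close> into monotonicity, so
    \<open>w\<close> starts at 0 and does not increase.\<close>
  define w where "w = (\<lambda>s. u s * exp (- (2 * L) * s))"
  have dw: "(w has_real_derivative (v s - 2 * L * u s) * exp (- (2 * L) * s)) (at s within {0..T})"
    if "s \<in> {0..T}" for s
    unfolding w_def by (auto intro!: derivative_eq_intros du[OF that] simp: algebra_simps)
  have "w t \<le> w 0"
  proof (rule DERIV_nonpos_imp_decreasing_open[where f = w and a = 0 and b = t])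
    show "0 \<le> t" using t by simp
    show "continuous_on {0..t} w"
    proof (rule continuous_on_subset[of "{0..T}"])
      show "continuous_on {0..T} w"
        unfolding continuous_on_eq_continuous_within using dw DERIV_continuous by blast
    qed (use t in auto)
    fix s assume s: "0 < s" "s < t"
    then have "at s within {0..T} = at s" using t by (intro at_within_Icc_at) auto
    then show "\<exists>y. (w has_real_derivative y) (at s) \<and> y \<le> 0"
      using dw[of s] vle[of s] s t by (intro exI conjI) (auto simp: mult_nonpos_nonneg)
  qed
  moreover have "w 0 = 0"
    using R0 by (simp add: w_def u_def p_def closest_point_self)
  ultimately have "u t \<le> 0" by (simp add: w_def mult_le_0_iff)
  then have "R t = p (R t)" unfolding u_def by simp
  then show ?thesis using pF by metis
qed

section \<open>Spectral theorem and Gram representation\<close>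

text \<open>If \<open>y \<bullet> f x\<close> were nonzero, moving from \<open>x\<close> along
  \<open>y\<close> would make the form negative to first order. The denominator \<open>b + 1\<close>
  in the step length covers \<open>b = 0\<close>.\<close>

lemma selfadjoint_nonneg_zero_imp_orthogonal:
  fixes f :: "'a::real_inner \<Rightarrow> 'a"
  assumes lf: "linear f" and sa: "\<And>x y. x \<bullet> f y = f x \<bullet> y"
    and V: "subspace V" and nn: "\<And>x. x \<in> V \<Longrightarrow> 0 \<le> x \<bullet> f x"
    and x: "x \<in> V" "x \<bullet> f x = 0" and y: "y \<in> V"
  shows "y \<bullet> f x = 0"
proof (rule ccontr)
  define a b where "a = y \<bullet> f x" and "b = y \<bullet> f y"
  assume "y \<bullet> f x \<noteq> 0"
  then have a: "a \<noteq> 0" by (simp add: a_def)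
  have b: "0 \<le> b" using nn y by (simp add: b_def)
  define t where "t = - a / (b + 1)"
  have "x + t *\<^sub>R y \<in> V" using V x y by (simp add: subspace_add subspace_scale)
  then have "0 \<le> (x + t *\<^sub>R y) \<bullet> f (x + t *\<^sub>R y)" by (rule nn)
  also have "\<dots> = 2 * t * a + t\<^sup>2 * b"
    using x(2) sa[of x y] unfolding a_def b_def
    by (simp add: linear_add[OF lf] linear_cmul[OF lf] algebra_simps inner_commute power2_eq_square)
  also have "\<dots> = t\<^sup>2 * (- b - 2)"
  proof -
    have at: "a = - t * (b + 1)" using b by (simp add: t_def)
    have "2 * t * a + t\<^sup>2 * b = 2 * t * (- t * (b + 1)) + t\<^sup>2 * b"
      by (subst at) (rule refl)
    then show ?thesis by (simp add: algebra_simps power2_eq_square)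
  qed
  also have "\<dots> < 0"
    using a b by (intro mult_pos_neg) (auto simp: t_def)
  finally show False by simp
qed

text \<open>Let \<open>x\<close> maximise the Rayleigh quotient on the unit sphere of
  \<open>V\<close>, with value \<open>c\<close>. The form of \<open>c id - f\<close> is nonnegative
  on \<open>V\<close> and vanishes at \<open>x\<close>, so the preceding lemma puts \<open>x\<close>
  in its kernel.\<close>

lemma selfadjoint_eigenvector_exists:
  fixes f :: "'a::euclidean_space \<Rightarrow> 'a"
  assumes lf: "linear f" and sa: "\<And>x y. x \<bullet> f y = f x \<bullet> y"
    and V: "subspace V" and inv: "\<And>x. x \<in> V \<Longrightarrow> f x \<in> V" and ne: "\<exists>x\<in>V. x \<noteq> 0"
  obtains x c where "x \<in> V" "norm x = 1" "f x = c *\<^sub>R x"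
proof -
  define X where "X = V \<inter> sphere 0 1"
  have "compact X" unfolding X_def
    by (intro closed_Int_compact closed_subspace V compact_sphere)
  moreover obtain z where "z \<in> V" "z \<noteq> 0" using ne by blast
  then have "z /\<^sub>R norm z \<in> X" using V by (simp add: X_def subspace_scale)
  then have "X \<noteq> {}" by blast
  moreover have "continuous_on X (\<lambda>x. x \<bullet> f x)"
    by (intro continuous_intros linear_continuous_on linear_conv_bounded_linear[THEN iffD1] lf)
  ultimately obtain x where x: "x \<in> X" "\<And>y. y \<in> X \<Longrightarrow> y \<bullet> f y \<le> x \<bullet> f x"
    using continuous_attains_sup[of X "\<lambda>x. x \<bullet> f x"] by blast
  define c where "c = x \<bullet> f x"
  have xV: "x \<in> V" and xn: "norm x = 1" using x by (auto simp: X_def)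
  have xx: "x \<bullet> x = 1" using xn by (simp add: dot_square_norm)
  define g where "g = (\<lambda>y. c *\<^sub>R y - f y)"
  have lg: "linear g" unfolding g_def
    by (intro linear_compose_sub lf linear_compose_scale_right linear_ident)
  have sg: "u \<bullet> g y = g u \<bullet> y" for u y
    unfolding g_def by (simp add: inner_diff_left inner_diff_right sa)
  have gn: "0 \<le> y \<bullet> g y" if y: "y \<in> V" for y
  proof (cases "y = 0")
    case False
    have "y /\<^sub>R norm y \<in> X" using V y False by (simp add: X_def subspace_scale)
    from x(2)[OF this] have "(y /\<^sub>R norm y) \<bullet> f (y /\<^sub>R norm y) \<le> c" by (simp add: c_def)
    then have "y \<bullet> f y / (norm y)\<^sup>2 \<le> c"
      by (simp add: linear_cmul[OF lf] power2_eq_square divide_inverse mult_ac)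
    then have "y \<bullet> f y \<le> c * (y \<bullet> y)"
      using False by (simp add: pos_divide_le_eq power2_norm_eq_inner)
    then show ?thesis by (simp add: g_def inner_diff_right)
  qed simp
  have gx: "g x \<in> V" using V xV inv unfolding g_def by (simp add: subspace_diff subspace_scale)
  have "x \<bullet> g x = 0" using xx by (simp add: g_def inner_diff_right c_def)
  then have "g x \<bullet> g x = 0"
    using selfadjoint_nonneg_zero_imp_orthogonal[OF lg sg V gn xV _ gx] by blast
  then have "f x = c *\<^sub>R x" by (simp add: g_def)
  then show ?thesis using that xV xn by blast
qed

text \<open>Take an orthonormal set of eigenvectors of greatest cardinality. Its orthogonal
  complement is invariant under \<open>f\<close>, so a nonzero vector there would supply one more
  eigenvector.\<close>

theorem selfadjoint_orthonormal_eigenbasis: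
  fixes f :: "'a::euclidean_space \<Rightarrow> 'a"
  assumes lf: "linear f" and sa: "\<And>x y. x \<bullet> f y = f x \<bullet> y"
  obtains B c where "finite B" "pairwise orthogonal B" "\<And>b. b \<in> B \<Longrightarrow> norm b = 1"
    "\<And>b. b \<in> B \<Longrightarrow> f b = c b *\<^sub>R b" "\<And>x. x = (\<Sum>b\<in>B. (x \<bullet> b) *\<^sub>R b)"
proof -
  define P where "P B \<longleftrightarrow> pairwise orthogonal B \<and> (\<forall>b\<in>B. norm b = 1 \<and> (\<exists>c. f b = c *\<^sub>R b))" for B
  have indep: "independent B" if "P B" for B
  proof (rule pairwise_orthogonal_independent)
    show "pairwise orthogonal B" "0 \<notin> B" using that unfolding P_def by force+
  qed
  have bnd: "finite B \<and> card B \<le> DIM('a)" if "P B" for B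
    using independent_bound[OF indep[OF that]] .
  have "P {}" by (simp add: P_def)
  then obtain B where B: "P B" "\<And>B'. P B' \<Longrightarrow> card B' \<le> card B"
    using ex_has_greatest_nat[of P "{}" card "Suc DIM('a)"] bnd
    by (metis le_imp_less_Suc)
  have fin: "finite B" using bnd B by blast
  define V where "V = {x. \<forall>b\<in>B. x \<bullet> b = 0}"
  have V: "subspace V" unfolding V_def subspace_def by (auto simp: inner_add_left)
  have invV: "f x \<in> V" if "x \<in> V" for x
  proof -
    have "f x \<bullet> b = 0" if "b \<in> B" for b
    proof -
      have "\<exists>c. f b = c *\<^sub>R b" using B(1) that by (simp add: P_def)
      then obtain c where "f b = c *\<^sub>R b" ..
      then show ?thesis using sa[of x b] that \<open>x \<in> V\<close> by (simp add: V_def)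
    qed
    then show ?thesis by (simp add: V_def)
  qed
  have V0: "x = 0" if "x \<in> V" for x
  proof (rule ccontr)
    assume "x \<noteq> 0"
    with that have ne: "\<exists>x\<in>V. x \<noteq> 0" by blast
    obtain y c where y: "y \<in> V" "norm y = 1" "f y = c *\<^sub>R y"
      by (rule selfadjoint_eigenvector_exists[OF lf sa V invV ne])
    have "y \<notin> B"
    proof
      assume "y \<in> B"
      then have "y \<bullet> y = 0" using y(1) by (simp add: V_def)
      then show False using y(2) by simp
    qed
    moreover have "P (insert y B)"
      using B(1) y unfolding P_def V_def
      by (auto simp: pairwise_insert orthogonal_def inner_commute)
    ultimately show False using B(2)[of "insert y B"] fin by simp
  qed
  have orth: "a \<bullet> b = (if a = b then 1 else 0)" if "a \<in> B" "b \<in> B" for a b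
    using B(1) that unfolding P_def pairwise_def orthogonal_def by (auto simp: dot_square_norm)
  have exp: "x = (\<Sum>b\<in>B. (x \<bullet> b) *\<^sub>R b)" for x
  proof -
    have "x - (\<Sum>b\<in>B. (x \<bullet> b) *\<^sub>R b) \<in> V"
      unfolding V_def
    proof (intro CollectI ballI)
      fix a assume a: "a \<in> B"
      have "(\<Sum>b\<in>B. (x \<bullet> b) *\<^sub>R b) \<bullet> a = (\<Sum>b\<in>B. if b = a then x \<bullet> a else 0)"
        unfolding inner_sum_left by (rule sum.cong) (auto simp: orth a)
      then show "(x - (\<Sum>b\<in>B. (x \<bullet> b) *\<^sub>R b)) \<bullet> a = 0"
        using fin a by (simp add: inner_diff_left)
    qed
    then show ?thesis using V0 by (metis right_minus_eq)
  qed
  show ?thesis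
  proof (rule that[of B "\<lambda>b. SOME c. f b = c *\<^sub>R b"])
    show "f b = (SOME c. f b = c *\<^sub>R b) *\<^sub>R b" if "b \<in> B" for b
      using B(1) that unfolding P_def by (metis (mono_tags, lifting) someI_ex)
  qed (use B(1) fin exp in \<open>auto simp: P_def\<close>)
qed

lemma sum_swap_4:
  "(\<Sum>p\<in>P. \<Sum>q\<in>Q. \<Sum>r\<in>R. \<Sum>s\<in>S. f p q r s) = (\<Sum>r\<in>R. \<Sum>s\<in>S. \<Sum>p\<in>P. \<Sum>q\<in>Q. f p q r s)"
proof -
  have "(\<Sum>p\<in>P. \<Sum>q\<in>Q. \<Sum>r\<in>R. \<Sum>s\<in>S. f p q r s) = (\<Sum>p\<in>P. \<Sum>r\<in>R. \<Sum>q\<in>Q. \<Sum>s\<in>S. f p q r s)"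
    by (intro sum.cong refl sum.swap)
  also have "\<dots> = (\<Sum>r\<in>R. \<Sum>p\<in>P. \<Sum>q\<in>Q. \<Sum>s\<in>S. f p q r s)" by (rule sum.swap)
  also have "\<dots> = (\<Sum>r\<in>R. \<Sum>p\<in>P. \<Sum>s\<in>S. \<Sum>q\<in>Q. f p q r s)"
    by (intro sum.cong refl sum.swap)
  also have "\<dots> = (\<Sum>r\<in>R. \<Sum>s\<in>S. \<Sum>p\<in>P. \<Sum>q\<in>Q. f p q r s)"
    by (intro sum.cong refl sum.swap)
  finally show ?thesis .
qed

section \<open>Positive semidefinite Hermitian matrices\<close>

definition sesq :: "('a::finite \<Rightarrow> 'a \<Rightarrow> complex) \<Rightarrow> ('a \<Rightarrow> complex) \<Rightarrow> complex" where
  "sesq M x = (\<Sum>a\<in>UNIV. \<Sum>b\<in>UNIV. M a b * x a * cnj (x b))"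

text \<open>Dependence of the form on a single coordinate; the next two lemmas consist in a good
  choice of the shift \<open>s\<close>.\<close>

lemma sesq_shift:
  assumes herm: "\<And>a b. M b a = cnj (M a b)"
  defines "L \<equiv> \<lambda>x c. \<Sum>a\<in>UNIV. M a c * x a"
  shows "sesq M (\<lambda>a. x a + (if a = c then s else 0)) =
    sesq M x + (cnj s * L x c + s * cnj (L x c)) + s * cnj s * M c c"
proof -
  have 1: "cnj (L x c) = (\<Sum>b\<in>UNIV. M c b * cnj (x b))"
    unfolding L_def by (simp add: herm[symmetric])
  have "sesq M (\<lambda>a. x a + (if a = c then s else 0)) =
     (\<Sum>a\<in>UNIV. \<Sum>b\<in>UNIV. M a b * x a * cnj (x b) + (if b = c then M a b * x a * cnj s else 0)
        + (if a = c then M a b * s * cnj (x b) else 0) + (if a = c then if b = c then M a b * s * cnj s else 0 else 0))"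
    unfolding sesq_def
    by (intro sum.cong refl, rename_tac a b, case_tac "a = c"; case_tac "b = c"; simp add: algebra_simps)
  also have "\<dots> = sesq M x + (\<Sum>a\<in>UNIV. M a c * x a * cnj s) + (\<Sum>b\<in>UNIV. M c b * s * cnj (x b))
      + M c c * s * cnj s"
  proof -
    have "(\<Sum>a\<in>UNIV. \<Sum>b\<in>UNIV. if a = c then M a b * s * cnj (x b) else 0)
        = (\<Sum>b\<in>UNIV. M c b * s * cnj (x b))"
      by (subst sum.swap) simp
    moreover have "(\<Sum>a\<in>UNIV. \<Sum>b\<in>UNIV. if a = c then if b = c then M a b * s * cnj s else 0 else 0)
        = M c c * s * cnj s"
      by (subst sum.swap) simp
    ultimately show ?thesis
      unfolding sesq_def sum.distrib by simp
  qed
  also have "(\<Sum>a\<in>UNIV. M a c * x a * cnj s) = cnj s * L x c"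
    unfolding L_def sum_distrib_left by (simp add: mult_ac)
  also have "(\<Sum>b\<in>UNIV. M c b * s * cnj (x b)) = s * cnj (L x c)"
    unfolding 1 sum_distrib_left by (simp add: mult_ac)
  finally show ?thesis by (simp add: algebra_simps)
qed

lemma sesq_zero [simp]: "sesq M (\<lambda>a. 0) = 0"
  by (simp add: sesq_def)

text \<open>With \<open>M c c = 0\<close> there is no quadratic term in the coordinate
  \<open>c\<close>, so a nonzero entry of that column lets the form become negative.\<close>

lemma hermitian_psd_zero_diag:
  assumes herm: "\<And>a b. M b a = cnj (M a b)" and psd: "\<And>x. 0 \<le> Re (sesq M x)"
    and 0: "M c c = 0"
  shows "M b c = 0"
proof (rule ccontr)
  assume nz: "M b c \<noteq> 0"
  define x where "x = (\<lambda>a. if a = b then (1::complex) else 0)"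
  define r where "r = Re (M b b) + 1"
  \<comment> \<open>Scaled so that the two cross terms contribute \<open>- 2 * r\<close>, which
    outweighs \<open>M b b = r - 1\<close>.\<close>
  define s where "s = - complex_of_real (r / (cmod (M b c))\<^sup>2) * M b c"
  have L: "(\<Sum>a\<in>UNIV. M a c * x a) = M b c" unfolding x_def
    by (simp add: if_distrib[of "\<lambda>t. _ * t"] cong: if_cong)
  have xb: "sesq M x = M b b"
    using sesq_shift[of M "\<lambda>a. 0" b 1, OF herm] unfolding x_def by simp
  have rr: "0 < r" using psd[of x] unfolding xb r_def by simp
  have "cnj s * M b c = - of_real r"
    using nz unfolding s_def
    by (simp add: complex_norm_square[symmetric] mult.commute[of "cnj _"] mult.assoc power2_eq_square)
  then have "Re (cnj s * M b c) = - r" by simp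
  moreover have "Re (s * cnj (M b c)) = Re (cnj s * M b c)"
    by simp
  ultimately have "Re (sesq M (\<lambda>a. x a + (if a = c then s else 0))) = Re (M b b) - 2 * r"
    using sesq_shift[of M x c s, OF herm] 0 unfolding L xb by simp
  then show False using psd[of "\<lambda>a. x a + (if a = c then s else 0)"] rr r_def by linarith
qed

text \<open>Cholesky factorisation by induction: splitting off a rank-one part at a nonzero diagonal
  entry leaves a semidefinite Schur complement with fewer nonzero diagonal entries.\<close>

lemma hermitian_psd_gram:
  fixes M :: "'a::finite \<Rightarrow> 'a \<Rightarrow> complex"
  assumes "\<And>a b. M b a = cnj (M a b)" and "\<And>x. 0 \<le> Re (sesq M x)"
  shows "\<exists>N v. \<forall>a b. M a b = (\<Sum>r<(N::nat). v r a * cnj (v r b))"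
  using assms
proof (induction "card {a. M a a \<noteq> 0}" arbitrary: M rule: less_induct)
  case less
  note herm = less.prems(1) and psd = less.prems(2)
  show ?case
  proof (cases "\<forall>c. M c c = 0")
    case True
    then have "M a b = 0" for a b using hermitian_psd_zero_diag[OF herm psd] by blast
    then show ?thesis by (intro exI[of _ 0]) simp
  next
    case False
    then obtain c where c: "M c c \<noteq> 0" by blast
    define d where "d = Re (M c c)"
    have Mcc: "M c c = of_real d"
      using herm[of c c] unfolding d_def by (simp add: complex_eq_iff)
    have "sesq M (\<lambda>a. 0 + (if a = c then 1 else 0)) = M c c"
      using sesq_shift[of M "\<lambda>a. 0" c 1, OF herm] by simp
    then have d: "d > 0" using psd[of "\<lambda>a. 0 + (if a = c then 1 else 0)"] c Mcc
      by (cases "d = 0") auto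
    define M' where "M' = (\<lambda>a b. M a b - M a c * M c b / of_real d)"
    have herm': "M' b a = cnj (M' a b)" for a b
      using herm[of a b] herm[of c a] herm[of b c] unfolding M'_def by (simp add: mult_ac)
    have psd': "0 \<le> Re (sesq M' x)" for x
    proof -
      define L where "L = (\<Sum>a\<in>UNIV. M a c * x a)"
      have cL: "cnj L = (\<Sum>b\<in>UNIV. M c b * cnj (x b))"
        unfolding L_def by (simp add: herm[symmetric])
      have "sesq M' x = sesq M x - L * cnj L / of_real d"
      proof -
        have "sesq M' x = (\<Sum>a\<in>UNIV. \<Sum>b\<in>UNIV. M a b * x a * cnj (x b)
            - (M a c * x a) * (M c b * cnj (x b)) / of_real d)"
          unfolding sesq_def M'_def
          by (intro sum.cong refl) (simp add: algebra_simps)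
        then show ?thesis
          unfolding cL unfolding L_def sum_product sesq_def sum_divide_distrib sum_subtractf .
      qed
      \<comment> \<open>The Schur complement at \<open>x\<close> is the value of \<open>M\<close> at
        \<open>x\<close> with coordinate \<open>c\<close> shifted to the minimiser, hence
        nonnegative.\<close>
      also have "\<dots> = sesq M (\<lambda>a. x a + (if a = c then - L / of_real d else 0))"
        using sesq_shift[of M x c "- L / of_real d", OF herm] d
        unfolding L_def[symmetric] Mcc by (simp add: field_simps)
      finally show ?thesis using psd by simp
    qed
    have "{a. M' a a \<noteq> 0} \<subseteq> {a. M a a \<noteq> 0} - {c}"
    proof -
      have "M' c c = 0" unfolding M'_def Mcc using d by simp
      moreover have "M' a a = 0" if "M a a = 0" for a
        using hermitian_psd_zero_diag[OF herm psd that, of c] that unfolding M'_def by simp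
      ultimately show ?thesis by auto
    qed
    then have "card {a. M' a a \<noteq> 0} < card {a. M a a \<noteq> 0}"
      using c by (intro psubset_card_mono) auto
    from less.hyps[OF this herm' psd'] obtain N v
      where v: "\<And>a b. M' a b = (\<Sum>r<(N::nat). v r a * cnj (v r b))" by blast
    define v' where "v' = (\<lambda>r. if r < N then v r else (\<lambda>a. M a c / of_real (sqrt d)))"
    have "M a b = (\<Sum>r<Suc N. v' r a * cnj (v' r b))" for a b
    proof -
      have "M a c / of_real (sqrt d) * cnj (M b c / of_real (sqrt d)) = M a c * M c b / of_real d"
        using herm[of b c] d by (simp flip: of_real_mult)
      then have "(\<Sum>r<Suc N. v' r a * cnj (v' r b))
          = (\<Sum>r<N. v r a * cnj (v r b)) + M a c * M c b / of_real d"
        by (simp add: v'_def)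
      then show ?thesis unfolding v[symmetric] M'_def by simp
    qed
    then show ?thesis by blast
  qed
qed

text \<open>In terms of a Gram representation \<open>(a, b)\<close> of \<open>M\<close> and \<open>x\<^sub>r\<^sub>s = \<Sum>p. a\<^sub>r\<^sub>p b\<^sub>s\<^sub>p\<close>, the real
  part below is half the sum of \<open>\<bar>x\<^sub>r\<^sub>s - x\<^sub>s\<^sub>r\<bar>\<^sup>2\<close>.\<close>

lemma hermitian_psd_block_trace:
  fixes M :: "'n::finite + 'n \<Rightarrow> 'n + 'n \<Rightarrow> complex"
  assumes "\<And>a b. M b a = cnj (M a b)" and "\<And>x. 0 \<le> Re (sesq M x)"
  shows "0 \<le> Re (\<Sum>p\<in>UNIV. \<Sum>q\<in>UNIV. M (Inl p) (Inl q) * M (Inr p) (Inr q)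
                 - M (Inl p) (Inr q) * cnj (M (Inl q) (Inr p)))"
proof -
  obtain N v where v: "\<And>a b. M a b = (\<Sum>r<(N::nat). v r a * cnj (v r b))"
    using hermitian_psd_gram[OF assms] by blast
  define x where "x r s = (\<Sum>p\<in>UNIV. v r (Inl p) * v s (Inr p))" for r s
  have 1: "(\<Sum>p\<in>UNIV. \<Sum>q\<in>UNIV. M (Inl p) (Inl q) * M (Inr p) (Inr q))
     = (\<Sum>r<N. \<Sum>s<N. x r s * cnj (x r s))"
  proof -
    have "(\<Sum>p\<in>UNIV. \<Sum>q\<in>UNIV. M (Inl p) (Inl q) * M (Inr p) (Inr q))
      = (\<Sum>p\<in>UNIV. \<Sum>q\<in>UNIV. \<Sum>r<N. \<Sum>s<N. (v r (Inl p) * v s (Inr p)) * cnj (v r (Inl q) * v s (Inr q)))"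
      unfolding v sum_product by (simp add: mult_ac)
    also have "\<dots> = (\<Sum>r<N. \<Sum>s<N. x r s * cnj (x r s))"
      unfolding x_def cnj_sum sum_product by (rule sum_swap_4)
    finally show ?thesis .
  qed
  have 2: "(\<Sum>p\<in>UNIV. \<Sum>q\<in>UNIV. M (Inl p) (Inr q) * cnj (M (Inl q) (Inr p)))
     = (\<Sum>r<N. \<Sum>s<N. x r s * cnj (x s r))"
  proof -
    have "(\<Sum>p\<in>UNIV. \<Sum>q\<in>UNIV. M (Inl p) (Inr q) * cnj (M (Inl q) (Inr p)))
      = (\<Sum>p\<in>UNIV. \<Sum>q\<in>UNIV. \<Sum>r<N. \<Sum>s<N. (v r (Inl p) * v s (Inr p)) * cnj (v s (Inl q) * v r (Inr q)))"
      unfolding v cnj_sum sum_product by (simp add: mult_ac)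
    also have "\<dots> = (\<Sum>r<N. \<Sum>s<N. x r s * cnj (x s r))"
      unfolding x_def cnj_sum sum_product by (rule sum_swap_4)
    finally show ?thesis .
  qed
  have "Re (x r s * cnj (x s r)) \<le> ((cmod (x r s))\<^sup>2 + (cmod (x s r))\<^sup>2) / 2" for r s
  proof -
    have "Re (x r s * cnj (x s r)) \<le> cmod (x r s) * cmod (x s r)"
      by (metis complex_Re_le_cmod complex_mod_cnj norm_mult)
    moreover have "0 \<le> (cmod (x r s) - cmod (x s r))\<^sup>2" by simp
    ultimately show ?thesis by (simp add: power2_diff)
  qed
  then have "(\<Sum>r<N. \<Sum>s<N. Re (x r s * cnj (x s r)))
      \<le> (\<Sum>r<N. \<Sum>s<N. ((cmod (x r s))\<^sup>2 + (cmod (x s r))\<^sup>2) / 2)"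
    by (intro sum_mono)
  also have "\<dots> = (\<Sum>r<N. \<Sum>s<N. (cmod (x r s))\<^sup>2)"
  proof -
    have "(\<Sum>r<N. \<Sum>s<N. (cmod (x s r))\<^sup>2) = (\<Sum>r<N. \<Sum>s<N. (cmod (x r s))\<^sup>2)"
      by (rule sum.swap)
    then show ?thesis by (simp add: add_divide_distrib sum.distrib flip: sum_divide_distrib)
  qed
  also have "\<dots> = Re (\<Sum>r<N. \<Sum>s<N. x r s * cnj (x r s))"
    by (simp add: complex_norm_square[symmetric] flip: of_real_power)
  finally have "0 \<le> Re ((\<Sum>r<N. \<Sum>s<N. x r s * cnj (x r s)) - (\<Sum>r<N. \<Sum>s<N. x r s * cnj (x s r)))"
    by simp
  then show ?thesis unfolding 1[symmetric] 2[symmetric] by (simp only: sum_subtractf)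
qed

section \<open>Algebra of curvature tensors\<close>

lemma Bq_nth: "Bq S T $ (i,j,k,l) =
      (1/2) * (\<Sum>p\<in>UNIV. \<Sum>q\<in>UNIV. S$(i,j,p,q) * T$(k,l,p,q) + S$(k,l,p,q) * T$(i,j,p,q))
    + (\<Sum>p\<in>UNIV. \<Sum>q\<in>UNIV. S$(i,p,k,q) * T$(j,p,l,q) - S$(i,p,l,q) * T$(j,p,k,q)
                            - S$(j,p,k,q) * T$(i,p,l,q) + S$(j,p,l,q) * T$(i,p,k,q))"
  by (simp add: Bq_def)

lemma odot_nth: "odot A B $ (i,j,k,l) = A$i$k * B$j$l - A$i$l * B$j$k - A$j$k * B$i$l + A$j$l * B$i$k"
  by (simp add: odot_def)

lemma odot_commute: "odot A B = odot B A"
  by (simp add: vec_eq_iff odot_nth)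

lemma odot_add_left: "odot (A + B) C = odot A C + odot B C"
  and odot_diff_left: "odot (A - B) C = odot A C - odot B C"
  and odot_scaleR_left: "odot (c *\<^sub>R A) C = c *\<^sub>R odot A C"
  by (simp_all add: vec_eq_iff odot_nth algebra_simps)

lemma odot_diff_right: "odot C (A - B) = odot C A - odot C B"
  and odot_scaleR_right: "odot C (c *\<^sub>R A) = c *\<^sub>R odot C A"
  by (simp_all add: vec_eq_iff odot_nth algebra_simps)

lemma Bq_commute: "Bq S T = Bq T S"
  by (simp add: vec_eq_iff Bq_nth add_ac mult_ac) (simp add: sum.distrib sum_subtractf mult_ac)

lemma bilinear_Bq: "bilinear (Bq :: 'n::finite tensor4 \<Rightarrow> 'n tensor4 \<Rightarrow> 'n tensor4)"
proof -
  have lin: "linear (Bq S)" for S :: "'n tensor4"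
  proof (rule linearI)
    show "Bq S (T + U) = Bq S T + Bq S U" for T U
      by (simp add: vec_eq_iff Bq_nth ring_distribs sum.distrib sum_subtractf)
    show "Bq S (c *\<^sub>R T) = c *\<^sub>R Bq S T" for T c
      by (simp add: vec_eq_iff Bq_nth ring_distribs sum.distrib sum_subtractf sum_distrib_left mult_ac)
  qed
  moreover have "(\<lambda>S. Bq S T) = Bq T" for T :: "'n tensor4"
    by (simp add: fun_eq_iff Bq_commute[of _ T])
  ultimately show ?thesis unfolding bilinear_def by simp
qed

lemma Qmap_add: "Qmap (S + T) = Qmap S + 2 *\<^sub>R Bq S T + Qmap T"
proof -
  note b = bilinear_Bq
  show ?thesis
    unfolding Qmap_def
    by (simp add: bilinear_ladd[OF b] bilinear_radd[OF b] Bq_commute[of T S] scaleR_2)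
qed

lemma Qmap_lipschitz_on_bounded:
  "\<exists>L. \<forall>x y :: 'n::finite tensor4. norm x \<le> B \<longrightarrow> norm y \<le> B \<longrightarrow> norm (Qmap x - Qmap y) \<le> L * norm (x - y)"
proof -
  interpret bounded_bilinear "Bq :: 'n tensor4 \<Rightarrow> 'n tensor4 \<Rightarrow> 'n tensor4"
    using bilinear_Bq bilinear_conv_bounded_bilinear by blast
  obtain C where C: "0 \<le> C" "\<And>a b :: 'n tensor4. norm (Bq a b) \<le> norm a * norm b * C"
    using nonneg_bounded by blast
  show ?thesis
  proof (intro exI allI impI)
    fix x y :: "'n tensor4" assume B: "norm x \<le> B" "norm y \<le> B"
    have "Qmap x - Qmap y = Bq (x - y) x + Bq y (x - y)"
      by (simp add: Qmap_def diff_left diff_right)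
    then have "norm (Qmap x - Qmap y) \<le> norm (x - y) * norm x * C + norm y * norm (x - y) * C"
      using C(2)[of "x - y" x] C(2)[of y "x - y"]
      by (simp add: order_trans[OF norm_triangle_ineq add_mono])
    also have "\<dots> \<le> norm (x - y) * B * C + B * norm (x - y) * C"
      using B C(1) order_trans[OF norm_ge_zero B(1)] by (intro add_mono mult_mono mult_nonneg_nonneg) auto
    finally show "norm (Qmap x - Qmap y) \<le> (2 * B * C) * norm (x - y)"
      by (simp add: algebra_simps)
  qed
qed

lemma acurvD:
  assumes "acurv R"
  shows "R $ (j,i,k,l) = - R $ (i,j,k,l)" "R $ (i,j,l,k) = - R $ (i,j,k,l)" "R $ (k,l,i,j) = R $ (i,j,k,l)"
    "R $ (i,j,k,l) + R $ (j,k,i,l) + R $ (k,i,j,l) = 0"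
proof -
  have 1: "R $ (i,j,k,l) = - R $ (j,i,k,l)" "R $ (i,j,k,l) = R $ (k,l,i,j)"
    "R $ (i,j,k,l) + R $ (j,k,i,l) + R $ (k,i,j,l) = 0" for i j k l
    using assms unfolding acurv_def by blast+
  show "R $ (j,i,k,l) = - R $ (i,j,k,l)" "R $ (k,l,i,j) = R $ (i,j,k,l)"
    "R $ (i,j,k,l) + R $ (j,k,i,l) + R $ (k,i,j,l) = 0"
    using 1(1)[of i j k l] 1(2)[of i j k l] 1(3)[of i j k l] by auto
  show "R $ (i,j,l,k) = - R $ (i,j,k,l)"
    using 1(2)[of i j l k] 1(1)[of l k i j] 1(2)[of i j k l] by simp
qed

lemma acurv_add:
  assumes "acurv S" "acurv T"
  shows "acurv (S + T)"
  unfolding acurv_def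
proof (intro allI)
  fix i j k l
  note * = assms[unfolded acurv_def, rule_format, of i j k l]
  show "(S + T) $ (i,j,k,l) = - (S + T) $ (j,i,k,l) \<and> (S + T) $ (i,j,k,l) = (S + T) $ (k,l,i,j) \<and>
    (S + T) $ (i,j,k,l) + (S + T) $ (j,k,i,l) + (S + T) $ (k,i,j,l) = 0"
    using * unfolding vector_add_component by linarith
qed

lemma acurv_scaleR:
  assumes "acurv S"
  shows "acurv (c *\<^sub>R S)"
  unfolding acurv_def
proof (intro allI)
  fix i j k l
  note * = assms[unfolded acurv_def, rule_format, of i j k l]
  have "c * (S $ (i,j,k,l) + S $ (j,k,i,l) + S $ (k,i,j,l)) = 0" using * by simp
  then show "(c *\<^sub>R S) $ (i,j,k,l) = - (c *\<^sub>R S) $ (j,i,k,l) \<and> (c *\<^sub>R S) $ (i,j,k,l) = (c *\<^sub>R S) $ (k,l,i,j) \<and>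
    (c *\<^sub>R S) $ (i,j,k,l) + (c *\<^sub>R S) $ (j,k,i,l) + (c *\<^sub>R S) $ (k,i,j,l) = 0"
    using * by (simp only: vector_scaleR_component distrib_left) auto
qed

lemma subspace_ACT: "subspace ACT"
proof -
  have "acurv 0" by (simp add: acurv_def)
  then show ?thesis unfolding subspace_def ACT_def by (simp add: acurv_add acurv_scaleR)
qed

lemma transpose_eq_nth: "transpose A = A \<longleftrightarrow> (\<forall>i j. A $ i $ j = A $ j $ i)"
  by (auto simp: vec_eq_iff transpose_def)

lemma acurv_odot:
  assumes "transpose A = A" "transpose B = B"
  shows "acurv (odot A B)"
proof -
  have s: "A $ i $ j = A $ j $ i" "B $ i $ j = B $ j $ i" for i j
    using assms unfolding transpose_eq_nth by blast+
  show ?thesis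
    unfolding acurv_def odot_nth
  proof (intro allI conjI)
    fix i j k l
    show "A$i$k * B$j$l - A$i$l * B$j$k - A$j$k * B$i$l + A$j$l * B$i$k =
      - (A$j$k * B$i$l - A$j$l * B$i$k - A$i$k * B$j$l + A$i$l * B$j$k)" by simp
    show "A$i$k * B$j$l - A$i$l * B$j$k - A$j$k * B$i$l + A$j$l * B$i$k =
      A$k$i * B$l$j - A$k$j * B$l$i - A$l$i * B$k$j + A$l$j * B$k$i"
      by (simp add: s[of k] s[of l])
    show "A$i$k * B$j$l - A$i$l * B$j$k - A$j$k * B$i$l + A$j$l * B$i$k +
      (A$j$i * B$k$l - A$j$l * B$k$i - A$k$i * B$j$l + A$k$l * B$j$i) +
      (A$k$j * B$i$l - A$k$l * B$i$j - A$i$j * B$k$l + A$i$l * B$k$j) = 0"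
      by (simp add: s[of k i] s[of k j] s[of j i])
  qed
qed

lemma sum_mult_mat1:
  fixes f :: "'n::finite \<Rightarrow> real"
  shows "(\<Sum>q\<in>UNIV. f q * mat 1 $ l $ q) = f l" "(\<Sum>q\<in>UNIV. f q * mat 1 $ q $ l) = f l"
  by (simp_all add: mat_def if_distrib[of "\<lambda>x. _ * x"] cong: if_cong)

lemma sum_sum_mult_mat1:
  fixes f :: "'n::finite \<Rightarrow> 'n \<Rightarrow> real"
  shows "(\<Sum>p\<in>UNIV. \<Sum>q\<in>UNIV. f p q * mat 1 $ l $ q) = (\<Sum>p\<in>UNIV. f p l)"
    "(\<Sum>p\<in>UNIV. \<Sum>q\<in>UNIV. f p q * mat 1 $ l $ p) = (\<Sum>q\<in>UNIV. f l q)"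
    "(\<Sum>p\<in>UNIV. \<Sum>q\<in>UNIV. f p q * mat 1 $ p $ l) = (\<Sum>q\<in>UNIV. f l q)"
    "(\<Sum>p\<in>UNIV. \<Sum>q\<in>UNIV. f p q * mat 1 $ p $ q) = (\<Sum>p\<in>UNIV. f p p)"
  by (simp_all add: sum_mult_mat1 flip: sum_distrib_right)

section \<open>The tensor Q(S + H odot id)\<close>

text \<open>The usual action of a curvature tensor on symmetric forms, as in the Lichnerowicz
  Laplacian.\<close>

definition curv_act :: "'n::finite tensor4 \<Rightarrow> real^'n^'n \<Rightarrow> real^'n^'n" where
  "curv_act S H = (\<chi> i k. \<Sum>p\<in>UNIV. \<Sum>q\<in>UNIV. S $ (i,p,k,q) * H $ p $ q)"

lemma half_sum_double: "1 / 2 * ((2 * a - 2 * b) + (2 * c - 2 * d)) = a - b + (c - d)" for a :: real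
  by simp

text \<open>Besides the Ricci and \<open>curv_act\<close> terms, twelve contractions
  \<open>E\<close> appear; they cancel in triples through four instances of the first Bianchi
  identity.\<close>

lemma Bq_odot_id:
  fixes S :: "'n::finite tensor4"
  assumes S: "acurv S" and H: "transpose H = H"
  shows "Bq S (odot H (mat 1)) = odot (Ric S) H + odot (curv_act S H) (mat 1)"
proof -
  let ?I = "mat 1 :: real^'n^'n"
  have h: "H $ i $ j = H $ j $ i" for i j using H unfolding transpose_eq_nth by blast
  define E where "E i j k m = (\<Sum>p\<in>UNIV. S $ (i,j,k,p) * H $ p $ m)" for i j k m
  have bianchi: "E i j k m + E j k i m + E k i j m = 0" for i j k m
    unfolding E_def sum.distrib[symmetric] distrib_right[symmetric]
    by (simp add: acurvD(4)[OF S])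
  have anti: "E j i k m = - E i j k m" for i j k m
    unfolding E_def by (simp add: acurvD(1)[OF S, of j i] sum_negf)
  have a: "(\<Sum>p\<in>UNIV. \<Sum>q\<in>UNIV. S$(i,j,p,q) * odot H ?I $ (k,l,p,q)) = 2 * E i j k l - 2 * E i j l k" for i j k l
  proof -
    have "(\<Sum>p\<in>UNIV. \<Sum>q\<in>UNIV. S$(i,j,p,q) * odot H ?I $ (k,l,p,q)) =
      (\<Sum>p\<in>UNIV. \<Sum>q\<in>UNIV. (S$(i,j,p,q) * H$k$p) * ?I$l$q - (S$(i,j,p,q) * H$k$q) * ?I$l$p
         - (S$(i,j,p,q) * H$l$p) * ?I$k$q + (S$(i,j,p,q) * H$l$q) * ?I$k$p)"
      unfolding odot_nth by (simp add: algebra_simps)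
    also have "\<dots> = (\<Sum>p\<in>UNIV. S$(i,j,p,l) * H$k$p) - (\<Sum>q\<in>UNIV. S$(i,j,l,q) * H$k$q)
         - (\<Sum>p\<in>UNIV. S$(i,j,p,k) * H$l$p) + (\<Sum>q\<in>UNIV. S$(i,j,k,q) * H$l$q)"
      by (simp only: sum.distrib sum_subtractf sum_sum_mult_mat1)
    also have "\<dots> = 2 * E i j k l - 2 * E i j l k"
      unfolding E_def
      by (simp add: h[of k] h[of l] acurvD(2)[OF S, where l = l] acurvD(2)[OF S, where l = k] sum_negf)
    finally show ?thesis .
  qed
  have b: "(\<Sum>p\<in>UNIV. \<Sum>q\<in>UNIV. S$(i,p,k,q) * odot H ?I $ (j,p,l,q)) =
      Ric S $ i $ k * H$j$l + curv_act S H $ i $ k * ?I$j$l - E i l k j - E k j i l" for i j k l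
  proof -
    have "(\<Sum>p\<in>UNIV. \<Sum>q\<in>UNIV. S$(i,p,k,q) * odot H ?I $ (j,p,l,q)) =
      (\<Sum>p\<in>UNIV. \<Sum>q\<in>UNIV. (S$(i,p,k,q) * H$j$l) * ?I$p$q - (S$(i,p,k,q) * H$j$q) * ?I$p$l
         - (S$(i,p,k,q) * H$p$l) * ?I$j$q + (S$(i,p,k,q) * H$p$q) * ?I$j$l)"
      unfolding odot_nth by (simp add: algebra_simps)
    also have "\<dots> = (\<Sum>p\<in>UNIV. S$(i,p,k,p) * H$j$l) - (\<Sum>q\<in>UNIV. S$(i,l,k,q) * H$j$q)
         - (\<Sum>p\<in>UNIV. S$(i,p,k,j) * H$p$l) + (\<Sum>p\<in>UNIV. \<Sum>q\<in>UNIV. (S$(i,p,k,q) * H$p$q) * ?I$j$l)"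
      by (simp only: sum.distrib sum_subtractf sum_sum_mult_mat1)
    also have "(\<Sum>p\<in>UNIV. \<Sum>q\<in>UNIV. (S$(i,p,k,q) * H$p$q) * ?I$j$l) = curv_act S H $ i $ k * ?I$j$l"
      unfolding curv_act_def by (simp add: sum_distrib_right)
    also have "(\<Sum>p\<in>UNIV. S$(i,p,k,p) * H$j$l) = Ric S $ i $ k * H$j$l"
      unfolding Ric_def by (simp add: sum_distrib_right)
    also have "(\<Sum>q\<in>UNIV. S$(i,l,k,q) * H$j$q) = E i l k j"
      unfolding E_def by (simp add: h[of j])
    also have "(\<Sum>p\<in>UNIV. S$(i,p,k,j) * H$p$l) = E k j i l"
      unfolding E_def by (simp add: acurvD(3)[OF S, of _ _ k j])
    finally show ?thesis by simp
  qed
  have "Bq S (odot H ?I) $ (i,j,k,l) = (odot (Ric S) H + odot (curv_act S H) ?I) $ (i,j,k,l)" for i j k l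
  proof -
    have "Bq S (odot H ?I) $ (i,j,k,l) = (1/2) * ((2 * E i j k l - 2 * E i j l k) + (2 * E k l i j - 2 * E k l j i))
      + ((Ric S $ i $ k * H$j$l + curv_act S H $ i $ k * ?I$j$l - E i l k j - E k j i l)
       - (Ric S $ i $ l * H$j$k + curv_act S H $ i $ l * ?I$j$k - E i k l j - E l j i k)
       - (Ric S $ j $ k * H$i$l + curv_act S H $ j $ k * ?I$i$l - E j l k i - E k i j l)
       + (Ric S $ j $ l * H$i$k + curv_act S H $ j $ l * ?I$i$k - E j k l i - E l i j k))"
      unfolding Bq_nth by (simp only: sum.distrib sum_subtractf a b)
    also have "\<dots> = (odot (Ric S) H + odot (curv_act S H) ?I) $ (i,j,k,l)"
      using bianchi[of i j k l] anti[of j k i l] bianchi[of i j l k] anti[of j l i k]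
        bianchi[of k l i j] anti[of l i k j] bianchi[of k l j i] anti[of l j k i]
      unfolding odot_nth vector_add_component half_sum_double by linarith
    finally show ?thesis .
  qed
  then show ?thesis by (simp add: vec_eq_iff)
qed

lemma Ric_add: "Ric (S + T) = Ric S + Ric T"
  and Ric_diff: "Ric (S - T) = Ric S - Ric T"
  and Ric_scaleR: "Ric (c *\<^sub>R S) = c *\<^sub>R Ric S"
  by (simp_all add: Ric_def vec_eq_iff sum.distrib sum_subtractf sum_distrib_left)

lemma scal_eq_trace: "scal S = trace (Ric S)"
  by (simp add: scal_def trace_def)

lemma trace_scaleR: "trace (c *\<^sub>R A) = c * trace (A :: real^'n^'n)"
  by (simp add: trace_def sum_distrib_left)

lemma trace_mat1: "trace (mat 1 :: real^'n^'n) = real CARD('n)"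
  by (simp add: trace_def mat_def)

lemma scal_add: "scal (S + T) = scal S + scal T"
  and scal_scaleR: "scal (c *\<^sub>R S) = c * scal S"
  by (simp_all add: scal_eq_trace Ric_add Ric_diff Ric_scaleR trace_add trace_sub trace_scaleR)

lemma Ric_odot:
  assumes B: "transpose B = B"
  shows "Ric (odot A B) = trace B *\<^sub>R A + trace A *\<^sub>R B - A ** B - B ** A"
proof -
  have s: "B $ i $ j = B $ j $ i" for i j using B unfolding transpose_eq_nth by blast
  show ?thesis
    unfolding vec_eq_iff Ric_def odot_nth trace_def matrix_matrix_mult_def
    using s by (auto simp: sum.distrib sum_subtractf sum_distrib_left mult.commute)
qed

lemma Ric_odot_id: "Ric (odot A (mat 1 :: real^'n::finite^'n)) = (real CARD('n) - 2) *\<^sub>R A + trace A *\<^sub>R mat 1"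
  by (subst Ric_odot) (auto simp: trace_mat1 algebra_simps scaleR_2)

lemma scal_odot_id: "scal (odot A (mat 1 :: real^'n::finite^'n)) = 2 * (real CARD('n) - 1) * trace A"
  by (simp add: scal_eq_trace Ric_odot_id trace_add trace_scaleR trace_mat1) (simp add: algebra_simps)

lemma curv_act_odot_id:
  assumes H: "transpose H = H"
  shows "curv_act (odot H (mat 1)) H = trace H *\<^sub>R H - 2 *\<^sub>R (H ** H) + trace (H ** H) *\<^sub>R mat 1"
proof -
  let ?I = "mat 1 :: real^'n^'n"
  have h: "H $ i $ j = H $ j $ i" for i j using H unfolding transpose_eq_nth by blast
  have "curv_act (odot H ?I) H $ i $ k =
     (trace H *\<^sub>R H - 2 *\<^sub>R (H ** H) + trace (H ** H) *\<^sub>R ?I) $ i $ k" for i k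
  proof -
    have "curv_act (odot H ?I) H $ i $ k = (\<Sum>p\<in>UNIV. \<Sum>q\<in>UNIV. (H$i$k * H$p$q) * ?I$p$q
       - (H$i$q * H$p$q) * ?I$p$k - (H$p$k * H$p$q) * ?I$i$q + (H$p$q * H$p$q) * ?I$i$k)"
      unfolding curv_act_def odot_nth by (simp add: algebra_simps)
    also have "\<dots> = (\<Sum>p\<in>UNIV. H$i$k * H$p$p) - (\<Sum>q\<in>UNIV. H$i$q * H$k$q)
       - (\<Sum>p\<in>UNIV. H$p$k * H$p$i) + (\<Sum>p\<in>UNIV. \<Sum>q\<in>UNIV. (H$p$q * H$p$q) * ?I$i$k)"
      by (simp only: sum.distrib sum_subtractf sum_sum_mult_mat1)
    also have "(\<Sum>p\<in>UNIV. \<Sum>q\<in>UNIV. (H$p$q * H$p$q) * ?I$i$k) = trace (H ** H) * ?I$i$k"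
      unfolding trace_def matrix_matrix_mult_def using h by (simp add: sum_distrib_right)
    also have "(\<Sum>p\<in>UNIV. H$i$k * H$p$p) = trace H * H$i$k"
      unfolding trace_def by (simp add: sum_distrib_left mult.commute)
    also have "(\<Sum>q\<in>UNIV. H$i$q * H$k$q) = (H ** H) $ i $ k"
      unfolding matrix_matrix_mult_def using h[of k] by simp
    also have "(\<Sum>p\<in>UNIV. H$p$k * H$p$i) = (H ** H) $ i $ k"
      unfolding matrix_matrix_mult_def using h[of i] by (simp add: mult.commute)
    finally show ?thesis by simp
  qed
  then show ?thesis by (simp add: vec_eq_iff)
qed

text \<open>Polarisation of \<open>Qmap\<close>. The mixed term and the pure term in
  \<open>H\<close> both come from \<open>Bq_odot_id\<close>, the latter with
  \<open>odot H id\<close> in the role of \<open>S\<close>.\<close>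

lemma Qmap_add_odot_id:
  fixes S :: "'n::finite tensor4"
  assumes S: "acurv S" and H: "transpose H = H"
  shows "Qmap (S + odot H (mat 1)) = Qmap S + 2 *\<^sub>R odot (Ric S) H
    + (real CARD('n) - 2) *\<^sub>R odot H H
    + odot (2 *\<^sub>R curv_act S H + (2 * trace H) *\<^sub>R H - 2 *\<^sub>R (H ** H) + trace (H ** H) *\<^sub>R mat 1) (mat 1)"
proof -
  let ?U = "odot H (mat 1)"
  have "Qmap ?U = odot (Ric ?U) H + odot (curv_act ?U H) (mat 1)"
    unfolding Qmap_def using acurv_odot[OF H] H by (intro Bq_odot_id) auto
  then show ?thesis
    unfolding Qmap_add Bq_odot_id[OF S H] Ric_odot_id curv_act_odot_id[OF H]
    by (simp only: odot_add_left odot_diff_left odot_scaleR_left odot_commute[of "mat 1" H])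
       (simp add: vec_eq_iff algebra_simps)
qed

section \<open>Hamilton's contraction and the Ricci part of Q\<close>

text \<open>The contraction that Hamilton denotes by B. Its symmetries reduce the algebraic
  identities for \<open>Qmap\<close> to linear relations.\<close>

definition quad :: "'n::finite tensor4 \<Rightarrow> 'n \<Rightarrow> 'n \<Rightarrow> 'n \<Rightarrow> 'n \<Rightarrow> real" where
  "quad R i j k l = (\<Sum>p\<in>UNIV. \<Sum>q\<in>UNIV. R$(i,p,j,q) * R$(k,p,l,q))"

lemma quad_sym:
  assumes "acurv R"
  shows "quad R k l i j = quad R i j k l" "quad R j i l k = quad R i j k l"
proof -
  show "quad R k l i j = quad R i j k l"
    unfolding quad_def by (simp add: mult.commute)
  have r: "R $ (j, p, i, q) = R $ (i, q, j, p)" for i j p q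
    using acurvD(3)[OF assms] by metis
  have "quad R j i l k = (\<Sum>p\<in>UNIV. \<Sum>q\<in>UNIV. R$(i,q,j,p) * R$(k,q,l,p))"
    unfolding quad_def by (simp add: r[of j _ i] r[of l _ k])
  also have "\<dots> = quad R i j k l" unfolding quad_def by (rule sum.swap)
  finally show "quad R j i l k = quad R i j k l" .
qed

text \<open>The first Bianchi identity gives \<open>R_ijpq = R_ipjq - R_iqjp\<close>; expanding both
  factors this way expresses the square of the curvature operator through
  \<open>quad\<close>.\<close>

lemma sum_square_acurv:
  assumes R: "acurv R"
  shows "(\<Sum>p\<in>UNIV. \<Sum>q\<in>UNIV. R$(i,j,p,q) * R$(k,l,p,q)) = 2 * quad R i j k l - 2 * quad R i j l k"
proof -
  have r: "R $ (i,j,p,q) = R $ (i,p,j,q) - R $ (i,q,j,p)" for i j p q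
    using acurvD(4)[OF R, of i j p q] acurvD(1)[OF R, of p i j q] acurvD(3)[OF R, of j p i q] by linarith
  have r2: "R $ (j, p, i, q) = R $ (i, q, j, p)" for i j p q
    using acurvD(3)[OF R] by metis
  have "(\<Sum>p\<in>UNIV. \<Sum>q\<in>UNIV. R$(i,j,p,q) * R$(k,l,p,q)) =
     (\<Sum>p\<in>UNIV. \<Sum>q\<in>UNIV. R$(i,p,j,q) * R$(k,p,l,q) + R$(i,q,j,p) * R$(k,q,l,p)
        - R$(i,p,j,q) * R$(l,p,k,q) - R$(i,q,j,p) * R$(l,q,k,p))"
    unfolding r[of i j] r[of k l] r2[of k _ l] by (simp add: algebra_simps)
  also have "\<dots> = 2 * quad R i j k l - 2 * quad R i j l k"
  proof -
    have "(\<Sum>p\<in>UNIV. \<Sum>q\<in>UNIV. R$(i,q,j,p) * R$(k,q,l,p)) = quad R i j k l" for k l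
      unfolding quad_def by (rule sum.swap)
    then show ?thesis by (simp add: sum.distrib sum_subtractf) (simp add: quad_def)
  qed
  finally show ?thesis .
qed

lemma Qmap_nth_quad:
  assumes R: "acurv R"
  shows "Qmap R $ (i,j,k,l) = 2 * (quad R i j k l - quad R i j l k + quad R i k j l - quad R i l j k)"
proof -
  have "Qmap R $ (i,j,k,l) = (1/2) * ((2 * quad R i j k l - 2 * quad R i j l k) + (2 * quad R k l i j - 2 * quad R k l j i))
      + (quad R i k j l - quad R i l j k - quad R j k i l + quad R j l i k)"
    unfolding Qmap_def Bq_nth by (simp only: sum.distrib sum_subtractf sum_square_acurv[OF R] quad_def[symmetric])
  then show ?thesis
    using quad_sym(1)[OF R, of k l i j] quad_sym(1)[OF R, of k l j i] quad_sym(2)[OF R, of j i k l]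
      quad_sym(1)[OF R, of j k i l] quad_sym(1)[OF R, of j l i k]
    unfolding half_sum_double by simp
qed

lemma acurv_Qmap:
  assumes R: "acurv R"
  shows "acurv (Qmap R)"
  unfolding acurv_def Qmap_nth_quad[OF R]
proof (intro allI conjI)
  fix i j k l
  have q: "quad R k l i j = quad R i j k l" "quad R j i l k = quad R i j k l" for i j k l
    by (rule quad_sym[OF R])+
  show "2 * (quad R i j k l - quad R i j l k + quad R i k j l - quad R i l j k) =
     - (2 * (quad R j i k l - quad R j i l k + quad R j k i l - quad R j l i k))"
    using q(2)[of i j k l] q(2)[of i j l k] q(1)[of i k j l] q(1)[of i l j k] by simp
  show "2 * (quad R i j k l - quad R i j l k + quad R i k j l - quad R i l j k) =
     2 * (quad R k l i j - quad R k l j i + quad R k i l j - quad R k j l i)"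
    using q(1)[of i j k l] q(1)[of i j l k] q(2)[of i j l k] q(2)[of i k j l] q(2)[of j k i l] q(1)[of i l j k] q(1)[of j i k l]
    by simp
  show "2 * (quad R i j k l - quad R i j l k + quad R i k j l - quad R i l j k) +
     2 * (quad R j k i l - quad R j k l i + quad R j i k l - quad R j l k i) +
     2 * (quad R k i j l - quad R k i l j + quad R k j i l - quad R k l i j) = 0"
    using q(1)[of i j k l] q(2)[of i j l k] q(2)[of i k l j] q(1)[of i l j k] q(2)[of j k i l] q(2)[of j k l i] q(2)[of i k j l]
      q(1)[of i l k j] q(1)[of j l k i] q(2)[of l j i k] q(1)[of i j l k] q(1)[of k l i j] q(1)[of i k j l] q(2)[of k j i l] q(1)[of j k i l]
    by simp
qed

text \<open>Two of the contractions satisfy \<open>X = 2 X - 2 Y\<close>, so \<open>X - 2 Y\<close>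
  drops out and only the contraction with \<open>Ric\<close> survives. In particular
  \<open>Qmap\<close> sends Einstein tensors to Einstein tensors.\<close>

lemma Ric_Qmap:
  assumes R: "acurv R"
  shows "Ric (Qmap R) = 2 *\<^sub>R curv_act R (Ric R)"
proof -
  have "Ric (Qmap R) $ i $ k = (2 *\<^sub>R curv_act R (Ric R)) $ i $ k" for i k
  proof -
    define X where "X = (\<Sum>j\<in>UNIV. quad R i j k j)"
    define Y where "Y = (\<Sum>j\<in>UNIV. quad R i j j k)"
    have Z: "(\<Sum>j\<in>UNIV. quad R i k j j) = curv_act R (Ric R) $ i $ k"
    proof -
      have "(\<Sum>j\<in>UNIV. quad R i k j j) = (\<Sum>p\<in>UNIV. \<Sum>q\<in>UNIV. \<Sum>j\<in>UNIV. R$(i,p,k,q) * R$(j,p,j,q))"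
        unfolding quad_def by (subst sum.swap) (intro sum.cong refl sum.swap)
      also have "\<dots> = (\<Sum>p\<in>UNIV. \<Sum>q\<in>UNIV. R$(i,p,k,q) * Ric R $ p $ q)"
      proof -
        have "R$(j,p,j,q) = R$(p,j,q,j)" for j p q
          using acurvD(1)[OF R, of j p j q] acurvD(2)[OF R, of p j j q] by simp
        then show ?thesis unfolding Ric_def by (simp add: sum_distrib_left)
      qed
      finally show ?thesis unfolding curv_act_def by simp
    qed
    have XY: "X = 2 * X - 2 * Y"
    proof -
      have "X = (\<Sum>j\<in>UNIV. \<Sum>p\<in>UNIV. \<Sum>q\<in>UNIV. R$(i,j,p,q) * R$(k,j,p,q))"
        unfolding X_def quad_def by (rule sum.swap)
      also have "\<dots> = 2 * X - 2 * Y"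
        unfolding sum_square_acurv[OF R] X_def Y_def by (simp add: sum_subtractf sum_distrib_left)
      finally show ?thesis .
    qed
    have "Ric (Qmap R) $ i $ k = 2 * (X - Y + (\<Sum>j\<in>UNIV. quad R i k j j) - Y)"
      unfolding Ric_def X_def Y_def
      by (simp add: Qmap_nth_quad[OF R] sum.distrib sum_subtractf flip: sum_distrib_left)
    then show ?thesis using XY Z by simp
  qed
  then show ?thesis by (simp add: vec_eq_iff)
qed

section \<open>Invariance of the PIC2 cone\<close>

definition ev2 :: "('n::finite \<Rightarrow> 'n \<Rightarrow> complex) \<Rightarrow> complex^'n \<Rightarrow> complex^'n \<Rightarrow> complex" where
  "ev2 f z w = (\<Sum>i\<in>UNIV. \<Sum>j\<in>UNIV. f i j * z$i * w$j)"

text \<open>Coefficients are arbitrary index functions, so that the products of components inside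
  \<open>Qmap\<close> can be evaluated and factored termwise before summing over the contracted
  indices.\<close>

definition ev4 :: "('n::finite \<Rightarrow> 'n \<Rightarrow> 'n \<Rightarrow> 'n \<Rightarrow> complex) \<Rightarrow>
    complex^'n \<Rightarrow> complex^'n \<Rightarrow> complex^'n \<Rightarrow> complex^'n \<Rightarrow> complex" where
  "ev4 F z w u v = (\<Sum>i\<in>UNIV. \<Sum>j\<in>UNIV. \<Sum>k\<in>UNIV. \<Sum>l\<in>UNIV. F i j k l * z$i * w$j * u$k * v$l)"

lemma ev4_add: "ev4 (\<lambda>i j k l. F i j k l + G i j k l) z w u v = ev4 F z w u v + ev4 G z w u v"
  and ev4_diff: "ev4 (\<lambda>i j k l. F i j k l - G i j k l) z w u v = ev4 F z w u v - ev4 G z w u v"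
  and ev4_cmult: "ev4 (\<lambda>i j k l. c * F i j k l) z w u v = c * ev4 F z w u v"
  by (simp_all add: ev4_def ring_distribs sum.distrib sum_subtractf sum_distrib_left mult.assoc)

lemma ev4_sum: "finite P \<Longrightarrow> ev4 (\<lambda>i j k l. \<Sum>p\<in>P. F p i j k l) z w u v = (\<Sum>p\<in>P. ev4 (F p) z w u v)"
  by (induction P rule: finite_induct) (simp_all add: ev4_add, simp add: ev4_def)

lemma ev4_ij_kl: "ev4 (\<lambda>i j k l. f i j * g k l) z w u v = ev2 f z w * ev2 g u v"
  unfolding ev4_def ev2_def sum_distrib_right unfolding sum_distrib_left by (simp add: mult_ac)

lemma ev4_ik_jl: "ev4 (\<lambda>i j k l. f i k * g j l) z w u v = ev2 f z u * ev2 g w v"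
proof -
  have "ev2 f z u * ev2 g w v =
    (\<Sum>i\<in>UNIV. \<Sum>k\<in>UNIV. \<Sum>j\<in>UNIV. \<Sum>l\<in>UNIV. (f i k * g j l) * z$i * w$j * u$k * v$l)"
    unfolding ev2_def sum_distrib_right unfolding sum_distrib_left by (simp add: mult_ac)
  also have "\<dots> = ev4 (\<lambda>i j k l. f i k * g j l) z w u v"
    unfolding ev4_def by (rule sum.cong[OF refl], rule sum.swap)
  finally show ?thesis ..
qed

lemma ev4_il_jk: "ev4 (\<lambda>i j k l. f i l * g j k) z w u v = ev2 f z v * ev2 g w u"
proof -
  have "ev4 (\<lambda>i j k l. f i l * g j k) z w u v = ev4 (\<lambda>i j k l. f i k * g j l) z w v u"
    unfolding ev4_def
    by (rule sum.cong[OF refl], rule sum.cong[OF refl], subst sum.swap) (simp add: mult_ac)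
  then show ?thesis by (simp add: ev4_ik_jl)
qed

definition cev :: "'n::finite tensor4 \<Rightarrow> complex^'n \<Rightarrow> complex^'n \<Rightarrow> complex^'n \<Rightarrow> complex^'n \<Rightarrow> complex" where
  "cev R = ev4 (\<lambda>i j k l. of_real (R $ (i,j,k,l)))"

definition mev :: "real^'n^'n \<Rightarrow> complex^'n::finite \<Rightarrow> complex^'n \<Rightarrow> complex" where
  "mev A = ev2 (\<lambda>i j. of_real (A $ i $ j))"

definition cconj :: "complex^'n \<Rightarrow> complex^'n" where
  "cconj z = (\<chi> i. cnj (z $ i))"

lemma cconj_nth [simp]: "cconj z $ i = cnj (z $ i)"
  by (simp add: cconj_def)

lemma cconj_cconj [simp]: "cconj (cconj z) = z"
  and cconj_add: "cconj (z + w) = cconj z + cconj w"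
  and cconj_smult: "cconj (a *s z) = cnj a *s cconj z"
  by (simp_all add: vec_eq_iff)

lemma cev_add_tensor: "cev (R + S) z w u v = cev R z w u v + cev S z w u v"
  and cev_diff_tensor: "cev (R - S) z w u v = cev R z w u v - cev S z w u v"
  and cev_scaleR_tensor: "cev (c *\<^sub>R R) z w u v = of_real c * cev R z w u v"
  by (simp_all add: cev_def ev4_add ev4_diff ev4_cmult)

lemma cev_add_args:
  "cev R (z + z') w u v = cev R z w u v + cev R z' w u v"
  "cev R z (w + w') u v = cev R z w u v + cev R z w' u v"
  "cev R z w (u + u') v = cev R z w u v + cev R z w u' v"
  "cev R z w u (v + v') = cev R z w u v + cev R z w u v'"
  by (simp_all add: cev_def ev4_def ring_distribs sum.distrib)

lemma cev_smult_args:
  "cev R (a *s z) w u v = a * cev R z w u v"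
  "cev R z (a *s w) u v = a * cev R z w u v"
  "cev R z w (a *s u) v = a * cev R z w u v"
  "cev R z w u (a *s v) = a * cev R z w u v"
  by (simp_all add: cev_def ev4_def sum_distrib_left mult_ac)

lemma cnj_cev: "cnj (cev R z w u v) = cev R (cconj z) (cconj w) (cconj u) (cconj v)"
  by (simp add: cev_def ev4_def)

lemma cev_antisym1:
  assumes "acurv R"
  shows "cev R w z u v = - cev R z w u v"
proof -
  have "cev R w z u v = (\<Sum>j\<in>UNIV. \<Sum>i\<in>UNIV. \<Sum>k\<in>UNIV. \<Sum>l\<in>UNIV. of_real (R$(i,j,k,l)) * w$i * z$j * u$k * v$l)"
    unfolding cev_def ev4_def by (rule sum.swap)
  also have "\<dots> = - cev R z w u v"
    unfolding cev_def ev4_def sum_negf[symmetric]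
    by (intro sum.cong refl) (subst acurvD(1)[OF assms], simp add: mult_ac)
  finally show ?thesis .
qed

lemma cev_pair:
  assumes "acurv R"
  shows "cev R u v z w = cev R z w u v"
proof -
  have "cev R u v z w = (\<Sum>k\<in>UNIV. \<Sum>l\<in>UNIV. \<Sum>i\<in>UNIV. \<Sum>j\<in>UNIV. of_real (R$(i,j,k,l)) * u$i * v$j * z$k * w$l)"
    unfolding cev_def ev4_def by (rule sum_swap_4)
  also have "\<dots> = cev R z w u v"
    unfolding cev_def ev4_def
    by (intro sum.cong refl) (subst acurvD(3)[OF assms], simp add: mult_ac)
  finally show ?thesis .
qed

lemma cev_antisym2:
  assumes "acurv R"
  shows "cev R z w v u = - cev R z w u v"
  using cev_antisym1[OF assms] cev_pair[OF assms] by metis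

lemma cev_self1: "acurv R \<Longrightarrow> cev R z z u v = 0"
  using cev_antisym1[of R z z u v] by simp

lemma cev_self2: "acurv R \<Longrightarrow> cev R z w u u = 0"
  using cev_antisym2[of R z w u u] by simp

text \<open>The real part loses nothing on curvature tensors: conjugation exchanges the two index
  pairs, so the value is real (\<open>curvq_complex\<close>).\<close>

definition curvq :: "'n::finite tensor4 \<Rightarrow> complex^'n \<Rightarrow> complex^'n \<Rightarrow> real" where
  "curvq R z w = Re (cev R z w (cconj z) (cconj w))"

lemma curvq_complex:
  assumes "acurv R"
  shows "cev R z w (cconj z) (cconj w) = of_real (curvq R z w)"
proof -
  have "cnj (cev R z w (cconj z) (cconj w)) = cev R z w (cconj z) (cconj w)"
    using cev_pair[OF assms, of "cconj z" "cconj w" z w] by (simp add: cnj_cev)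
  then show ?thesis unfolding curvq_def by (simp add: complex_eq_iff)
qed

lemma PIC2_iff: "R \<in> PIC2 \<longleftrightarrow> acurv R \<and> (\<forall>z w. 0 \<le> curvq R z w)"
proof -
  have eq: "(\<Sum>i\<in>UNIV. \<Sum>j\<in>UNIV. \<Sum>k\<in>UNIV. \<Sum>l\<in>UNIV.
      complex_of_real (R $ (i,j,k,l)) * z$i * w$j * cnj (z$k) * cnj (w$l)) = cev R z w (cconj z) (cconj w)" for z w
    by (simp add: cev_def ev4_def)
  have "acurv R \<Longrightarrow> Im (cev R z w (cconj z) (cconj w)) = 0" for z w
    by (simp add: curvq_complex)
  then show ?thesis
    unfolding PIC2_def Let_def curvq_def mem_Collect_eq eq by blast
qed

lemma curvq_add: "curvq (R + S) z w = curvq R z w + curvq S z w"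
  and curvq_diff: "curvq (R - S) z w = curvq R z w - curvq S z w"
  and curvq_scaleR: "curvq (c *\<^sub>R R) z w = c * curvq R z w"
  by (simp_all add: curvq_def cev_add_tensor cev_diff_tensor cev_scaleR_tensor)

lemma cev_odot: "cev (odot A B) z w u v =
   mev A z u * mev B w v - mev A z v * mev B w u - mev B z v * mev A w u + mev B z u * mev A w v"
proof -
  have "cev (odot A B) z w u v = ev4 (\<lambda>i j k l.
      of_real (A$i$k) * of_real (B$j$l) - of_real (A$i$l) * of_real (B$j$k)
    - of_real (B$i$l) * of_real (A$j$k) + of_real (B$i$k) * of_real (A$j$l)) z w u v"
    unfolding cev_def odot_nth by (simp add: mult.commute)
  then show ?thesis
    unfolding ev4_add ev4_diff ev4_ik_jl ev4_il_jk mev_def .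
qed

section \<open>Q and the second variation at a zero of the curvature\<close>

text \<open>Freezing slots one and three leaves a matrix in the other two; such matrices are the
  blocks of the Hessian below.\<close>

definition cpart :: "'n::finite tensor4 \<Rightarrow> complex^'n \<Rightarrow> complex^'n \<Rightarrow> 'n \<Rightarrow> 'n \<Rightarrow> complex" where
  "cpart S z u p q = ev2 (\<lambda>i k. of_real (S $ (i,p,k,q))) z u"

lemma cev_cpart: "cev S z w u v = (\<Sum>p\<in>UNIV. \<Sum>q\<in>UNIV. cpart S z u p q * w$p * v$q)"
proof -
  have "cev S z w u v = (\<Sum>j\<in>UNIV. \<Sum>i\<in>UNIV. \<Sum>k\<in>UNIV. \<Sum>l\<in>UNIV. of_real (S$(i,j,k,l)) * z$i * w$j * u$k * v$l)"
    unfolding cev_def ev4_def by (rule sum.swap)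
  also have "\<dots> = (\<Sum>j\<in>UNIV. \<Sum>i\<in>UNIV. \<Sum>l\<in>UNIV. \<Sum>k\<in>UNIV. of_real (S$(i,j,k,l)) * z$i * w$j * u$k * v$l)"
    by (rule sum.cong[OF refl], rule sum.cong[OF refl], rule sum.swap)
  also have "\<dots> = (\<Sum>j\<in>UNIV. \<Sum>l\<in>UNIV. \<Sum>i\<in>UNIV. \<Sum>k\<in>UNIV. of_real (S$(i,j,k,l)) * z$i * w$j * u$k * v$l)"
    by (rule sum.cong[OF refl], rule sum.swap)
  also have "\<dots> = (\<Sum>p\<in>UNIV. \<Sum>q\<in>UNIV. cpart S z u p q * w$p * v$q)"
    unfolding cpart_def ev2_def sum_distrib_right by (simp add: mult_ac)
  finally show ?thesis .
qed

lemma cpart_swap: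
  assumes "acurv S"
  shows "cpart S u z q p = cpart S z u p q"
proof -
  have "cpart S u z q p = (\<Sum>i\<in>UNIV. \<Sum>k\<in>UNIV. of_real (S$(k,q,i,p)) * u$k * z$i)"
    unfolding cpart_def ev2_def by (rule sum.swap)
  also have "\<dots> = cpart S z u p q"
    unfolding cpart_def ev2_def by (intro sum.cong refl) (subst acurvD(3)[OF assms], simp add: mult_ac)
  finally show ?thesis .
qed

lemma cnj_cpart: "cnj (cpart S z u p q) = cpart S (cconj z) (cconj u) p q"
  by (simp add: cpart_def ev2_def)

text \<open>The square of the curvature operator contributes squared moduli. The second summand has
  no evident sign; it is the trace expression of \<open>hermitian_psd_block_trace\<close> and is
  controlled at zeros of \<open>curvq S\<close>.\<close>

lemma curvq_Qmap:
  assumes S: "acurv S"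
  shows "curvq (Qmap S) z w =
    (\<Sum>p\<in>UNIV. \<Sum>q\<in>UNIV. (cmod (ev2 (\<lambda>i j. of_real (S $ (i,j,p,q))) z w))\<^sup>2)
    + 2 * Re (\<Sum>p\<in>UNIV. \<Sum>q\<in>UNIV. cpart S w (cconj w) p q * cpart S z (cconj z) p q
         - cpart S w (cconj z) p q * cpart S z (cconj w) p q)"
proof -
  let ?g = "\<lambda>p q i j. complex_of_real (S $ (i,j,p,q))"
  let ?h = "\<lambda>p q i k. complex_of_real (S $ (i,p,k,q))"
  have 1: "of_real (Qmap S $ (i,j,k,l)) = (\<Sum>p\<in>UNIV. \<Sum>q\<in>UNIV. ?g p q i j * ?g p q k l
      + 2 * (?h p q i k * ?h p q j l) - 2 * (?h p q i l * ?h p q j k))" for i j k l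
  proof -
    have 2: "(\<Sum>p\<in>UNIV. \<Sum>q\<in>UNIV. S $ (j,p,l,q) * S $ (i,p,k,q)) = (\<Sum>p\<in>UNIV. \<Sum>q\<in>UNIV. S $ (i,p,k,q) * S $ (j,p,l,q))" for i j k l
      by (simp add: mult.commute)
    have 3: "(\<Sum>p\<in>UNIV. \<Sum>q\<in>UNIV. S $ (k,l,p,q) * S $ (i,j,p,q)) = (\<Sum>p\<in>UNIV. \<Sum>q\<in>UNIV. S $ (i,j,p,q) * S $ (k,l,p,q))" for i j k l
      by (simp add: mult.commute)
    have "Qmap S $ (i,j,k,l) = (\<Sum>p\<in>UNIV. \<Sum>q\<in>UNIV. S $ (i,j,p,q) * S $ (k,l,p,q)
      + 2 * (S $ (i,p,k,q) * S $ (j,p,l,q)) - 2 * (S $ (i,p,l,q) * S $ (j,p,k,q)))"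
      unfolding Qmap_def Bq_nth sum.distrib sum_subtractf sum_distrib_left[symmetric]
      using 2[of j l i k] 2[of j k i l] 3[of k l i j] by simp
    then show ?thesis by simp
  qed
  have "cev (Qmap S) z w u v = (\<Sum>p\<in>UNIV. \<Sum>q\<in>UNIV. ev2 (?g p q) z w * ev2 (?g p q) u v
      + 2 * (cpart S z u p q * cpart S w v p q) - 2 * (cpart S z v p q * cpart S w u p q))" for u v
    unfolding cev_def 1
    by (simp add: ev4_sum ev4_add ev4_diff ev4_cmult ev4_ij_kl ev4_ik_jl ev4_il_jk cpart_def)
  moreover have "ev2 (?g p q) (cconj z) (cconj w) = cnj (ev2 (?g p q) z w)" for p q
    by (simp add: ev2_def)
  ultimately have "cev (Qmap S) z w (cconj z) (cconj w) = (\<Sum>p\<in>UNIV. \<Sum>q\<in>UNIV. of_real ((cmod (ev2 (?g p q) z w))\<^sup>2)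
      + 2 * (cpart S w (cconj w) p q * cpart S z (cconj z) p q - cpart S w (cconj z) p q * cpart S z (cconj w) p q))"
    by (simp add: complex_norm_square[symmetric] algebra_simps)
  then show ?thesis
    unfolding curvq_def by (simp add: sum.distrib sum_distrib_left)
qed

text \<open>Averaging \<open>curvq S (z + a \<xi>) (w + a \<eta>)\<close> over \<open>a \<in> {1, \<i>, -1, -\<i>}\<close> keeps only the terms of equal
  degree in \<open>a\<close> and its conjugate.\<close>

lemma curvq_average:
  fixes z w :: "complex^'n::finite" and S :: "'n tensor4"
  defines "q \<equiv> \<lambda>a \<xi> \<eta>. cev S (z + a *s \<xi>) (w + a *s \<eta>) (cconj (z + a *s \<xi>)) (cconj (w + a *s \<eta>))"
  shows "q 1 \<xi> \<eta> + q \<i> \<xi> \<eta> + q (-1) \<xi> \<eta> + q (-\<i>) \<xi> \<eta> =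
    4 * (cev S z w (cconj z) (cconj w) + (cev S \<xi> w (cconj \<xi>) (cconj w) + cev S z \<eta> (cconj z) (cconj \<eta>)
      + cev S \<xi> w (cconj z) (cconj \<eta>) + cev S z \<eta> (cconj \<xi>) (cconj w)) + cev S \<xi> \<eta> (cconj \<xi>) (cconj \<eta>))"
  unfolding q_def cconj_add cconj_smult cev_add_args cev_smult_args by (simp add: algebra_simps)

text \<open>A zero of \<open>curvq S\<close> is a minimum. The averaging leaves the Hermitian part
  \<open>T\<close> of the Hessian and a fourth-order term \<open>Q\<close>; scaling the variation by
  \<open>t\<close> gives \<open>0 \<le> T + t\<^sup>2 Q\<close>, and a small \<open>t\<close> rules
  out \<open>T < 0\<close>.\<close>

lemma second_variation_nonneg:
  assumes S: "S \<in> PIC2" and zero: "curvq S z w = 0"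
  shows "0 \<le> Re (cev S \<xi> w (cconj \<xi>) (cconj w) + cev S z \<eta> (cconj z) (cconj \<eta>)
      + cev S \<xi> w (cconj z) (cconj \<eta>) + cev S z \<eta> (cconj \<xi>) (cconj w))" (is "0 \<le> Re (?T \<xi> \<eta>)")
proof (rule ccontr)
  have aS: "acurv S" and pos: "\<And>z w. 0 \<le> Re (cev S z w (cconj z) (cconj w))"
    using S unfolding PIC2_iff curvq_def by auto
  have z0: "cev S z w (cconj z) (cconj w) = 0" using zero curvq_complex[OF aS] by simp
  have base: "0 \<le> Re (?T \<xi> \<eta>) + curvq S \<xi> \<eta>" for \<xi> \<eta>
  proof -
    have "0 \<le> Re (4 * (0 + ?T \<xi> \<eta> + cev S \<xi> \<eta> (cconj \<xi>) (cconj \<eta>)))"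
      unfolding z0[symmetric] curvq_average[symmetric] plus_complex.sel
      by (intro add_nonneg_nonneg pos)
    then show ?thesis unfolding curvq_def by simp
  qed
  have hom: "0 \<le> Re (?T \<xi> \<eta>) + t\<^sup>2 * curvq S \<xi> \<eta>" if "t \<noteq> 0" for t :: real
  proof -
    have "?T (of_real t *s \<xi>) (of_real t *s \<eta>) = of_real (t\<^sup>2) * ?T \<xi> \<eta>"
      by (simp add: cconj_smult cev_smult_args algebra_simps power2_eq_square)
    moreover have "curvq S (of_real t *s \<xi>) (of_real t *s \<eta>) = t^4 * curvq S \<xi> \<eta>"
      unfolding curvq_def by (simp add: cconj_smult cev_smult_args power4_eq_xxxx mult_ac)
    ultimately have "0 \<le> t\<^sup>2 * Re (?T \<xi> \<eta>) + t^4 * curvq S \<xi> \<eta>"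
      using base[of "of_real t *s \<xi>" "of_real t *s \<eta>"] by (simp add: Re_complex_of_real flip: of_real_power)
    also have "\<dots> = t\<^sup>2 * (Re (?T \<xi> \<eta>) + t\<^sup>2 * curvq S \<xi> \<eta>)"
      by (simp add: algebra_simps power4_eq_xxxx power2_eq_square)
    finally show ?thesis using that by (simp add: zero_le_mult_iff)
  qed
  define T where "T = Re (?T \<xi> \<eta>)"
  define Q where "Q = curvq S \<xi> \<eta>"
  assume "\<not> 0 \<le> Re (?T \<xi> \<eta>)"
  then have T: "T < 0" by (simp add: T_def)
  have Q: "0 \<le> Q" using S unfolding PIC2_iff Q_def by blast
  \<comment> \<open>Makes \<open>t\<^sup>2 Q\<close> at most \<open>- T / 2\<close>; the added 1
    covers \<open>Q = 0\<close>.\<close>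
  define t where "t = sqrt (- T / (2 * (Q + 1)))"
  have t2: "t\<^sup>2 = - T / (2 * (Q + 1))" unfolding t_def using T Q by (intro real_sqrt_pow2 divide_nonneg_nonneg) auto
  have "t \<noteq> 0" unfolding t_def using T Q by simp
  then have "0 \<le> T + t\<^sup>2 * Q" using hom unfolding T_def Q_def by blast
  moreover have "t\<^sup>2 * Q \<le> - T / 2"
  proof -
    have "t\<^sup>2 * Q \<le> t\<^sup>2 * (Q + 1)" by (simp add: mult_left_mono)
    also have "\<dots> = - T / 2" unfolding t2 using Q by (simp add: field_simps)
    finally show ?thesis .
  qed
  ultimately show False using T by linarith
qed

text \<open>The Hermitian part of the Hessian is a semidefinite matrix \<open>M\<close> on two
  copies of the index set. The block trace inequality for \<open>M\<close> is the nonnegativity of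
  the second summand in \<open>curvq_Qmap\<close>.\<close>

theorem Qmap_nonneg_at_PIC2_zero:
  fixes S :: "'n::finite tensor4"
  assumes S: "S \<in> PIC2" and zero: "curvq S z w = 0"
  shows "0 \<le> curvq (Qmap S) z w"
proof -
  have aS: "acurv S" using S unfolding PIC2_iff by blast
  \<comment> \<open>\<open>Inl\<close> indexes the variation of \<open>z\<close> and
    \<open>Inr\<close> that of \<open>w\<close>. The off-diagonal signs come from moving the
    variation of \<open>z\<close> into the second slot by antisymmetry.\<close>
  define M :: "'n + 'n \<Rightarrow> 'n + 'n \<Rightarrow> complex" where
    "M a b = (case a of
        Inl p \<Rightarrow> (case b of Inl q \<Rightarrow> cpart S w (cconj w) p q | Inr q \<Rightarrow> - cpart S w (cconj z) p q)
      | Inr p \<Rightarrow> (case b of Inl q \<Rightarrow> - cpart S z (cconj w) p q | Inr q \<Rightarrow> cpart S z (cconj z) p q))" for a b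
  have herm: "M b a = cnj (M a b)" for a b
    unfolding M_def using cpart_swap[OF aS] by (auto split: sum.split simp: cnj_cpart)
  have psd: "0 \<le> Re (sesq M x)" for x
  proof -
    define \<xi> where "\<xi> = (\<chi> p. x (Inl p))"
    define \<eta> where "\<eta> = (\<chi> p. x (Inr p))"
    have U: "(\<Sum>a\<in>UNIV. f a) = (\<Sum>p\<in>UNIV. f (Inl p)) + (\<Sum>p\<in>UNIV. f (Inr p))" for f :: "'n + 'n \<Rightarrow> complex"
      unfolding UNIV_Plus_UNIV[symmetric] by (subst sum.Plus) auto
    have "sesq M x = cev S w \<xi> (cconj w) (cconj \<xi>) - cev S w \<xi> (cconj z) (cconj \<eta>)
        - cev S z \<eta> (cconj w) (cconj \<xi>) + cev S z \<eta> (cconj z) (cconj \<eta>)"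
      unfolding sesq_def U M_def cev_cpart \<xi>_def \<eta>_def by (simp add: sum.distrib sum_negf sum_subtractf)
    also have "\<dots> = cev S \<xi> w (cconj \<xi>) (cconj w) + cev S z \<eta> (cconj z) (cconj \<eta>)
      + cev S \<xi> w (cconj z) (cconj \<eta>) + cev S z \<eta> (cconj \<xi>) (cconj w)"
      using cev_antisym1[OF aS, of w \<xi>] cev_antisym2[OF aS, of _ _ "cconj w" "cconj \<xi>"] by simp
    finally show ?thesis using second_variation_nonneg[OF S zero] by simp
  qed
  have "cnj (M (Inl q) (Inr p)) = - cpart S z (cconj w) p q" for p q
    using herm[of "Inl q" "Inr p"] by (simp add: M_def)
  then have "0 \<le> Re (\<Sum>p\<in>UNIV. \<Sum>q\<in>UNIV. cpart S w (cconj w) p q * cpart S z (cconj z) p q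
         - cpart S w (cconj z) p q * cpart S z (cconj w) p q)"
    using hermitian_psd_block_trace[OF herm psd] by (simp add: M_def)
  then show ?thesis
    unfolding curvq_Qmap[OF aS] by (intro add_nonneg_nonneg sum_nonneg) auto
qed

section \<open>Frames, eigenbases and the pinching term\<close>

lemma norm_square_vec_complex: "(norm (z :: complex^'n))\<^sup>2 = (\<Sum>i\<in>UNIV. (cmod (z$i))\<^sup>2)"
  by (simp add: norm_vec_def L2_set_def sum_nonneg)

lemma norm_smult_complex: "norm (a *s (z :: complex^'n)) = cmod a * norm z"
  by (simp add: norm_vec_def L2_set_right_distrib norm_mult)

lemma curvq_smult: "curvq R (a *s z) (b *s w) = (cmod a)\<^sup>2 * (cmod b)\<^sup>2 * curvq R z w"
proof -
  have "cev R (a *s z) (b *s w) (cconj (a *s z)) (cconj (b *s w)) =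
    (a * cnj a) * (b * cnj b) * cev R z w (cconj z) (cconj w)"
    by (simp add: cconj_smult cev_smult_args)
  also have "\<dots> = of_real ((cmod a)\<^sup>2 * (cmod b)\<^sup>2) * cev R z w (cconj z) (cconj w)"
    by (simp only: of_real_mult complex_norm_square)
  finally show ?thesis unfolding curvq_def by simp
qed

lemma curvq_shear:
  assumes "acurv R"
  shows "curvq R z (w + a *s z) = curvq R z w"
  unfolding curvq_def
  by (simp add: cconj_add cconj_smult cev_add_args cev_smult_args cev_self1[OF assms] cev_self2[OF assms])

text \<open>Unitary 2-frames. Up to scale \<open>curvq R z w\<close> depends only on the complex
  plane spanned, so PIC2 can be tested on this compact set.\<close>

definition frames :: "((complex^'n) \<times> (complex^'n)) set" where
  "frames = {(z, w). norm z = 1 \<and> norm w = 1 \<and> (\<Sum>i\<in>UNIV. z$i * cnj (w$i)) = 0}"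

lemma compact_frames: "compact (frames :: ((complex^'n) \<times> (complex^'n)) set)"
proof -
  have eq: "frames = (sphere 0 1 \<times> sphere 0 1) \<inter> {p :: (complex^'n) \<times> (complex^'n). (\<Sum>i\<in>UNIV. fst p$i * cnj (snd p$i)) = 0}"
    by (auto simp: frames_def)
  have cl: "closed {p :: (complex^'n) \<times> (complex^'n). (\<Sum>i\<in>UNIV. fst p$i * cnj (snd p$i)) = 0}"
    by (intro closed_Collect_eq continuous_intros)
  show ?thesis unfolding eq by (intro compact_Int_closed compact_Times compact_sphere cl)
qed

lemma continuous_on_curvq: "continuous_on X (\<lambda>p. curvq R (fst p) (snd p))"
  unfolding curvq_def cev_def ev4_def cconj_nth by (intro continuous_intros)

text \<open>Gram-Schmidt: homogeneity and \<open>curvq_shear\<close> reduce an independent pair to a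
  unitary frame, and a dependent pair gives the value 0.\<close>

lemma curvq_nonneg_of_frames:
  fixes R :: "'n::finite tensor4"
  assumes R: "acurv R" and fr: "\<And>p. p \<in> frames \<Longrightarrow> 0 \<le> curvq R (fst p) (snd p)"
  shows "0 \<le> curvq R z w"
proof (cases "z = 0")
  case True
  then have "z = 0 *s z" by simp
  then have "curvq R z w = 0" using curvq_smult[of R 0 z 1 w] by simp
  then show ?thesis by simp
next
  case False
  define e where "e = of_real (1 / norm z) *s z"
  have ne: "norm e = 1" using False unfolding e_def norm_smult_complex by (simp add: norm_divide)
  have z: "z = of_real (norm z) *s e" using False by (simp add: e_def vec_eq_iff)
  have ee: "(\<Sum>i\<in>UNIV. e$i * cnj (e$i)) = 1"
    using norm_square_vec_complex[of e] ne by (simp add: complex_norm_square[symmetric] flip: of_real_sum of_real_power)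
  define a where "a = (\<Sum>i\<in>UNIV. w$i * cnj (e$i))"
  define v where "v = w - a *s e"
  have orth: "(\<Sum>i\<in>UNIV. e$i * cnj (v$i)) = 0"
  proof -
    have "(\<Sum>i\<in>UNIV. e$i * cnj (v$i)) = (\<Sum>i\<in>UNIV. e$i * cnj (w$i)) - cnj a * (\<Sum>i\<in>UNIV. e$i * cnj (e$i))"
      unfolding v_def by (simp add: sum_subtractf sum_distrib_left algebra_simps)
    then show ?thesis unfolding ee a_def by (simp add: mult.commute)
  qed
  have w: "w = v + a *s e" by (simp add: v_def)
  have ev: "0 \<le> curvq R e v"
  proof (cases "v = 0")
    case True
    then have "v = 0 *s v" by simp
    then have "curvq R e v = 0" using curvq_smult[of R 1 e 0 v] by simp
    then show ?thesis by simp
  next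
    case False
    define f where "f = of_real (1 / norm v) *s v"
    have nf: "norm f = 1" using False unfolding f_def norm_smult_complex by (simp add: norm_divide)
    have v: "v = of_real (norm v) *s f" using False by (simp add: f_def vec_eq_iff)
    have "(\<Sum>i\<in>UNIV. e$i * cnj (f$i)) = of_real (1 / norm v) * (\<Sum>i\<in>UNIV. e$i * cnj (v$i))"
      unfolding f_def by (simp add: sum_distrib_left mult_ac sum_divide_distrib)
    then have "(e, f) \<in> frames" using ne nf orth by (simp add: frames_def)
    then have "0 \<le> curvq R e f" using fr[of "(e, f)"] by simp
    then have "0 \<le> curvq R (1 *s e) (of_real (norm v) *s f)" unfolding curvq_smult by simp
    then show ?thesis using v by simp
  qed
  then have "0 \<le> curvq R e w" unfolding w curvq_shear[OF R] .
  then have "0 \<le> curvq R (of_real (norm z) *s e) (1 *s w)" unfolding curvq_smult by simp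
  then show ?thesis using z by simp
qed

lemma mev_mat1: "mev (mat 1) z u = (\<Sum>i\<in>UNIV. z$i * u$i)"
  unfolding mev_def ev2_def mat_def
  by (intro sum.cong refl) (simp add: if_distrib[of complex_of_real] if_distrib[of "\<lambda>x. x * _"] cong: if_cong)

text \<open>\<open>odot id id\<close> is twice the curvature tensor of the unit sphere, so adding a
  positive multiple of it gains positivity uniformly over all frames.\<close>

lemma curvq_odot_id_frames:
  assumes "(z, w) \<in> frames"
  shows "curvq (odot (mat 1) (mat 1)) z w = 2"
proof -
  have "(\<Sum>i\<in>UNIV. z$i * cnj (z$i)) = 1" "(\<Sum>i\<in>UNIV. w$i * cnj (w$i)) = 1" "(\<Sum>i\<in>UNIV. z$i * cnj (w$i)) = 0"
    using assms norm_square_vec_complex[of z] norm_square_vec_complex[of w] unfolding frames_def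
    by (simp_all add: complex_norm_square[symmetric] flip: of_real_sum of_real_power)
  then show ?thesis
    unfolding curvq_def cev_odot mev_mat1 by simp
qed

definition cvec :: "real^'n \<Rightarrow> complex^'n" where
  "cvec x = (\<chi> i. of_real (x $ i))"

text \<open>The Jacobi operator of \<open>S\<close> in the direction \<open>x\<close>.\<close>

definition rpart :: "'n::finite tensor4 \<Rightarrow> real^'n \<Rightarrow> 'n \<Rightarrow> 'n \<Rightarrow> real" where
  "rpart S x p q = (\<Sum>i\<in>UNIV. \<Sum>k\<in>UNIV. S $ (i,p,k,q) * x$i * x$k)"

lemma curvq_cvec: "curvq S (cvec x) (cvec y) = (\<Sum>p\<in>UNIV. \<Sum>q\<in>UNIV. rpart S x p q * y$p * y$q)"
proof -
  have c: "cconj (cvec x) = cvec x" for x by (simp add: vec_eq_iff cvec_def)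
  have "cpart S (cvec x) (cvec x) p q = of_real (rpart S x p q)" for p q
    by (simp add: cpart_def ev2_def rpart_def cvec_def)
  then show ?thesis
    unfolding curvq_def c cev_cpart by (simp add: cvec_def)
qed

lemma inner_matrix_vector: "x \<bullet> (A *v y) = (\<Sum>i\<in>UNIV. \<Sum>k\<in>UNIV. A$i$k * x$i * y$k)"
  for A :: "real^'n^'n"
  by (simp add: inner_vec_def matrix_vector_mult_def sum_distrib_left mult_ac)

lemma symmetric_matrix_inner: "transpose A = A \<Longrightarrow> x \<bullet> (A *v y) = (A *v x) \<bullet> y"
  for A :: "real^'n^'n"
  by (metis dot_lmul_matrix vector_transpose_matrix)

lemma psd_zero_imp_kernel:
  fixes A :: "real^'n^'n"
  assumes A: "transpose A = A" "psd A" and x: "x \<bullet> (A *v x) = 0"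
  shows "A *v x = 0"
proof -
  have "y \<bullet> (A *v x) = 0" for y
    using selfadjoint_nonneg_zero_imp_orthogonal[of "(*v) A" UNIV x y] A x
    by (auto simp: symmetric_matrix_inner psd_def)
  then show ?thesis by (metis inner_eq_zero_iff)
qed

lemma curv_act_inner: "x \<bullet> (curv_act S K *v x) = (\<Sum>p\<in>UNIV. \<Sum>q\<in>UNIV. rpart S x p q * K$p$q)"
proof -
  have "x \<bullet> (curv_act S K *v x) = (\<Sum>i\<in>UNIV. \<Sum>k\<in>UNIV. \<Sum>p\<in>UNIV. \<Sum>q\<in>UNIV. S $ (i,p,k,q) * x$i * x$k * K$p$q)"
    unfolding inner_matrix_vector curv_act_def by (simp add: sum_distrib_right sum_distrib_left mult_ac)
  also have "\<dots> = (\<Sum>p\<in>UNIV. \<Sum>q\<in>UNIV. \<Sum>i\<in>UNIV. \<Sum>k\<in>UNIV. S $ (i,p,k,q) * x$i * x$k * K$p$q)"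
    by (rule sum_swap_4)
  finally show ?thesis unfolding rpart_def by (simp add: sum_distrib_right)
qed

text \<open>For each real \<open>x\<close> the Jacobi operator is semidefinite with trace
  \<open>Ric(x,x) = 0\<close>, hence zero. Polarisation and the Bianchi identity then annihilate
  \<open>S\<close>.\<close>

lemma PIC2_Ric_zero:
  fixes S :: "'n::finite tensor4"
  assumes S: "S \<in> PIC2" and ric: "Ric S = 0"
  shows "S = 0"
proof -
  have aS: "acurv S" using S unfolding PIC2_iff by blast
  have sw: "rpart S x q p = rpart S x p q" for x p q
  proof -
    have "rpart S x q p = (\<Sum>i\<in>UNIV. \<Sum>k\<in>UNIV. S $ (k,q,i,p) * x$k * x$i)"
      unfolding rpart_def by (rule sum.swap)
    also have "\<dots> = rpart S x p q"
      unfolding rpart_def by (intro sum.cong refl) (subst acurvD(3)[OF aS], simp add: mult_ac)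
    finally show ?thesis .
  qed
  have r0: "rpart S x p q = 0" for x p q
  proof -
    define P :: "real^'n^'n" where "P = (\<chi> p q. rpart S x p q)"
    have tP: "transpose P = P" unfolding transpose_eq_nth P_def by (simp add: sw)
    have "y \<bullet> (P *v y) = curvq S (cvec x) (cvec y)" for y
      unfolding inner_matrix_vector P_def curvq_cvec by simp
    then have psd: "psd P" using S unfolding psd_def PIC2_iff by simp
    have ax: "axis p 1 \<bullet> (P *v axis p 1) = P $ p $ p" for p
      by (simp add: inner_axis' matrix_vector_mul_component inner_axis)
    have "(\<Sum>p\<in>UNIV. P$p$p) = (\<Sum>i\<in>UNIV. \<Sum>k\<in>UNIV. \<Sum>p\<in>UNIV. S $ (i,p,k,p) * x$i * x$k)"
      unfolding P_def rpart_def by (simp, subst sum.swap, rule sum.cong[OF refl], rule sum.swap)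
    also have "\<dots> = (\<Sum>i\<in>UNIV. \<Sum>k\<in>UNIV. Ric S $ i $ k * x$i * x$k)"
      unfolding Ric_def by (simp add: sum_distrib_right)
    finally have "(\<Sum>p\<in>UNIV. P$p$p) = 0" using ric by simp
    moreover have "0 \<le> P$p$p" for p using psd ax unfolding psd_def by metis
    ultimately have "P$p$p = 0" for p by (simp add: sum_nonneg_eq_0_iff)
    then have "P *v axis q 1 = 0" using psd_zero_imp_kernel[OF tP psd] ax by metis
    then have "(P *v axis q 1) $ p = 0" by simp
    then show ?thesis by (simp add: matrix_vector_mul_component inner_axis P_def)
  qed
  \<comment> \<open>Polarisation in \<open>x\<close> makes \<open>S\<close> skew in slots one and
    three; with the antisymmetry in the first pair, all three terms of the Bianchi identity become
    equal.\<close>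
  have skew: "S $ (i,p,k,q) = - S $ (k,p,i,q)" for i p k q
  proof -
    define N :: "real^'n^'n" where "N = (\<chi> i k. S $ (i,p,k,q) + S $ (k,p,i,q))"
    have tN: "transpose N = N" unfolding transpose_eq_nth N_def by (simp add: add.commute)
    have z: "x \<bullet> (N *v x) = 0" for x
    proof -
      have "x \<bullet> (N *v x) = (\<Sum>i\<in>UNIV. \<Sum>k\<in>UNIV. S $ (i,p,k,q) * x$i * x$k) + (\<Sum>i\<in>UNIV. \<Sum>k\<in>UNIV. S $ (k,p,i,q) * x$i * x$k)"
        unfolding inner_matrix_vector N_def by (simp add: ring_distribs sum.distrib)
      also have "(\<Sum>i\<in>UNIV. \<Sum>k\<in>UNIV. S $ (k,p,i,q) * x$i * x$k) = (\<Sum>k\<in>UNIV. \<Sum>i\<in>UNIV. S $ (k,p,i,q) * x$k * x$i)"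
        by (subst sum.swap) (simp add: mult_ac)
      finally show ?thesis using r0[of x p q] unfolding rpart_def by simp
    qed
    then have "N *v x = 0" for x using psd_zero_imp_kernel[OF tN] by (simp add: psd_def)
    then have "(N *v axis k 1) $ i = 0" by simp
    then show ?thesis by (simp add: matrix_vector_mul_component inner_axis N_def)
  qed
  have "S $ (i,j,k,l) = 0" for i j k l
    using acurvD(4)[OF aS, of i j k l] skew[of i j k l] skew[of j k i l] acurvD(1)[OF aS, of k j i l] acurvD(1)[OF aS, of i k j l]
    by linarith
  then show ?thesis by (simp add: vec_eq_iff)
qed

section \<open>Spectral matrices and the pinching inequality\<close>

definition specm :: "(real^'n) set \<Rightarrow> (real^'n \<Rightarrow> real) \<Rightarrow> real^'n^'n" where
  "specm B c = (\<chi> i j. \<Sum>b\<in>B. c b * b$i * b$j)"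

text \<open>One basis for \<open>K\<close>, its square and the identity at once, so that all
  \<open>odot\<close> terms can be compared coefficient by coefficient.\<close>

lemma symmetric_spectral:
  fixes K :: "real^'n^'n"
  assumes K: "transpose K = K"
  obtains B c where "finite B" "\<And>b. b \<in> B \<Longrightarrow> norm b = 1" "\<And>b. b \<in> B \<Longrightarrow> K *v b = c b *\<^sub>R b"
    "K = specm B c" "K ** K = specm B (\<lambda>b. (c b)\<^sup>2)" "mat 1 = specm B (\<lambda>b. 1)"
proof -
  obtain B c where B: "finite B" "\<And>b. b \<in> B \<Longrightarrow> norm b = 1" "\<And>b. b \<in> B \<Longrightarrow> K *v b = c b *\<^sub>R b"
      "\<And>x. x = (\<Sum>b\<in>B. (x \<bullet> b) *\<^sub>R b)"
    by (rule selfadjoint_orthonormal_eigenbasis[of "(*v) K"]) (auto simp: symmetric_matrix_inner[OF K])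
  have gen: "A = specm B d" if A: "\<And>b. b \<in> B \<Longrightarrow> A *v b = d b *\<^sub>R b" for A :: "real^'n^'n" and d
  proof -
    have "A $ i $ j = specm B d $ i $ j" for i j
    proof -
      have "A $ i $ j = (A *v axis j 1) $ i" by (simp add: matrix_vector_mul_component inner_axis)
      also have "axis j 1 = (\<Sum>b\<in>B. (axis j 1 \<bullet> b) *\<^sub>R b)" by (rule B(4))
      also have "A *v (\<Sum>b\<in>B. (axis j 1 \<bullet> b) *\<^sub>R b) = (\<Sum>b\<in>B. (b $ j * d b) *\<^sub>R b)"
        by (simp add: linear_sum[OF matrix_vector_mul_linear] matrix_vector_mult_scaleR A inner_axis')
      finally show ?thesis by (simp add: specm_def mult_ac)
    qed
    then show ?thesis by (simp add: vec_eq_iff)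
  qed
  show ?thesis
  proof (rule that[OF B(1-3)])
    show "K = specm B c" by (rule gen[OF B(3)])
    show "K ** K = specm B (\<lambda>b. (c b)\<^sup>2)"
      by (rule gen) (simp add: B(3) matrix_vector_mult_scaleR power2_eq_square flip: matrix_vector_mul_assoc)
    show "mat 1 = specm B (\<lambda>b. 1)" by (rule gen) simp
  qed
qed

lemma trace_specm:
  assumes "\<And>b. b \<in> B \<Longrightarrow> norm b = 1"
  shows "trace (specm B c) = (\<Sum>b\<in>B. c b)"
proof -
  have "trace (specm B c) = (\<Sum>b\<in>B. \<Sum>i\<in>UNIV. c b * b$i * b$i)"
    unfolding trace_def specm_def by (simp, rule sum.swap)
  also have "\<dots> = (\<Sum>b\<in>B. c b * (b \<bullet> b))"
    by (simp add: inner_vec_def sum_distrib_left mult_ac)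
  also have "\<dots> = (\<Sum>b\<in>B. c b)" using assms by (intro sum.cong) (auto simp: dot_square_norm)
  finally show ?thesis .
qed

lemma psd_eigenvalue_nonneg:
  fixes K :: "real^'n^'n"
  assumes "psd K" "norm b = 1" "K *v b = c *\<^sub>R b"
  shows "0 \<le> c"
  using assms unfolding psd_def by (metis dot_square_norm inner_scaleR_right mult.right_neutral power_one)

text \<open>In an eigenbasis of \<open>K\<close> the value is a sum of unnormalised sectional
  curvatures of \<open>S\<close> weighted by the nonnegative eigenvalues.\<close>

lemma curv_act_nonneg:
  fixes S :: "'n::finite tensor4"
  assumes S: "S \<in> PIC2" and K: "transpose K = K" "psd K"
  shows "0 \<le> x \<bullet> (curv_act S K *v x)"
proof -
  obtain B c where B: "finite B" "\<And>b. b \<in> B \<Longrightarrow> norm b = 1" "\<And>b. b \<in> B \<Longrightarrow> K *v b = c b *\<^sub>R b" "K = specm B c"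
    using symmetric_spectral[OF K(1)] by metis
  have "x \<bullet> (curv_act S K *v x) = (\<Sum>p\<in>UNIV. \<Sum>q\<in>UNIV. \<Sum>b\<in>B. rpart S x p q * (c b * b$p * b$q))"
    unfolding curv_act_inner by (subst B(4)) (simp add: specm_def sum_distrib_left)
  also have "\<dots> = (\<Sum>b\<in>B. \<Sum>p\<in>UNIV. \<Sum>q\<in>UNIV. rpart S x p q * (c b * b$p * b$q))"
    by (subst sum.swap[where B = B], rule sum.swap[symmetric, THEN trans]) (intro sum.cong refl sum.swap)
  also have "\<dots> = (\<Sum>b\<in>B. c b * curvq S (cvec x) (cvec b))"
    unfolding curvq_cvec by (simp add: sum_distrib_left mult_ac)
  also have "\<dots> \<ge> 0"
    using S psd_eigenvalue_nonneg[OF K(2) B(2,3)] unfolding PIC2_iff by (intro sum_nonneg mult_nonneg_nonneg) auto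
  finally show ?thesis .
qed

definition cdot :: "real^'n \<Rightarrow> complex^'n \<Rightarrow> complex" where
  "cdot b z = (\<Sum>i\<in>UNIV. of_real (b$i) * z$i)"

lemma mev_specm:
  shows "mev (specm B c) z u = (\<Sum>b\<in>B. of_real (c b) * cdot b z * cdot b u)"
proof -
  have "mev (specm B c) z u = (\<Sum>i\<in>UNIV. \<Sum>j\<in>UNIV. \<Sum>b\<in>B. of_real (c b) * (of_real (b$i) * z$i) * (of_real (b$j) * u$j))"
    unfolding mev_def ev2_def specm_def by (simp add: sum_distrib_right sum_distrib_left mult_ac)
  also have "\<dots> = (\<Sum>i\<in>UNIV. \<Sum>b\<in>B. \<Sum>j\<in>UNIV. of_real (c b) * (of_real (b$i) * z$i) * (of_real (b$j) * u$j))"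
    by (rule sum.cong[OF refl], rule sum.swap)
  also have "\<dots> = (\<Sum>b\<in>B. \<Sum>i\<in>UNIV. \<Sum>j\<in>UNIV. of_real (c b) * (of_real (b$i) * z$i) * (of_real (b$j) * u$j))"
    by (rule sum.swap)
  also have "\<dots> = (\<Sum>b\<in>B. of_real (c b) * cdot b z * cdot b u)"
    unfolding cdot_def by (simp add: sum_distrib_left sum_distrib_right mult_ac)
  finally show ?thesis .
qed

lemma cdot_cconj: "cdot b (cconj z) = cnj (cdot b z)"
  by (simp add: cdot_def)

text \<open>The squared moduli are those of the Pluecker coordinates of \<open>z\<close> and
  \<open>w\<close> in the basis \<open>B\<close>: forms diagonal in \<open>B\<close> give a
  curvature operator diagonal on 2-vectors.\<close>

lemma curvq_odot_specm:
  "curvq (odot (specm B c) (specm B d)) z w =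
     (\<Sum>a\<in>B. \<Sum>b\<in>B. c a * d b * (cmod (cdot a z * cdot b w - cdot b z * cdot a w))\<^sup>2)"
proof -
  let ?z = "\<lambda>b. cdot b z" and ?w = "\<lambda>b. cdot b w"
  have "cev (odot (specm B c) (specm B d)) z w (cconj z) (cconj w) =
    (\<Sum>a\<in>B. \<Sum>b\<in>B. of_real (c a) * ?z a * cnj (?z a) * (of_real (d b) * ?w b * cnj (?w b))
      - of_real (c a) * ?z a * cnj (?w a) * (of_real (d b) * ?w b * cnj (?z b))
      - of_real (c a) * ?w a * cnj (?z a) * (of_real (d b) * ?z b * cnj (?w b))
      + of_real (c a) * ?w a * cnj (?w a) * (of_real (d b) * ?z b * cnj (?z b)))"
    unfolding cev_odot mev_specm cdot_cconj sum.distrib sum_subtractf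
    by (simp add: sum_product[symmetric] mult.commute)
  also have "\<dots> = (\<Sum>a\<in>B. \<Sum>b\<in>B. of_real (c a * d b * (cmod (?z a * ?w b - ?z b * ?w a))\<^sup>2))"
    by (intro sum.cong refl, simp only: of_real_mult complex_norm_square) (simp add: algebra_simps)
  finally show ?thesis unfolding curvq_def by simp
qed

lemma sum_squares_le_square_sum:
  fixes k :: "'a \<Rightarrow> real"
  assumes "finite B" "\<And>b. b \<in> B \<Longrightarrow> 0 \<le> k b"
  shows "(\<Sum>b\<in>B. (k b)\<^sup>2) \<le> (\<Sum>b\<in>B. k b)\<^sup>2"
proof -
  have "(\<Sum>b\<in>B. (k b)\<^sup>2) \<le> (\<Sum>b\<in>B. k b * (\<Sum>b\<in>B. k b))"
    unfolding power2_eq_square using assms by (intro sum_mono mult_left_mono member_le_sum) auto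
  then show ?thesis by (simp add: power2_eq_square sum_distrib_right)
qed

text \<open>Here \<open>x\<close> and \<open>y\<close> are two eigenvalues of \<open>K\<close>,
  \<open>\<tau>\<close> is its trace and \<open>N\<close> the trace of its square. The expression is
  bounded below by an affine function of \<open>A\<close>, so its values at \<open>A = 0\<close> and
  \<open>A = \<sigma>\<^sup>2 \<Lambda>\<^sup>2\<close> decide; these are the two bounds on
  \<open>\<nu>\<close>.\<close>

lemma pinching_eigenvalue_bound:
  fixes x y \<tau> N \<sigma> \<Lambda> \<nu> m :: real
  assumes xy: "0 \<le> x" "0 \<le> y" "x + y \<le> \<tau>" and N: "N \<le> x\<^sup>2 + y\<^sup>2 + (\<tau> - x - y)\<^sup>2"
    and \<sigma>: "0 < \<sigma>" "\<sigma> \<le> 2" and \<tau>: "\<tau> = 2 * \<sigma> * \<Lambda>" and m: "2 \<le> m"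
    and \<nu>: "\<nu> \<le> (1 - \<sigma>)\<^sup>2" "\<nu> \<le> (1 - \<sigma> / 2)\<^sup>2"
  shows "0 \<le> m * x * y - \<tau> * (x + y) + x\<^sup>2 + y\<^sup>2 + (4 * \<Lambda>\<^sup>2 - (2 - \<sigma>) / \<sigma> * N - 4 * \<Lambda>\<^sup>2 * \<nu>)"
proof -
  define s where "s = x + y"
  define A where "A = s * (\<tau> - s)"
  have A0: "0 \<le> A" using xy by (simp add: A_def s_def)
  have A1: "A \<le> \<sigma>\<^sup>2 * \<Lambda>\<^sup>2"
  proof -
    have "0 \<le> (\<tau> / 2 - s)\<^sup>2" by simp
    then have "A \<le> (\<tau> / 2)\<^sup>2" unfolding A_def by (simp add: power2_eq_square algebra_simps)
    then show ?thesis unfolding \<tau> by (simp add: power_mult_distrib)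
  qed
  have xy0: "0 \<le> x * y" using xy by simp
  have "N \<le> \<tau>\<^sup>2 - 2 * A"
    using N xy0 unfolding A_def s_def by (simp add: power2_eq_square algebra_simps)
  then have "(2 - \<sigma>) / \<sigma> * N \<le> (2 - \<sigma>) / \<sigma> * (\<tau>\<^sup>2 - 2 * A)"
    using \<sigma> by (intro mult_left_mono) auto
  also have "\<dots> = 4 * \<sigma> * (2 - \<sigma>) * \<Lambda>\<^sup>2 - (4 / \<sigma> - 2) * A"
    unfolding \<tau> using \<sigma> by (simp add: field_simps power2_eq_square)
  finally have 1: "(2 - \<sigma>) / \<sigma> * N \<le> 4 * \<sigma> * (2 - \<sigma>) * \<Lambda>\<^sup>2 - (4 / \<sigma> - 2) * A" .
  have "2 * (x * y) \<le> m * (x * y)" using m xy0 by (rule mult_right_mono)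
  then have 2: "- A \<le> m * x * y - \<tau> * (x + y) + x\<^sup>2 + y\<^sup>2"
    unfolding A_def s_def by (simp add: power2_eq_square algebra_simps)
  \<comment> \<open>The sign of the slope \<open>4 / \<sigma> - 3\<close> tells which end of the
    range of \<open>A\<close> is the minimum.\<close>
  have 3: "0 \<le> 4 * \<Lambda>\<^sup>2 * ((1 - \<sigma>)\<^sup>2 - \<nu>) + (4 / \<sigma> - 3) * A"
  proof (cases "3 \<le> 4 / \<sigma>")
    case True
    then show ?thesis using A0 \<nu> by (intro add_nonneg_nonneg mult_nonneg_nonneg) auto
  next
    case False
    have "(4 / \<sigma> - 3) * (\<sigma>\<^sup>2 * \<Lambda>\<^sup>2) \<le> (4 / \<sigma> - 3) * A"
      using False A1 by (intro mult_left_mono_neg) auto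
    moreover have "4 * \<Lambda>\<^sup>2 * ((1 - \<sigma>)\<^sup>2 - \<nu>) + (4 / \<sigma> - 3) * (\<sigma>\<^sup>2 * \<Lambda>\<^sup>2) = 4 * \<Lambda>\<^sup>2 * ((1 - \<sigma> / 2)\<^sup>2 - \<nu>)"
      using \<sigma> by (simp add: field_simps power2_eq_square)
    moreover have "0 \<le> 4 * \<Lambda>\<^sup>2 * ((1 - \<sigma> / 2)\<^sup>2 - \<nu>)" using \<nu> by simp
    ultimately show ?thesis by linarith
  qed
  have "4 * \<Lambda>\<^sup>2 * ((1 - \<sigma>)\<^sup>2 - \<nu>) + (4 / \<sigma> - 3) * A
     = - A + 4 * \<Lambda>\<^sup>2 - (4 * \<sigma> * (2 - \<sigma>) * \<Lambda>\<^sup>2 - (4 / \<sigma> - 2) * A) - 4 * \<Lambda>\<^sup>2 * \<nu>"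
    by (simp add: power2_eq_square algebra_simps)
  then show ?thesis using 1 2 3 by linarith
qed

text \<open>In an eigenbasis the tensor has coefficients \<open>x a b\<close> that are not
  symmetric, while the squared coordinates are. Hence only \<open>x a b + x b a\<close> matters, for
  distinct eigenvectors, and \<open>pinching_eigenvalue_bound\<close> applies.\<close>

lemma pinching_tensor_nonneg:
  fixes K :: "real^'n::finite^'n"
  assumes K: "transpose K = K" "psd K" and tr: "trace K = 2 * \<sigma> * \<Lambda>"
    and \<sigma>: "0 < \<sigma>" "\<sigma> \<le> 2" and m: "2 \<le> m"
    and \<nu>: "\<nu> \<le> (1 - \<sigma>)\<^sup>2" "\<nu> \<le> (1 - \<sigma> / 2)\<^sup>2"
  shows "0 \<le> curvq (m *\<^sub>R odot K K - (2 * trace K) *\<^sub>R odot K (mat 1) + 2 *\<^sub>R odot (K ** K) (mat 1)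
     + (4 * \<Lambda>\<^sup>2 - (2 - \<sigma>) / \<sigma> * trace (K ** K) - 4 * \<Lambda>\<^sup>2 * \<nu>) *\<^sub>R odot (mat 1) (mat 1)) z w"
proof -
  obtain B k where B: "finite B" "\<And>b. b \<in> B \<Longrightarrow> norm b = 1" "\<And>b. b \<in> B \<Longrightarrow> K *v b = k b *\<^sub>R b"
    "K = specm B k" "K ** K = specm B (\<lambda>b. (k b)\<^sup>2)" "mat 1 = specm B (\<lambda>b. 1)"
    using symmetric_spectral[OF K(1)] by metis
  have k0: "0 \<le> k b" if "b \<in> B" for b using psd_eigenvalue_nonneg[OF K(2) B(2,3)] that by blast
  define \<tau> where "\<tau> = trace K"
  have \<tau>: "\<tau> = (\<Sum>b\<in>B. k b)" unfolding \<tau>_def by (subst B(4)) (rule trace_specm[OF B(2)])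
  have N: "trace (K ** K) = (\<Sum>b\<in>B. (k b)\<^sup>2)" by (subst B(5)) (rule trace_specm[OF B(2)])
  define c where "c = 4 * \<Lambda>\<^sup>2 - (2 - \<sigma>) / \<sigma> * trace (K ** K) - 4 * \<Lambda>\<^sup>2 * \<nu>"
  define \<omega> where "\<omega> a b = (cmod (cdot a z * cdot b w - cdot b z * cdot a w))\<^sup>2" for a b
  define x where "x a b = m * k a * k b - 2 * \<tau> * k a + 2 * (k a)\<^sup>2 + c" for a b
  have "curvq (odot K K) z w = (\<Sum>a\<in>B. \<Sum>b\<in>B. k a * k b * \<omega> a b)"
    unfolding \<omega>_def by (subst (1 2) B(4)) (rule curvq_odot_specm)
  moreover have "curvq (odot K (mat 1)) z w = (\<Sum>a\<in>B. \<Sum>b\<in>B. k a * 1 * \<omega> a b)"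
    unfolding \<omega>_def by (subst B(4), subst B(6)) (rule curvq_odot_specm)
  moreover have "curvq (odot (K ** K) (mat 1)) z w = (\<Sum>a\<in>B. \<Sum>b\<in>B. (k a)\<^sup>2 * 1 * \<omega> a b)"
    unfolding \<omega>_def by (subst B(5), subst B(6)) (rule curvq_odot_specm)
  moreover have "curvq (odot (mat 1) (mat 1)) z w = (\<Sum>a\<in>B. \<Sum>b\<in>B. 1 * 1 * \<omega> a b)"
    unfolding \<omega>_def by (subst (1 2) B(6)) (rule curvq_odot_specm)
  ultimately have eq: "curvq (m *\<^sub>R odot K K - (2 * trace K) *\<^sub>R odot K (mat 1) + 2 *\<^sub>R odot (K ** K) (mat 1)
     + c *\<^sub>R odot (mat 1) (mat 1)) z w = (\<Sum>a\<in>B. \<Sum>b\<in>B. x a b * \<omega> a b)"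
    unfolding curvq_add curvq_diff curvq_scaleR x_def \<tau>_def[symmetric]
    by (simp add: sum_distrib_left algebra_simps sum.distrib sum_subtractf)
  have sym: "\<omega> b a = \<omega> a b" for a b
    unfolding \<omega>_def by (simp add: norm_minus_commute mult.commute)
  have diag: "\<omega> a a = 0" for a unfolding \<omega>_def by simp
  have "2 * (\<Sum>a\<in>B. \<Sum>b\<in>B. x a b * \<omega> a b) = (\<Sum>a\<in>B. \<Sum>b\<in>B. x a b * \<omega> a b) + (\<Sum>a\<in>B. \<Sum>b\<in>B. x b a * \<omega> b a)"
    using sum.swap[of "\<lambda>a b. x a b * \<omega> a b" B B] by simp
  also have "\<dots> = (\<Sum>a\<in>B. \<Sum>b\<in>B. (x a b + x b a) * \<omega> a b)"
    by (simp add: sum.distrib distrib_right sym)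
  also have "\<dots> \<ge> 0"
  proof (intro sum_nonneg)
    fix a b assume ab: "a \<in> B" "b \<in> B"
    show "0 \<le> (x a b + x b a) * \<omega> a b"
    proof (cases "a = b")
      case True
      then show ?thesis by (simp add: diag)
    next
      case False
      have split: "(\<Sum>b\<in>B. f b) = f a + f b + (\<Sum>b\<in>B - {a, b}. f b)" for f :: "real^'n \<Rightarrow> real"
        using B(1) ab False by (simp add: sum.remove[of B a] sum.remove[of "B - {a}" b] Diff_insert2 [symmetric])
      have rest: "\<tau> - k a - k b = (\<Sum>b\<in>B - {a, b}. k b)" unfolding \<tau> split[of k] by simp
      \<comment> \<open>The remaining eigenvalues are nonnegative, so their squares sum to at most
        the square of their sum.\<close>
      have "trace (K ** K) \<le> (k a)\<^sup>2 + (k b)\<^sup>2 + (\<tau> - k a - k b)\<^sup>2"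
        unfolding N split[of "\<lambda>b. (k b)\<^sup>2"] rest using B(1) k0
        by (intro add_left_mono sum_squares_le_square_sum) auto
      moreover have "k a + k b \<le> \<tau>"
        using rest k0 sum_nonneg[of "B - {a, b}" k] by force
      ultimately have "0 \<le> m * k a * k b - \<tau> * (k a + k b) + (k a)\<^sup>2 + (k b)\<^sup>2 + c"
        unfolding c_def using k0 ab tr \<sigma> m \<nu> by (intro pinching_eigenvalue_bound) (auto simp: \<tau>_def)
      then have "0 \<le> x a b + x b a" unfolding x_def by (simp add: algebra_simps)
      then show ?thesis by (simp add: \<omega>_def)
    qed
  qed
  finally show ?thesis using eq unfolding c_def by simp
qed

section \<open>The cones\<close>

lemma transpose_add: "transpose (A + B) = transpose A + transpose (B :: real^'n^'n)"
  and transpose_diff: "transpose (A - B) = transpose A - transpose (B :: real^'n^'n)"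
  and transpose_scaleR: "transpose (c *\<^sub>R A) = c *\<^sub>R transpose (A :: real^'n^'n)"
  by (simp_all add: transpose_def vec_eq_iff)

lemma acurv_diff: "acurv S \<Longrightarrow> acurv T \<Longrightarrow> acurv (S - T)"
  using subspace_diff[OF subspace_ACT, of S T] by (simp add: ACT_def)

lemma inner_matrix_add: "x \<bullet> ((A + B) *v x) = x \<bullet> (A *v x) + x \<bullet> (B *v x)"
  and inner_matrix_diff: "x \<bullet> ((A - B) *v x) = x \<bullet> (A *v x) - x \<bullet> (B *v x)"
  and inner_matrix_scaleR: "x \<bullet> ((c *\<^sub>R A) *v x) = c * (x \<bullet> (A *v x))"
  for A B :: "real^'n^'n"
  by (simp_all add: matrix_vector_mult_add_rdistrib matrix_vector_mult_diff_rdistrib inner_add_right inner_diff_right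
      flip: scaleR_matrix_vector_assoc)

lemma Ric0_eq_0_iff: "Ric0 (S :: 'n::finite tensor4) = 0 \<longleftrightarrow> Ric S = (scal S / real CARD('n)) *\<^sub>R mat 1"
  by (simp add: Ric0_def)

lemma Einstein_scal:
  fixes S :: "'n::finite tensor4"
  assumes "Ric S = \<rho> *\<^sub>R mat 1"
  shows "scal S = real CARD('n) * \<rho>" "Ric0 S = 0"
proof -
  show "scal S = real CARD('n) * \<rho>" unfolding scal_eq_trace assms trace_scaleR trace_mat1 by simp
  then show "Ric0 S = 0" unfolding Ric0_eq_0_iff assms by simp
qed

lemma Ric0_add: "Ric0 (S + T) = Ric0 S + Ric0 T"
  and Ric0_scaleR: "Ric0 (c *\<^sub>R S) = c *\<^sub>R Ric0 S"
  by (simp_all add: Ric0_def Ric_add Ric_scaleR scal_add scal_scaleR add_divide_distrib algebra_simps)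

lemma symmetric_curv_act:
  assumes "acurv S" "transpose H = H"
  shows "transpose (curv_act S H) = curv_act S H"
proof -
  have h: "H $ p $ q = H $ q $ p" for p q using assms(2) unfolding transpose_eq_nth by blast
  have "curv_act S H $ i $ k = curv_act S H $ k $ i" for i k
  proof -
    have "curv_act S H $ i $ k = (\<Sum>q\<in>UNIV. \<Sum>p\<in>UNIV. S $ (i,p,k,q) * H $ p $ q)"
      unfolding curv_act_def by (simp, rule sum.swap)
    also have "\<dots> = curv_act S H $ k $ i"
      unfolding curv_act_def by (simp, intro sum.cong refl) (subst acurvD(3)[OF assms(1)], subst h, simp)
    finally show ?thesis .
  qed
  then show ?thesis unfolding transpose_eq_nth by blast
qed

lemma symmetric_Ric:
  assumes "acurv S"
  shows "transpose (Ric S) = Ric S"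
  unfolding transpose_eq_nth Ric_def using acurvD(3)[OF assms] by simp

lemma curv_act_mat1: "curv_act S (mat 1) = Ric S"
  unfolding curv_act_def Ric_def by (simp add: vec_eq_iff sum_sum_mult_mat1)

lemma curv_act_diff: "curv_act S (A - B) = curv_act S A - curv_act S B"
  and curv_act_scaleR: "curv_act S (c *\<^sub>R A) = c *\<^sub>R curv_act S A"
  by (simp_all add: curv_act_def vec_eq_iff algebra_simps sum_subtractf sum_distrib_left)

lemma trace_curv_act:
  assumes "acurv S"
  shows "trace (curv_act S H) = (\<Sum>p\<in>UNIV. \<Sum>q\<in>UNIV. Ric S $ p $ q * H $ p $ q)"
proof -
  have e: "S $ (i,p,i,q) = S $ (p,i,q,i)" for i p q
    using acurvD(1)[OF assms, of i p i q] acurvD(2)[OF assms, of p i i q] by simp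
  have "trace (curv_act S H) = (\<Sum>i\<in>UNIV. \<Sum>p\<in>UNIV. \<Sum>q\<in>UNIV. S $ (p,i,q,i) * H $ p $ q)"
    unfolding trace_def curv_act_def by (simp, intro sum.cong refl, subst e, rule refl)
  also have "\<dots> = (\<Sum>p\<in>UNIV. \<Sum>i\<in>UNIV. \<Sum>q\<in>UNIV. S $ (p,i,q,i) * H $ p $ q)" by (rule sum.swap)
  also have "\<dots> = (\<Sum>p\<in>UNIV. \<Sum>q\<in>UNIV. \<Sum>i\<in>UNIV. S $ (p,i,q,i) * H $ p $ q)"
    by (rule sum.cong[OF refl], rule sum.swap)
  finally show ?thesis unfolding Ric_def by (simp add: sum_distrib_right)
qed

lemma trace_square_symmetric:
  fixes K :: "real^'n^'n"
  assumes "transpose K = K"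
  shows "trace (K ** K) = (norm K)\<^sup>2"
proof -
  have "K $ i $ j = K $ j $ i" for i j using assms unfolding transpose_eq_nth by blast
  then have "trace (K ** K) = (\<Sum>i\<in>UNIV. \<Sum>j\<in>UNIV. K$i$j * K$i$j)"
    unfolding trace_def matrix_matrix_mult_def by simp
  then show ?thesis by (simp add: power2_norm_eq_inner inner_vec_def)
qed

lemma psd_trace_bounds:
  fixes K :: "real^'n^'n"
  assumes K: "transpose K = K" "psd K"
  shows "0 \<le> trace K" "trace (K ** K) \<le> (trace K)\<^sup>2"
proof -
  obtain B k where B: "finite B" "\<And>b. b \<in> B \<Longrightarrow> norm b = 1" "\<And>b. b \<in> B \<Longrightarrow> K *v b = k b *\<^sub>R b"
    "K = specm B k" "K ** K = specm B (\<lambda>b. (k b)\<^sup>2)"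
    using symmetric_spectral[OF K(1)] by metis
  have k0: "0 \<le> k b" if "b \<in> B" for b using psd_eigenvalue_nonneg[OF K(2) B(2,3)] that by blast
  have t: "trace K = (\<Sum>b\<in>B. k b)" by (subst B(4)) (rule trace_specm[OF B(2)])
  have N: "trace (K ** K) = (\<Sum>b\<in>B. (k b)\<^sup>2)" by (subst B(5)) (rule trace_specm[OF B(2)])
  show "0 \<le> trace K" unfolding t using k0 by (rule sum_nonneg)
  show "trace (K ** K) \<le> (trace K)\<^sup>2" unfolding t N using B(1) k0 by (rule sum_squares_le_square_sum)
qed

lemma PIC2_Einstein_scal_nonneg:
  fixes S :: "'n::finite tensor4"
  assumes S: "S \<in> PIC2" "Ric0 S = 0"
  shows "0 \<le> scal S"
proof -
  obtain i :: 'n where True by blast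
  have "0 \<le> axis i 1 \<bullet> (curv_act S (mat 1) *v axis i 1)"
    using S(1) by (intro curv_act_nonneg) (auto simp: psd_def)
  also have "\<dots> = scal S / real CARD('n)"
    using S(2) unfolding curv_act_mat1 Ric0_eq_0_iff by (simp add: inner_matrix_scaleR inner_axis)
  finally show ?thesis by (simp add: zero_le_divide_iff)
qed

section \<open>Parametrisation of the cones by triples\<close>

text \<open>The linear constraints alone: they are shared by points of the cone and by directions,
  and are stable under all real multiples. \<open>cone_data\<close> adds the inequalities.\<close>

definition lin_data :: "real \<Rightarrow> 'n::finite tensor4 \<Rightarrow> real \<Rightarrow> real^'n^'n \<Rightarrow> bool" where
  "lin_data \<sigma> S \<Lambda> K \<longleftrightarrow> acurv S \<and> Ric0 S = 0 \<and> transpose K = K \<and> trace K = 2 * \<sigma> * \<Lambda>"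

text \<open>This is \<open>tr H - \<theta> scal S\<close>, since
  \<open>tr K = 2 \<sigma> \<Lambda>\<close> means
  \<open>tr H = (n - 2\<sigma>) \<Lambda>\<close>.\<close>

definition margin :: "real \<Rightarrow> real \<Rightarrow> 'n::finite tensor4 \<Rightarrow> real \<Rightarrow> real" where
  "margin \<sigma> \<theta> S \<Lambda> = (real CARD('n) - 2 * \<sigma>) * \<Lambda> - \<theta> * scal S"

definition cone_data :: "real \<Rightarrow> real \<Rightarrow> 'n::finite tensor4 \<Rightarrow> real \<Rightarrow> real^'n^'n \<Rightarrow> bool" where
  "cone_data \<sigma> \<theta> S \<Lambda> K \<longleftrightarrow> lin_data \<sigma> S \<Lambda> K \<and> S \<in> PIC2 \<and> psd K \<and> 0 \<le> margin \<sigma> \<theta> S \<Lambda>"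

definition assemble :: "'n::finite tensor4 \<Rightarrow> real \<Rightarrow> real^'n^'n \<Rightarrow> 'n tensor4" where
  "assemble S \<Lambda> K = S + odot (\<Lambda> *\<^sub>R mat 1 - K) (mat 1)"

lemma assemble_add: "assemble (S + T) (\<Lambda> + M) (K + L) = assemble S \<Lambda> K + assemble T M L"
  and assemble_scaleR: "assemble (c *\<^sub>R S) (c * \<Lambda>) (c *\<^sub>R K) = c *\<^sub>R assemble S \<Lambda> K"
  by (simp_all add: assemble_def odot_add_left odot_diff_left odot_scaleR_left algebra_simps)

lemma margin_add: "margin \<sigma> \<theta> (S + T) (\<Lambda> + M) = margin \<sigma> \<theta> S \<Lambda> + margin \<sigma> \<theta> T M"
  and margin_scaleR: "margin \<sigma> \<theta> (c *\<^sub>R S) (c * \<Lambda>) = c * margin \<sigma> \<theta> S \<Lambda>"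
  by (simp_all add: margin_def scal_add scal_scaleR algebra_simps)

lemma lin_data_add: "lin_data \<sigma> S \<Lambda> K \<Longrightarrow> lin_data \<sigma> T M L \<Longrightarrow> lin_data \<sigma> (S + T) (\<Lambda> + M) (K + L)"
  and lin_data_scaleR: "lin_data \<sigma> S \<Lambda> K \<Longrightarrow> lin_data \<sigma> (c *\<^sub>R S) (c * \<Lambda>) (c *\<^sub>R K)"
  by (simp_all add: lin_data_def acurv_add acurv_scaleR Ric0_add Ric0_scaleR transpose_add transpose_scaleR
      trace_add trace_scaleR algebra_simps)

lemma acurv_assemble: "lin_data \<sigma> S \<Lambda> K \<Longrightarrow> acurv (assemble S \<Lambda> K)"
  unfolding assemble_def lin_data_def
  by (intro acurv_add acurv_odot) (auto simp: transpose_diff transpose_scaleR)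

lemma lin_data_of_symmetric:
  fixes S :: "'n::finite tensor4"
  assumes pos: "0 < real CARD('n) - 2 * \<sigma>" and S: "acurv S" "Ric0 S = 0" and H: "transpose H = H"
  defines "\<Lambda> \<equiv> trace H / (real CARD('n) - 2 * \<sigma>)"
  shows "lin_data \<sigma> S \<Lambda> (\<Lambda> *\<^sub>R mat 1 - H)" "assemble S \<Lambda> (\<Lambda> *\<^sub>R mat 1 - H) = S + odot H (mat 1)"
    "(real CARD('n) - 2 * \<sigma>) * \<Lambda> = trace H"
proof -
  show t: "(real CARD('n) - 2 * \<sigma>) * \<Lambda> = trace H" using pos by (simp add: \<Lambda>_def)
  have "trace (\<Lambda> *\<^sub>R mat 1 - H) = 2 * \<sigma> * \<Lambda>"
    unfolding trace_sub trace_scaleR trace_mat1 t[symmetric] by (simp add: algebra_simps)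
  then show "lin_data \<sigma> S \<Lambda> (\<Lambda> *\<^sub>R mat 1 - H)"
    using S H by (simp add: lin_data_def transpose_diff transpose_scaleR)
  show "assemble S \<Lambda> (\<Lambda> *\<^sub>R mat 1 - H) = S + odot H (mat 1)" by (simp add: assemble_def)
qed

text \<open>The semidefinite matrix in the definition of the cone equals
  \<open>(n - 2\<sigma>) K\<close>, and the positive factor can be divided out.\<close>

lemma Ccone_iff:
  fixes R :: "'n::finite tensor4"
  assumes pos: "0 < real CARD('n) - 2 * \<sigma>"
  shows "R \<in> Ccone \<sigma> \<theta> \<longleftrightarrow> (\<exists>S \<Lambda> K. cone_data \<sigma> \<theta> S \<Lambda> K \<and> R = assemble S \<Lambda> K)"
proof
  assume "R \<in> Ccone \<sigma> \<theta>"
  then obtain S H where S: "S \<in> PIC2" "Ric0 S = 0" and H: "transpose H = H"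
    "psd (trace H *\<^sub>R mat 1 - (real CARD('n) - 2 * \<sigma>) *\<^sub>R H)" and m: "0 \<le> trace H - \<theta> * scal S"
    and R: "R = S + odot H (mat 1)" unfolding Ccone_def by blast
  define \<Lambda> where "\<Lambda> = trace H / (real CARD('n) - 2 * \<sigma>)"
  have aS: "acurv S" using S unfolding PIC2_iff by blast
  note L = lin_data_of_symmetric[OF pos aS S(2) H(1), folded \<Lambda>_def]
  have "trace H *\<^sub>R mat 1 - (real CARD('n) - 2 * \<sigma>) *\<^sub>R H = (real CARD('n) - 2 * \<sigma>) *\<^sub>R (\<Lambda> *\<^sub>R mat 1 - H)"
    unfolding L(3)[symmetric] by (simp add: algebra_simps)
  then have "psd (\<Lambda> *\<^sub>R mat 1 - H)"
    using H(2) pos unfolding psd_def by (simp only: inner_matrix_scaleR zero_le_mult_iff) auto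
  then have "cone_data \<sigma> \<theta> S \<Lambda> (\<Lambda> *\<^sub>R mat 1 - H)"
    using L S m by (simp add: cone_data_def margin_def)
  then show "\<exists>S \<Lambda> K. cone_data \<sigma> \<theta> S \<Lambda> K \<and> R = assemble S \<Lambda> K" using L(2) R by metis
next
  assume "\<exists>S \<Lambda> K. cone_data \<sigma> \<theta> S \<Lambda> K \<and> R = assemble S \<Lambda> K"
  then obtain S \<Lambda> K where d: "cone_data \<sigma> \<theta> S \<Lambda> K" and R: "R = assemble S \<Lambda> K" by blast
  define H where "H = \<Lambda> *\<^sub>R mat 1 - K"
  have tr: "trace K = 2 * \<sigma> * \<Lambda>" and K: "transpose K = K" "psd K" and S: "S \<in> PIC2" "Ric0 S = 0"
    using d unfolding cone_data_def lin_data_def by auto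
  have tH: "trace H = (real CARD('n) - 2 * \<sigma>) * \<Lambda>"
    unfolding H_def trace_sub trace_scaleR trace_mat1 tr by (simp add: algebra_simps)
  have eq: "trace H *\<^sub>R mat 1 - (real CARD('n) - 2 * \<sigma>) *\<^sub>R H = (real CARD('n) - 2 * \<sigma>) *\<^sub>R K"
    unfolding tH unfolding H_def by (simp add: algebra_simps)
  have "psd (trace H *\<^sub>R mat 1 - (real CARD('n) - 2 * \<sigma>) *\<^sub>R H)"
    unfolding eq using K(2) pos unfolding psd_def by (simp add: inner_matrix_scaleR)
  moreover have "transpose H = H" using K by (simp add: H_def transpose_diff transpose_scaleR)
  moreover have "0 \<le> trace H - \<theta> * scal S" using d unfolding tH cone_data_def margin_def by simp
  moreover have "acurv R" unfolding R using d acurv_assemble unfolding cone_data_def by blast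
  ultimately show "R \<in> Ccone \<sigma> \<theta>"
    unfolding Ccone_def using S R by (auto simp: assemble_def H_def)
qed

lemma Ccone_add:
  fixes R :: "'n::finite tensor4"
  assumes pos: "0 < real CARD('n) - 2 * \<sigma>" and "R \<in> Ccone \<sigma> \<theta>" "R' \<in> Ccone \<sigma> \<theta>"
  shows "R + R' \<in> Ccone \<sigma> \<theta>"
proof -
  obtain S \<Lambda> K where d: "cone_data \<sigma> \<theta> S \<Lambda> K" "R = assemble S \<Lambda> K" using assms Ccone_iff[OF pos] by blast
  obtain S' \<Lambda>' K' where d': "cone_data \<sigma> \<theta> S' \<Lambda>' K'" "R' = assemble S' \<Lambda>' K'" using assms Ccone_iff[OF pos] by blast
  have "cone_data \<sigma> \<theta> (S + S') (\<Lambda> + \<Lambda>') (K + K')"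
    using d(1) d'(1) unfolding cone_data_def PIC2_iff psd_def
    by (simp add: lin_data_add margin_add curvq_add inner_matrix_add acurv_add)
  then show ?thesis unfolding Ccone_iff[OF pos] d(2) d'(2) assemble_add[symmetric] by blast
qed

lemma Ccone_scaleR:
  fixes R :: "'n::finite tensor4"
  assumes pos: "0 < real CARD('n) - 2 * \<sigma>" and "R \<in> Ccone \<sigma> \<theta>" "0 \<le> c"
  shows "c *\<^sub>R R \<in> Ccone \<sigma> \<theta>"
proof -
  obtain S \<Lambda> K where d: "cone_data \<sigma> \<theta> S \<Lambda> K" "R = assemble S \<Lambda> K" using assms Ccone_iff[OF pos] by blast
  have "cone_data \<sigma> \<theta> (c *\<^sub>R S) (c * \<Lambda>) (c *\<^sub>R K)"
    using d(1) assms(3) unfolding cone_data_def PIC2_iff psd_def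
    by (simp add: lin_data_scaleR margin_scaleR curvq_scaleR inner_matrix_scaleR acurv_scaleR)
  then show ?thesis unfolding Ccone_iff[OF pos] d(2) assemble_scaleR[symmetric] by blast
qed

lemma convex_Ccone:
  assumes "0 < real CARD('n) - 2 * \<sigma>"
  shows "convex (Ccone \<sigma> \<theta> :: 'n::finite tensor4 set)" "cone (Ccone \<sigma> \<theta> :: 'n::finite tensor4 set)"
  using Ccone_add[OF assms] Ccone_scaleR[OF assms] by (auto intro!: convexI simp: cone_def)

lemma scal_assemble:
  fixes S :: "'n::finite tensor4"
  assumes "lin_data \<sigma> S \<Lambda> K"
  shows "scal (assemble S \<Lambda> K) = scal S + 2 * (real CARD('n) - 1) * ((real CARD('n) - 2 * \<sigma>) * \<Lambda>)"
  using assms unfolding lin_data_def assemble_def scal_add scal_odot_id trace_sub trace_scaleR trace_mat1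
  by (simp add: algebra_simps)

text \<open>\<open>S\<close> is eliminated in favour of \<open>R\<close>, so that along a convergent
  sequence of tensors \<open>R\<close> only \<open>\<Lambda>\<close> and \<open>K\<close> require a
  compactness argument.\<close>

lemma closed_cone_data: "closed {p :: 'n::finite tensor4 \<times> real \<times> (real^'n^'n).
   cone_data \<sigma> \<theta> (fst p - odot (fst (snd p) *\<^sub>R mat 1 - snd (snd p)) (mat 1)) (fst (snd p)) (snd (snd p))}"
  unfolding cone_data_def lin_data_def margin_def PIC2_iff acurv_def Ric0_def Ric_def scal_def psd_def trace_def
    transpose_def curvq_def cev_def ev4_def vec_eq_iff matrix_vector_mult_def inner_vec_def
  by (simp add: odot_nth, intro closed_Collect_conj closed_Collect_all closed_Collect_eq closed_Collect_le
      continuous_intros) simp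

text \<open>The cone is the projection of a closed set with bounded fibres:
  \<open>scal S \<ge> 0\<close> lets the scalar curvature of \<open>R\<close> bound
  \<open>\<Lambda>\<close>, and the semidefinite \<open>K\<close> is bounded by its trace
  \<open>2 \<sigma> \<Lambda>\<close>.\<close>

lemma closed_Ccone:
  assumes n: "2 \<le> CARD('n)" and pos: "0 < real CARD('n) - 2 * \<sigma>" and \<sigma>: "0 < \<sigma>"
  shows "closed (Ccone \<sigma> \<theta> :: 'n::finite tensor4 set)"
  unfolding closed_sequential_limits
proof (intro allI impI)
  fix X :: "nat \<Rightarrow> 'n tensor4" and R
  assume "(\<forall>m. X m \<in> Ccone \<sigma> \<theta>) \<and> X \<longlonglongrightarrow> R"
  then have X: "\<And>m. X m \<in> Ccone \<sigma> \<theta>" and lim: "X \<longlonglongrightarrow> R" by auto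
  have "\<forall>m. \<exists>S \<Lambda> K. cone_data \<sigma> \<theta> S \<Lambda> K \<and> X m = assemble S \<Lambda> K" using X Ccone_iff[OF pos] by blast
  then obtain S \<Lambda> K where d: "\<And>m. cone_data \<sigma> \<theta> (S m) (\<Lambda> m) (K m)" and Xm: "\<And>m. X m = assemble (S m) (\<Lambda> m) (K m)"
    by metis
  have ld: "lin_data \<sigma> (S m) (\<Lambda> m) (K m)" and tr: "trace (K m) = 2 * \<sigma> * \<Lambda> m"
    and Km: "transpose (K m) = K m" "psd (K m)" and Sm: "S m \<in> PIC2" "Ric0 (S m) = 0" for m
    using d[of m] unfolding cone_data_def lin_data_def by auto
  define a where "a = 2 * (real CARD('n) - 1) * (real CARD('n) - 2 * \<sigma>)"
  have a: "0 < a" unfolding a_def using n pos by simp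
  obtain C where C: "\<And>m. norm (X m) \<le> C" using convergent_imp_Bseq[of X] lim
    unfolding convergent_def Bseq_def by blast
  have sc: "\<bar>scal T\<bar> \<le> real (CARD('n)^2) * norm T" for T :: "'n tensor4"
  proof -
    have "\<bar>scal T\<bar> \<le> (\<Sum>i\<in>UNIV. \<Sum>j\<in>UNIV. \<bar>T $ (i,j,i,j)\<bar>)"
      unfolding scal_def Ric_def
      by (simp, rule order_trans[OF sum_abs], intro sum_mono) (rule sum_abs)
    also have "\<dots> \<le> (\<Sum>i\<in>(UNIV::'n set). \<Sum>j\<in>(UNIV::'n set). norm T)"
      by (intro sum_mono) (rule component_le_norm_cart)
    finally show ?thesis by (simp add: power2_eq_square)
  qed
  have L0: "0 \<le> \<Lambda> m" for m
    using psd_trace_bounds(1)[OF Km] \<sigma> unfolding tr by (simp add: zero_le_mult_iff)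
  have "\<Lambda> m \<le> real (CARD('n)^2) * C / a" for m
  proof -
    have "a * \<Lambda> m \<le> scal (X m)"
      unfolding Xm scal_assemble[OF ld] using PIC2_Einstein_scal_nonneg[OF Sm] by (simp add: a_def)
    also have "\<dots> \<le> real (CARD('n)^2) * C"
      using sc[of "X m"] C[of m] mult_left_mono[OF C[of m], of "real (CARD('n)^2)"] by linarith
    finally show ?thesis using a by (simp add: field_simps)
  qed
  then obtain b where b: "\<And>m. \<Lambda> m \<le> b" by blast
  have nK: "norm (K m) \<le> 2 * \<sigma> * b" for m
  proof -
    have "(norm (K m))\<^sup>2 \<le> (trace (K m))\<^sup>2"
      using psd_trace_bounds(2)[OF Km] trace_square_symmetric[OF Km(1)] by simp
    then have "norm (K m) \<le> trace (K m)" using psd_trace_bounds(1)[OF Km] by (rule power2_le_imp_le)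
    also have "\<dots> \<le> 2 * \<sigma> * b" unfolding tr using b \<sigma> by simp
    finally show ?thesis .
  qed
  have "norm (\<Lambda> m, K m) \<le> b + 2 * \<sigma> * b" for m
    using L0[of m] b[of m] nK[of m] by (intro order_trans[OF norm_Pair_le] add_mono) auto
  then have "bounded (range (\<lambda>m. (\<Lambda> m, K m)))" unfolding bounded_iff by blast
  then obtain l r where r: "strict_mono r" "((\<lambda>m. (\<Lambda> m, K m)) \<circ> r) \<longlonglongrightarrow> l"
    using bounded_imp_convergent_subsequence by blast
  let ?D = "{p :: 'n::finite tensor4 \<times> real \<times> (real^'n^'n).
   cone_data \<sigma> \<theta> (fst p - odot (fst (snd p) *\<^sub>R mat 1 - snd (snd p)) (mat 1)) (fst (snd p)) (snd (snd p))}"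
  have lim': "(\<lambda>m. ((X \<circ> r) m, ((\<lambda>m. (\<Lambda> m, K m)) \<circ> r) m)) \<longlonglongrightarrow> (R, l)"
    by (intro tendsto_Pair r(2) LIMSEQ_subseq_LIMSEQ[OF lim r(1)])
  have mem: "((X \<circ> r) m, ((\<lambda>m. (\<Lambda> m, K m)) \<circ> r) m) \<in> ?D" for m
    using d[of "r m"] by (simp add: Xm assemble_def)
  have "(R, l) \<in> ?D" by (rule closed_sequentially[OF closed_cone_data mem lim'])
  then show "R \<in> Ccone \<sigma> \<theta>"
    unfolding Ccone_iff[OF pos] by (auto simp: assemble_def intro!: exI)
qed

section \<open>Admissible directions\<close>

text \<open>Strict inward motion is demanded only where a condition is active at the base
  point.\<close>

definition strict_dir :: "real \<Rightarrow> real \<Rightarrow> 'n::finite tensor4 \<Rightarrow> real \<Rightarrow> real^'n^'n \<Rightarrow>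
    'n tensor4 \<Rightarrow> real \<Rightarrow> real^'n^'n \<Rightarrow> bool" where
  "strict_dir \<sigma> \<theta> S \<Lambda> K S' \<Lambda>' K' \<longleftrightarrow>
     (\<forall>p\<in>frames. curvq S (fst p) (snd p) = 0 \<longrightarrow> 0 < curvq S' (fst p) (snd p)) \<and>
     (\<forall>x\<in>sphere 0 1. x \<bullet> (K *v x) = 0 \<longrightarrow> 0 < x \<bullet> (K' *v x)) \<and>
     (margin \<sigma> \<theta> S \<Lambda> = 0 \<longrightarrow> 0 < margin \<sigma> \<theta> S' \<Lambda>')"

lemma continuous_on_quadratic_form: "continuous_on X (\<lambda>x. x \<bullet> (K *v x))" for K :: "real^'n^'n"
  by (intro continuous_intros linear_continuous_on) (rule matrix_vector_mul_bounded_linear)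

lemma psd_of_sphere:
  fixes K :: "real^'n^'n"
  assumes "\<And>x. x \<in> sphere 0 1 \<Longrightarrow> 0 \<le> x \<bullet> (K *v x)"
  shows "psd K"
  unfolding psd_def
proof
  fix x :: "real^'n"
  show "0 \<le> x \<bullet> (K *v x)"
  proof (cases "x = 0")
    case False
    define y where "y = x /\<^sub>R norm x"
    have "0 \<le> (norm x)\<^sup>2 * (y \<bullet> (K *v y))"
      using assms[of y] False by (simp add: y_def)
    also have "\<dots> = (norm x *\<^sub>R y) \<bullet> (K *v (norm x *\<^sub>R y))"
      by (simp add: matrix_vector_mult_scaleR power2_eq_square)
    also have "norm x *\<^sub>R y = x" using False by (simp add: y_def)
    finally show ?thesis .
  qed simp
qed

text \<open>Compactness of the frames and of the unit sphere gives a positive step for each of the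
  three conditions; the smallest one serves.\<close>

lemma Ccone_step:
  fixes S :: "'n::finite tensor4"
  assumes pos: "0 < real CARD('n) - 2 * \<sigma>"
    and d: "cone_data \<sigma> \<theta> S \<Lambda> K" and l: "lin_data \<sigma> S' \<Lambda>' K'" and st: "strict_dir \<sigma> \<theta> S \<Lambda> K S' \<Lambda>' K'"
  shows "\<exists>\<delta>>0. assemble S \<Lambda> K + \<delta> *\<^sub>R assemble S' \<Lambda>' K' \<in> Ccone \<sigma> \<theta>"
proof -
  have "\<exists>\<delta>>0. \<forall>t. 0 \<le> t \<and> t \<le> \<delta> \<longrightarrow> (\<forall>p\<in>frames. 0 \<le> curvq S (fst p) (snd p) + t * curvq S' (fst p) (snd p))"
    using d st unfolding cone_data_def PIC2_iff strict_dir_def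
    by (intro nonneg_perturb_on_compact compact_frames continuous_on_curvq) auto
  then obtain \<delta>1 where 1: "\<delta>1 > 0" "\<And>t p. 0 \<le> t \<Longrightarrow> t \<le> \<delta>1 \<Longrightarrow> p \<in> frames \<Longrightarrow> 0 \<le> curvq S (fst p) (snd p) + t * curvq S' (fst p) (snd p)"
    by blast
  have "\<exists>\<delta>>0. \<forall>t. 0 \<le> t \<and> t \<le> \<delta> \<longrightarrow> (\<forall>x\<in>sphere 0 1. 0 \<le> x \<bullet> (K *v x) + t * (x \<bullet> (K' *v x)))"
    using d st unfolding cone_data_def psd_def strict_dir_def
    by (intro nonneg_perturb_on_compact compact_sphere continuous_on_quadratic_form) auto
  then obtain \<delta>2 where 2: "\<delta>2 > 0" "\<And>t x. 0 \<le> t \<Longrightarrow> t \<le> \<delta>2 \<Longrightarrow> x \<in> sphere 0 1 \<Longrightarrow> 0 \<le> x \<bullet> (K *v x) + t * (x \<bullet> (K' *v x))"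
    by blast
  \<comment> \<open>The scalar condition is handled as a function on a one-point compact
    set.\<close>
  have "\<exists>\<delta>>0. \<forall>t. 0 \<le> t \<and> t \<le> \<delta> \<longrightarrow> (\<forall>x\<in>{0::real}. 0 \<le> margin \<sigma> \<theta> S \<Lambda> + t * margin \<sigma> \<theta> S' \<Lambda>')"
    using d st unfolding cone_data_def strict_dir_def
    by (intro nonneg_perturb_on_compact) auto
  then obtain \<delta>3 where 3: "\<delta>3 > 0" "\<And>t. 0 \<le> t \<Longrightarrow> t \<le> \<delta>3 \<Longrightarrow> 0 \<le> margin \<sigma> \<theta> S \<Lambda> + t * margin \<sigma> \<theta> S' \<Lambda>'"
    by blast
  define t where "t = min \<delta>1 (min \<delta>2 \<delta>3)"
  have t: "0 < t" "t \<le> \<delta>1" "t \<le> \<delta>2" "t \<le> \<delta>3" using 1 2 3 by (auto simp: t_def)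
  have ld: "lin_data \<sigma> (S + t *\<^sub>R S') (\<Lambda> + t * \<Lambda>') (K + t *\<^sub>R K')"
    using d l unfolding cone_data_def by (intro lin_data_add lin_data_scaleR) auto
  then have ac: "acurv (S + t *\<^sub>R S')" unfolding lin_data_def by blast
  have "0 \<le> curvq (S + t *\<^sub>R S') z w" for z w
    by (rule curvq_nonneg_of_frames[OF ac]) (use 1(2)[of t] t in \<open>simp add: curvq_add curvq_scaleR\<close>)
  then have "S + t *\<^sub>R S' \<in> PIC2" unfolding PIC2_iff using ac by blast
  moreover have "psd (K + t *\<^sub>R K')"
    using 2(2)[of t] t by (intro psd_of_sphere) (auto simp: inner_matrix_add inner_matrix_scaleR)
  moreover have "0 \<le> margin \<sigma> \<theta> (S + t *\<^sub>R S') (\<Lambda> + t * \<Lambda>')"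
    using 3(2)[of t] t by (simp add: margin_add margin_scaleR)
  ultimately have "cone_data \<sigma> \<theta> (S + t *\<^sub>R S') (\<Lambda> + t * \<Lambda>') (K + t *\<^sub>R K')"
    using ld unfolding cone_data_def by blast
  then have "assemble S \<Lambda> K + t *\<^sub>R assemble S' \<Lambda>' K' \<in> Ccone \<sigma> \<theta>"
    unfolding Ccone_iff[OF pos] assemble_add[symmetric] assemble_scaleR[symmetric] by blast
  then show ?thesis using t by blast
qed

text \<open>Strict inwardness is open along every line of directions; this is what makes room around
  \<open>Qmap R\<close> in the tangent cone.\<close>

lemma strict_dir_perturb:
  fixes S :: "'n::finite tensor4"
  assumes st: "strict_dir \<sigma> \<theta> S \<Lambda> K S' \<Lambda>' K'"
  shows "\<exists>\<eta>>0. strict_dir \<sigma> \<theta> S \<Lambda> K (S' + \<eta> *\<^sub>R S'') (\<Lambda>' + \<eta> * \<Lambda>'') (K' + \<eta> *\<^sub>R K'')"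
proof -
  have "\<exists>\<delta>>0. \<forall>t. 0 \<le> t \<and> t \<le> \<delta> \<longrightarrow> (\<forall>p\<in>frames. curvq S (fst p) (snd p) = 0 \<longrightarrow>
      0 < curvq S' (fst p) (snd p) + t * curvq S'' (fst p) (snd p))"
    using st unfolding strict_dir_def
    by (intro pos_perturb_on_zero_set compact_frames continuous_on_curvq) auto
  then obtain \<delta>1 where 1: "\<delta>1 > 0" "\<And>t p. 0 \<le> t \<Longrightarrow> t \<le> \<delta>1 \<Longrightarrow> p \<in> frames \<Longrightarrow> curvq S (fst p) (snd p) = 0 \<Longrightarrow>
      0 < curvq S' (fst p) (snd p) + t * curvq S'' (fst p) (snd p)"
    by blast
  have "\<exists>\<delta>>0. \<forall>t. 0 \<le> t \<and> t \<le> \<delta> \<longrightarrow> (\<forall>x\<in>sphere 0 1. x \<bullet> (K *v x) = 0 \<longrightarrow>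
      0 < x \<bullet> (K' *v x) + t * (x \<bullet> (K'' *v x)))"
    using st unfolding strict_dir_def
    by (intro pos_perturb_on_zero_set compact_sphere continuous_on_quadratic_form) auto
  then obtain \<delta>2 where 2: "\<delta>2 > 0" "\<And>t x. 0 \<le> t \<Longrightarrow> t \<le> \<delta>2 \<Longrightarrow> x \<in> sphere 0 1 \<Longrightarrow> x \<bullet> (K *v x) = 0 \<Longrightarrow>
      0 < x \<bullet> (K' *v x) + t * (x \<bullet> (K'' *v x))"
    by blast
  have "\<exists>\<delta>>0. \<forall>t. 0 \<le> t \<and> t \<le> \<delta> \<longrightarrow> (\<forall>x\<in>{0::real}. margin \<sigma> \<theta> S \<Lambda> = 0 \<longrightarrow>
      0 < margin \<sigma> \<theta> S' \<Lambda>' + t * margin \<sigma> \<theta> S'' \<Lambda>'')"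
    using st unfolding strict_dir_def
    by (intro pos_perturb_on_zero_set) auto
  then obtain \<delta>3 where 3: "\<delta>3 > 0" "\<And>t. 0 \<le> t \<Longrightarrow> t \<le> \<delta>3 \<Longrightarrow> margin \<sigma> \<theta> S \<Lambda> = 0 \<Longrightarrow>
      0 < margin \<sigma> \<theta> S' \<Lambda>' + t * margin \<sigma> \<theta> S'' \<Lambda>''"
    by blast
  define t where "t = min \<delta>1 (min \<delta>2 \<delta>3)"
  have t: "0 < t" "t \<le> \<delta>1" "t \<le> \<delta>2" "t \<le> \<delta>3" using 1 2 3 by (auto simp: t_def)
  have "strict_dir \<sigma> \<theta> S \<Lambda> K (S' + t *\<^sub>R S'') (\<Lambda>' + t * \<Lambda>'') (K' + t *\<^sub>R K'')"
    unfolding strict_dir_def curvq_add curvq_scaleR inner_matrix_add inner_matrix_scaleR margin_add margin_scaleR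
    using 1(2)[of t] 2(2)[of t] 3(2)[of t] t by simp
  then show ?thesis using t by blast
qed

text \<open>\<open>\<mu>\<close> measures how far \<open>\<sigma>\<close> is from the degenerate values 1 and 2. The multiple \<open>c\<close> of \<open>id \<odot> id\<close> moved from
  the \<open>H\<close>-part to the \<open>S\<close>-part is chosen so that both the PIC2 condition and \<open>K \<ge> 0\<close> gain a
  multiple of \<open>\<mu> \<Lambda>\<^sup>2\<close>.\<close>

lemma Qmap_assemble:
  fixes S :: "'n::finite tensor4"
  assumes n: "5 \<le> CARD('n)" and \<sigma>: "0 < \<sigma>" "\<sigma> \<le> 2"
    and \<theta>: "0 \<le> \<theta>" "\<theta> \<le> 1 / (8 * (real CARD('n))\<^sup>2)"
    and d: "cone_data \<sigma> \<theta> S \<Lambda> K"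
    and \<mu>: "2 * \<mu> \<le> (1 - \<sigma>)\<^sup>2" "2 * \<mu> \<le> (1 - \<sigma> / 2)\<^sup>2" "0 \<le> \<mu>"
  obtains S' \<Lambda>' K' where "lin_data \<sigma> S' \<Lambda>' K'" "Qmap (assemble S \<Lambda> K) = assemble S' \<Lambda>' K'"
    "\<And>p. p \<in> frames \<Longrightarrow> curvq S (fst p) (snd p) = 0 \<Longrightarrow> 8 * \<Lambda>\<^sup>2 * \<mu> \<le> curvq S' (fst p) (snd p)"
    "\<And>x. x \<in> sphere 0 1 \<Longrightarrow> x \<bullet> (K *v x) = 0 \<Longrightarrow> 8 * \<sigma> * \<Lambda>\<^sup>2 * \<mu> \<le> (real CARD('n) - 2 * \<sigma>) * (x \<bullet> (K' *v x))"
    "margin \<sigma> \<theta> S \<Lambda> = 0 \<Longrightarrow> \<theta> * (scal S)\<^sup>2 / real CARD('n) \<le> margin \<sigma> \<theta> S' \<Lambda>'"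
proof -
  let ?I = "mat 1 :: real^'n^'n"
  define n where "n = real CARD('n)"
  have n5: "5 \<le> n" using n by (simp add: n_def)
  have pos: "0 < n - 2 * \<sigma>" "1 \<le> n - 2 * \<sigma>" using n5 \<sigma> by auto
  have S: "S \<in> PIC2" "acurv S" "Ric0 S = 0" and K: "transpose K = K" "psd K" and tr: "trace K = 2 * \<sigma> * \<Lambda>"
    using d unfolding cone_data_def lin_data_def by auto
  define r where "r = scal S / n"
  define N where "N = trace (K ** K)"
  define H where "H = \<Lambda> *\<^sub>R ?I - K"
  \<comment> \<open>\<open>K \<ge> 0\<close> allows \<open>c\<close> up to the value with
    \<open>\<mu> = 0\<close>; the last term gives up part of it to gain strictness on the kernel of
    \<open>K\<close>.\<close>
  define c where "c = 4 * \<Lambda>\<^sup>2 - (2 - \<sigma>) / \<sigma> * N - 4 * \<Lambda>\<^sup>2 * \<mu>"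
  have Ric: "Ric S = r *\<^sub>R ?I" using S(3) unfolding Ric0_eq_0_iff r_def n_def .
  have N0: "0 \<le> N" unfolding N_def trace_square_symmetric[OF K(1)] by simp
  have N1: "N \<le> (2 * \<sigma> * \<Lambda>)\<^sup>2" using psd_trace_bounds(2)[OF K] unfolding N_def tr .
  have c4: "c \<le> 4 * \<Lambda>\<^sup>2"
  proof -
    have "0 \<le> (2 - \<sigma>) / \<sigma> * N" "0 \<le> 4 * \<Lambda>\<^sup>2 * \<mu>" using N0 \<sigma> \<mu>(3) by auto
    then show ?thesis unfolding c_def by linarith
  qed
  have \<sigma>c: "\<sigma> * c = 4 * \<sigma> * \<Lambda>\<^sup>2 - (2 - \<sigma>) * N - 4 * \<sigma> * \<Lambda>\<^sup>2 * \<mu>"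
    unfolding c_def using \<sigma> by (simp add: field_simps)
  have Hs: "transpose H = H" using K by (simp add: H_def transpose_diff transpose_scaleR)
  have KK: "transpose (K ** K) = K ** K" using K by (simp add: matrix_transpose_mul)
  have HH: "transpose (H ** H) = H ** H" using Hs by (simp add: matrix_transpose_mul)
  have trH: "trace H = (n - 2 * \<sigma>) * \<Lambda>"
    unfolding H_def trace_sub trace_scaleR trace_mat1 tr n_def by (simp add: algebra_simps)
  have H2: "H ** H = \<Lambda>\<^sup>2 *\<^sub>R ?I - (2 * \<Lambda>) *\<^sub>R K + K ** K"
  proof -
    have "(H ** H) $ i $ j = (\<Sum>k\<in>UNIV. (\<Lambda>\<^sup>2 * ?I$i$k) * ?I$k$j - (\<Lambda> * K$i$k) * ?I$k$j - (\<Lambda> * K$k$j) * ?I$i$k + K$i$k * K$k$j)" for i j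
      unfolding H_def matrix_matrix_mult_def by (simp add: algebra_simps power2_eq_square)
    then have "(H ** H) $ i $ j = \<Lambda>\<^sup>2 * ?I$i$j - \<Lambda> * K$i$j - \<Lambda> * K$i$j + (K ** K) $ i $ j" for i j
      by (simp only: sum.distrib sum_subtractf sum_mult_mat1) (simp add: matrix_matrix_mult_def)
    then show ?thesis by (simp add: vec_eq_iff)
  qed
  have trHH: "trace (H ** H) = n * \<Lambda>\<^sup>2 - 4 * \<sigma> * \<Lambda>\<^sup>2 + N"
    unfolding H2 trace_add trace_sub trace_scaleR trace_mat1 tr N_def n_def by (simp add: algebra_simps power2_eq_square)
  \<comment> \<open>The term \<open>(n - 2) odot K K\<close> of \<open>Qmap\<close> is not Einstein.
    Its Ricci tensor has the trace-free part of \<open>(n - 2) (2 tr K K - 2 K\<^sup>2)\<close>,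
    which the two corrections with \<open>odot id\<close> cancel; \<open>H'\<close> compensates for
    them and for \<open>c\<close>.\<close>
  define S' where "S' = Qmap S + ((n - 2) *\<^sub>R odot K K - (2 * trace K) *\<^sub>R odot K ?I + 2 *\<^sub>R odot (K ** K) ?I + c *\<^sub>R odot ?I ?I)"
  define H' where "H' = (2 * r) *\<^sub>R H + 2 *\<^sub>R curv_act S H + ((n - 2) * \<Lambda>\<^sup>2) *\<^sub>R ?I - (2 * (n - 2) * \<Lambda>) *\<^sub>R K
     + (2 * trace K) *\<^sub>R K - 2 *\<^sub>R (K ** K) + (2 * trace H) *\<^sub>R H - 2 *\<^sub>R (H ** H) + (trace (H ** H)) *\<^sub>R ?I - c *\<^sub>R ?I"
  define \<Lambda>' where "\<Lambda>' = trace H' / (real CARD('n) - 2 * \<sigma>)"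
  define K' where "K' = \<Lambda>' *\<^sub>R ?I - H'"
  have oHH: "odot H H = \<Lambda>\<^sup>2 *\<^sub>R odot ?I ?I - (2 * \<Lambda>) *\<^sub>R odot K ?I + odot K K"
    unfolding H_def odot_diff_left odot_diff_right odot_scaleR_left odot_scaleR_right odot_commute[of ?I K]
    by (simp add: vec_eq_iff algebra_simps power2_eq_square)
  have Q: "Qmap (assemble S \<Lambda> K) = S' + odot H' ?I"
    unfolding assemble_def H_def[symmetric] Qmap_add_odot_id[OF S(2) Hs] oHH Ric S'_def H'_def n_def[symmetric]
      odot_add_left odot_diff_left odot_scaleR_left odot_commute[of ?I H]
    by (simp add: vec_eq_iff algebra_simps)
  have aS': "acurv S'"
    unfolding S'_def using acurv_Qmap[OF S(2)] K KK by (intro acurv_add acurv_diff acurv_scaleR acurv_odot) auto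
  define \<rho> where "\<rho> = 2 * r\<^sup>2 - 2 * (2 * \<sigma> * \<Lambda>)\<^sup>2 + 2 * N + 2 * (n - 1) * c"
  have RQ: "Ric (Qmap S) = (2 * r\<^sup>2) *\<^sub>R ?I"
    unfolding Ric_Qmap[OF S(2)] Ric curv_act_scaleR curv_act_mat1 by (simp add: power2_eq_square)
  have RK: "Ric (odot K K) = (2 * trace K) *\<^sub>R K - 2 *\<^sub>R (K ** K)"
    unfolding Ric_odot[OF K(1)] by (simp add: vec_eq_iff)
  have RicS': "Ric S' = \<rho> *\<^sub>R ?I"
    unfolding S'_def Ric_add Ric_diff Ric_scaleR Ric_odot_id RQ RK n_def[symmetric] trace_mat1 \<rho>_def N_def[symmetric] tr
    by (simp add: vec_eq_iff algebra_simps power2_eq_square)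
  note E = Einstein_scal[OF RicS', folded n_def]
  have H's: "transpose H' = H'"
    unfolding H'_def using Hs K KK HH symmetric_curv_act[OF S(2) Hs]
    by (simp add: transpose_add transpose_diff transpose_scaleR)
  note L = lin_data_of_symmetric[OF pos(1)[unfolded n_def] aS' E(2) H's, folded \<Lambda>'_def K'_def]
  have trcH: "trace (curv_act S H) = r * trace H"
  proof -
    have "trace (curv_act S H) = (\<Sum>p\<in>UNIV. \<Sum>q\<in>UNIV. (r * H$p$q) * ?I$p$q)"
      unfolding trace_curv_act[OF S(2)] Ric by (simp add: mult_ac)
    then show ?thesis unfolding sum_sum_mult_mat1 trace_def by (simp add: sum_distrib_left)
  qed
  \<comment> \<open>Chosen so that, up to \<open>- 2 * A\<close>, \<open>H'\<close> takes the value
    \<open>4 r \<Lambda> + q - c\<close> on unit vectors in the kernel of \<open>K\<close>. The same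
    quantity leads \<open>trace H'\<close> and cancels in
    \<open>K' = \<Lambda>' id - H'\<close>.\<close>
  define q where "q = (4 * n - 4) * \<Lambda>\<^sup>2 - 8 * \<sigma> * \<Lambda>\<^sup>2 + N"
  have trH': "trace H' = (n - 2 * \<sigma>) * (4 * r * \<Lambda> + q - c) + 8 * \<sigma> * \<Lambda>\<^sup>2 * \<mu>"
  proof -
    have "trace H' = 4 * r * (n - 2 * \<sigma>) * \<Lambda> + n * (n - 2) * \<Lambda>\<^sup>2 - 4 * (n - 2) * \<sigma> * \<Lambda>\<^sup>2
      + 8 * \<sigma>\<^sup>2 * \<Lambda>\<^sup>2 - 2 * N + 2 * ((n - 2 * \<sigma>) * \<Lambda>)\<^sup>2 + (n - 2) * (n * \<Lambda>\<^sup>2 - 4 * \<sigma> * \<Lambda>\<^sup>2 + N) - n * c"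
      unfolding H'_def trace_add trace_sub trace_scaleR trace_mat1 trcH trHH trH tr N_def[symmetric] n_def[symmetric]
      by (simp add: algebra_simps power2_eq_square)
    also have "\<dots> = (n - 2 * \<sigma>) * (4 * r * \<Lambda> + q - c) + 8 * \<sigma> * \<Lambda>\<^sup>2 - (4 - 2 * \<sigma>) * N - 2 * (\<sigma> * c)"
      unfolding q_def by (simp add: algebra_simps power2_eq_square)
    finally show ?thesis unfolding \<sigma>c by (simp add: algebra_simps)
  qed
  show ?thesis
  proof (rule that[OF L(1)])
    show "Qmap (assemble S \<Lambda> K) = assemble S' \<Lambda>' K'" unfolding Q L(2) ..
  next
    fix p :: "(complex^'n) \<times> (complex^'n)" assume p: "p \<in> frames" and z: "curvq S (fst p) (snd p) = 0"
    \<comment> \<open>The pinching inequality is used with \<open>\<nu> = 2 * \<mu>\<close>. The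
      unspent \<open>4 \<Lambda>\<^sup>2 \<mu>\<close> times \<open>odot id id\<close>, which has
      value 2 on frames, is the gain.\<close>
    have cc: "c = (4 * \<Lambda>\<^sup>2 - (2 - \<sigma>) / \<sigma> * trace (K ** K) - 4 * \<Lambda>\<^sup>2 * (2 * \<mu>)) + 4 * \<Lambda>\<^sup>2 * \<mu>"
      unfolding c_def N_def by simp
    have "S' = Qmap S + ((n - 2) *\<^sub>R odot K K - (2 * trace K) *\<^sub>R odot K ?I + 2 *\<^sub>R odot (K ** K) ?I
        + (4 * \<Lambda>\<^sup>2 - (2 - \<sigma>) / \<sigma> * trace (K ** K) - 4 * \<Lambda>\<^sup>2 * (2 * \<mu>)) *\<^sub>R odot ?I ?I)
        + (4 * \<Lambda>\<^sup>2 * \<mu>) *\<^sub>R odot ?I ?I" (is "_ = _ + ?D + _")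
      unfolding S'_def by (subst cc) (simp only: scaleR_add_left add.assoc)
    moreover have "0 \<le> curvq ?D (fst p) (snd p)"
      using K tr \<sigma> \<mu> n5 by (intro pinching_tensor_nonneg) auto
    moreover have "curvq (odot ?I ?I) (fst p) (snd p) = 2"
      using curvq_odot_id_frames[of "fst p" "snd p"] p by simp
    ultimately show "8 * \<Lambda>\<^sup>2 * \<mu> \<le> curvq S' (fst p) (snd p)"
      using Qmap_nonneg_at_PIC2_zero[OF S(1) z] by (simp only: curvq_add curvq_scaleR)
  next
    fix x :: "real^'n" assume x: "x \<in> sphere 0 1" and z: "x \<bullet> (K *v x) = 0"
    have xx: "x \<bullet> x = 1" using x by (simp add: dot_square_norm)
    have Kx: "K *v x = 0" by (rule psd_zero_imp_kernel[OF K z])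
    have KKx: "x \<bullet> ((K ** K) *v x) = 0" using Kx by (simp flip: matrix_vector_mul_assoc)
    have Hx: "x \<bullet> (H *v x) = \<Lambda>" unfolding H_def inner_matrix_diff inner_matrix_scaleR z using xx by simp
    have HHx: "x \<bullet> ((H ** H) *v x) = \<Lambda>\<^sup>2"
      unfolding H2 inner_matrix_add inner_matrix_diff inner_matrix_scaleR z KKx using xx by simp
    define A where "A = x \<bullet> (curv_act S K *v x)"
    have A: "0 \<le> A" unfolding A_def by (rule curv_act_nonneg[OF S(1) K])
    have cHx: "x \<bullet> (curv_act S H *v x) = \<Lambda> * r - A"
      unfolding H_def curv_act_diff curv_act_scaleR curv_act_mat1 Ric inner_matrix_diff inner_matrix_scaleR A_def
      using xx by simp
    have H'x: "x \<bullet> (H' *v x) = 4 * r * \<Lambda> + q - c - 2 * A"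
      unfolding H'_def inner_matrix_add inner_matrix_diff inner_matrix_scaleR z KKx Hx HHx cHx trHH trH q_def
      using xx by (simp add: algebra_simps power2_eq_square)
    have "(n - 2 * \<sigma>) * (x \<bullet> (K' *v x)) = trace H' - (n - 2 * \<sigma>) * (4 * r * \<Lambda> + q - c - 2 * A)"
      unfolding K'_def inner_matrix_diff inner_matrix_scaleR H'x L(3)[folded n_def, symmetric]
      using xx by (simp add: algebra_simps)
    also have "\<dots> = 8 * \<sigma> * \<Lambda>\<^sup>2 * \<mu> + 2 * (n - 2 * \<sigma>) * A" unfolding trH' by (simp add: algebra_simps)
    finally show "8 * \<sigma> * \<Lambda>\<^sup>2 * \<mu> \<le> (real CARD('n) - 2 * \<sigma>) * (x \<bullet> (K' *v x))"
      using A pos(1) unfolding n_def[symmetric] by simp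
  next
    assume m: "margin \<sigma> \<theta> S \<Lambda> = 0"
    define s where "s = scal S"
    have m': "(n - 2 * \<sigma>) * \<Lambda> = \<theta> * s" using m unfolding margin_def n_def s_def by simp
    have rs: "r = s / n" by (simp add: r_def s_def)
    \<comment> \<open>On the active face \<open>(n - 2\<sigma>) \<Lambda> = \<theta> s\<close> with
      \<open>n - 2\<sigma> \<ge> 1\<close>, so every error quadratic in \<open>\<Lambda>\<close> is
      of order \<open>\<theta>\<^sup>2 s\<^sup>2\<close>.\<close>
    have "1 * \<Lambda>\<^sup>2 \<le> (n - 2 * \<sigma>)\<^sup>2 * \<Lambda>\<^sup>2" using pos by (intro mult_right_mono) auto
    then have \<Lambda>2: "\<Lambda>\<^sup>2 \<le> \<theta>\<^sup>2 * s\<^sup>2" using m' by (metis mult_1 power_mult_distrib)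
    have "0 \<le> 4 * (n - 1 - 2 * \<sigma>) * \<Lambda>\<^sup>2" using n5 \<sigma> by (intro mult_nonneg_nonneg) auto
    then have "- (4 * \<Lambda>\<^sup>2) \<le> q - c" using c4 N0 unfolding q_def by (simp add: algebra_simps)
    then have "(n - 2 * \<sigma>) * (- (4 * \<Lambda>\<^sup>2)) \<le> (n - 2 * \<sigma>) * (q - c)" using pos by (intro mult_left_mono) auto
    moreover have "- (4 * n * \<Lambda>\<^sup>2) \<le> (n - 2 * \<sigma>) * (- (4 * \<Lambda>\<^sup>2))"
      using \<sigma> mult_right_mono[of "n - 2 * \<sigma>" n "4 * \<Lambda>\<^sup>2"] by simp
    moreover have "trace H' = 4 * r * (\<theta> * s) + (n - 2 * \<sigma>) * (q - c) + 8 * \<sigma> * \<Lambda>\<^sup>2 * \<mu>"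
      unfolding trH' m'[symmetric] by (simp add: algebra_simps)
    moreover have "0 \<le> 8 * \<sigma> * \<Lambda>\<^sup>2 * \<mu>" using \<sigma> \<mu> by simp
    ultimately have T: "4 * r * (\<theta> * s) - 4 * n * \<Lambda>\<^sup>2 \<le> trace H'" by linarith
    have "n * \<rho> \<le> 2 * n * r\<^sup>2 + 8 * n\<^sup>2 * \<Lambda>\<^sup>2"
    proof -
      have "\<rho> \<le> 2 * r\<^sup>2 + 2 * (n - 1) * c" using N1 unfolding \<rho>_def by simp
      also have "\<dots> \<le> 2 * r\<^sup>2 + 2 * (n - 1) * (4 * \<Lambda>\<^sup>2)" using c4 n5 by (intro add_left_mono mult_left_mono) auto
      also have "\<dots> \<le> 2 * r\<^sup>2 + 2 * n * (4 * \<Lambda>\<^sup>2)" by (intro add_left_mono mult_right_mono) auto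
      finally have "n * \<rho> \<le> n * (2 * r\<^sup>2 + 2 * n * (4 * \<Lambda>\<^sup>2))" using n5 by (intro mult_left_mono) auto
      then show ?thesis by (simp add: algebra_simps power2_eq_square)
    qed
    then have "\<theta> * (n * \<rho>) \<le> \<theta> * (2 * n * r\<^sup>2 + 8 * n\<^sup>2 * \<Lambda>\<^sup>2)" using \<theta> by (intro mult_left_mono) auto
    moreover have "margin \<sigma> \<theta> S' \<Lambda>' = trace H' - \<theta> * (n * \<rho>)"
      unfolding margin_def L(3) E(1) ..
    ultimately have M: "4 * r * (\<theta> * s) - 4 * n * \<Lambda>\<^sup>2 - \<theta> * (2 * n * r\<^sup>2 + 8 * n\<^sup>2 * \<Lambda>\<^sup>2) \<le> margin \<sigma> \<theta> S' \<Lambda>'"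
      using T by linarith
    \<comment> \<open>The main part is \<open>2 \<theta> s\<^sup>2 / n\<close>. The bound
      \<open>8 n\<^sup>2 \<theta> \<le> 1\<close> is what keeps the error below half of it.\<close>
    have "(4 * n + 8 * n\<^sup>2 * \<theta>) * \<Lambda>\<^sup>2 \<le> (4 * n + 8 * n\<^sup>2 * \<theta>) * (\<theta>\<^sup>2 * s\<^sup>2)"
      using \<Lambda>2 n5 \<theta> by (intro mult_left_mono) auto
    also have "\<dots> \<le> \<theta> * s\<^sup>2 / n"
    proof -
      have th: "8 * n\<^sup>2 * \<theta> \<le> 1" using \<theta>(2) n5 unfolding n_def[symmetric] by (simp add: field_simps)
      have "(4 * n + 8 * n\<^sup>2 * \<theta>) * \<theta> * n \<le> (4 * n + 1) * \<theta> * n"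
        using th \<theta> n5 by (intro mult_right_mono) auto
      also have "\<dots> \<le> 8 * n\<^sup>2 * \<theta>"
      proof -
        have "(4 * n + 1) * n \<le> 8 * n\<^sup>2" using n5 by (simp add: power2_eq_square)
        then have "(4 * n + 1) * n * \<theta> \<le> 8 * n\<^sup>2 * \<theta>" using \<theta> by (intro mult_right_mono) auto
        then show ?thesis by (simp add: mult_ac)
      qed
      finally have "(4 * n + 8 * n\<^sup>2 * \<theta>) * \<theta> * n \<le> 1" using th by linarith
      then have "(4 * n + 8 * n\<^sup>2 * \<theta>) * \<theta> \<le> 1 / n" using n5 by (simp add: field_simps)
      then have "((4 * n + 8 * n\<^sup>2 * \<theta>) * \<theta>) * (\<theta> * s\<^sup>2) \<le> 1 / n * (\<theta> * s\<^sup>2)"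
        using \<theta> by (intro mult_right_mono) auto
      then show ?thesis by (simp add: power2_eq_square mult_ac)
    qed
    finally have "(4 * n + 8 * n\<^sup>2 * \<theta>) * \<Lambda>\<^sup>2 \<le> \<theta> * s\<^sup>2 / n" .
    moreover have "4 * r * (\<theta> * s) - \<theta> * (2 * n * r\<^sup>2) = 2 * (\<theta> * s\<^sup>2 / n)"
      unfolding rs using n5 by (simp add: field_simps power2_eq_square)
    moreover have "4 * r * (\<theta> * s) - 4 * n * \<Lambda>\<^sup>2 - \<theta> * (2 * n * r\<^sup>2 + 8 * n\<^sup>2 * \<Lambda>\<^sup>2)
      = (4 * r * (\<theta> * s) - \<theta> * (2 * n * r\<^sup>2)) - (4 * n + 8 * n\<^sup>2 * \<theta>) * \<Lambda>\<^sup>2"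
      by (simp add: algebra_simps)
    ultimately show "\<theta> * (scal S)\<^sup>2 / real CARD('n) \<le> margin \<sigma> \<theta> S' \<Lambda>'"
      using M unfolding s_def[symmetric] n_def[symmetric] by linarith
  qed
qed

section \<open>Invariance and transversality\<close>

text \<open>With \<open>\<mu> = 0\<close> the direction \<open>Qmap P\<close> satisfies only weak
  inequalities, whereas \<open>Ccone_step\<close> requires strict ones. Adding
  \<open>\<epsilon>\<close> times a fixed strictly inward direction repairs this; after pairing with
  the normal \<open>N\<close>, \<open>\<epsilon>\<close> can be arbitrarily small.\<close>

lemma Ccone_ode_invariant:
  fixes \<sigma> \<theta> :: real
  assumes n: "5 \<le> CARD('n)" and \<sigma>: "0 < \<sigma>" "\<sigma> \<le> 2"
    and \<theta>: "0 \<le> \<theta>" "\<theta> \<le> 1 / (8 * (real CARD('n))\<^sup>2)"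
  shows "ode_invariant (Ccone \<sigma> \<theta> :: 'n::finite tensor4 set)"
proof -
  let ?C = "Ccone \<sigma> \<theta> :: 'n tensor4 set" and ?I = "mat 1 :: real^'n^'n"
  define k where "k = real CARD('n)"
  have k5: "5 \<le> k" using n by (simp add: k_def)
  have pos: "0 < real CARD('n) - 2 * \<sigma>" using k5 \<sigma> by (simp add: k_def)
  have tangent: "N \<bullet> Qmap P \<le> 0" if P: "P \<in> ?C" and N: "\<And>X. X \<in> ?C \<Longrightarrow> N \<bullet> (X - P) \<le> 0" for P N
  proof -
    obtain S \<Lambda> K where d: "cone_data \<sigma> \<theta> S \<Lambda> K" and P': "P = assemble S \<Lambda> K" using P Ccone_iff[OF pos] by blast
    obtain S' \<Lambda>' K' where l': "lin_data \<sigma> S' \<Lambda>' K'" and Q: "Qmap P = assemble S' \<Lambda>' K'"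
      and g1: "\<And>p. p \<in> frames \<Longrightarrow> curvq S (fst p) (snd p) = 0 \<Longrightarrow> 0 \<le> curvq S' (fst p) (snd p)"
      and g2: "\<And>x. x \<in> sphere 0 1 \<Longrightarrow> x \<bullet> (K *v x) = 0 \<Longrightarrow> 0 \<le> x \<bullet> (K' *v x)"
      and g3: "margin \<sigma> \<theta> S \<Lambda> = 0 \<Longrightarrow> 0 \<le> margin \<sigma> \<theta> S' \<Lambda>'"
    proof (rule Qmap_assemble[OF n \<sigma> \<theta> d, of 0])
      fix S' \<Lambda>' K'
      assume *: "lin_data \<sigma> S' \<Lambda>' K'" "Qmap (assemble S \<Lambda> K) = assemble S' \<Lambda>' K'"
        "\<And>p. p \<in> frames \<Longrightarrow> curvq S (fst p) (snd p) = 0 \<Longrightarrow> 8 * \<Lambda>\<^sup>2 * 0 \<le> curvq S' (fst p) (snd p)"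
        "\<And>x. x \<in> sphere 0 1 \<Longrightarrow> x \<bullet> (K *v x) = 0 \<Longrightarrow> 8 * \<sigma> * \<Lambda>\<^sup>2 * 0 \<le> (real CARD('n) - 2 * \<sigma>) * (x \<bullet> (K' *v x))"
        "margin \<sigma> \<theta> S \<Lambda> = 0 \<Longrightarrow> \<theta> * (scal S)\<^sup>2 / real CARD('n) \<le> margin \<sigma> \<theta> S' \<Lambda>'"
      show thesis
      proof (rule that[OF *(1)])
        show "Qmap P = assemble S' \<Lambda>' K'" using *(2) P' by simp
        show "0 \<le> curvq S' (fst p) (snd p)" if "p \<in> frames" "curvq S (fst p) (snd p) = 0" for p
          using *(3)[OF that] by simp
        show "0 \<le> x \<bullet> (K' *v x)" if "x \<in> sphere 0 1" "x \<bullet> (K *v x) = 0" for x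
          using *(4)[OF that] pos by (simp add: zero_le_mult_iff)
        show "0 \<le> margin \<sigma> \<theta> S' \<Lambda>'" if "margin \<sigma> \<theta> S \<Lambda> = 0"
        proof -
          have "0 \<le> \<theta> * (scal S)\<^sup>2 / real CARD('n)" using \<theta>(1) by simp
          then show ?thesis using *(5)[OF that] by linarith
        qed
      qed
    qed auto
    \<comment> \<open>Small enough for \<open>\<theta> * scal T < 1 \<le> n - 2\<sigma>\<close>, so
      that \<open>T\<close> with \<open>\<Lambda> = 1\<close> has positive margin; the
      \<open>+ 1\<close> covers \<open>\<theta> = 0\<close>.\<close>
    define \<eta> where "\<eta> = 1 / (2 * k\<^sup>2 * (\<theta> + 1))"
    have \<eta>: "0 < \<eta>" unfolding \<eta>_def using k5 \<theta> by simp
    define T where "T = \<eta> *\<^sub>R odot ?I ?I"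
    define L where "L = (2 * \<sigma> / k) *\<^sub>R ?I"
    have scT: "scal T = \<eta> * (2 * (k - 1) * k)"
      unfolding T_def scal_scaleR scal_odot_id trace_mat1 k_def ..
    have lT: "lin_data \<sigma> T 1 L"
    proof -
      have "Ric T = (\<eta> * (2 * k - 2)) *\<^sub>R ?I"
        unfolding T_def Ric_scaleR Ric_odot_id trace_mat1 k_def by (simp add: vec_eq_iff algebra_simps)
      then have "Ric0 T = 0" by (rule Einstein_scal(2))
      moreover have "acurv T" unfolding T_def by (intro acurv_scaleR acurv_odot) auto
      moreover have "trace L = 2 * \<sigma> * 1"
        unfolding L_def trace_scaleR trace_mat1 k_def[symmetric] using k5 by simp
      ultimately show ?thesis unfolding lin_data_def by (simp add: L_def transpose_scaleR)
    qed
    have mT: "0 < margin \<sigma> \<theta> T 1"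
    proof -
      have "\<theta> * scal T \<le> \<theta> * (\<eta> * (2 * k\<^sup>2))"
        unfolding scT using \<theta> \<eta> k5 by (intro mult_left_mono) (auto simp: power2_eq_square)
      also have "\<eta> * (2 * k\<^sup>2) = 1 / (\<theta> + 1)" unfolding \<eta>_def using k5 by simp
      also have "\<theta> * (1 / (\<theta> + 1)) < 1" using \<theta>(1) by (simp add: field_simps)
      finally show ?thesis unfolding margin_def k_def[symmetric] using k5 \<sigma> by simp
    qed
    have le: "N \<bullet> (Qmap P + \<epsilon> *\<^sub>R assemble T 1 L) \<le> 0" if \<epsilon>: "0 < \<epsilon>" for \<epsilon>
    proof -
      have "strict_dir \<sigma> \<theta> S \<Lambda> K (S' + \<epsilon> *\<^sub>R T) (\<Lambda>' + \<epsilon> * 1) (K' + \<epsilon> *\<^sub>R L)"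
        unfolding strict_dir_def curvq_add curvq_scaleR inner_matrix_add inner_matrix_scaleR margin_add margin_scaleR
      proof (intro conjI ballI impI)
        fix p :: "(complex^'n) \<times> (complex^'n)" assume p: "p \<in> frames" "curvq S (fst p) (snd p) = 0"
        have "curvq T (fst p) (snd p) = \<eta> * 2"
          unfolding T_def curvq_scaleR using curvq_odot_id_frames[of "fst p" "snd p"] p by simp
        then show "0 < curvq S' (fst p) (snd p) + \<epsilon> * curvq T (fst p) (snd p)"
          using g1[OF p] \<epsilon> \<eta> by (simp add: add_nonneg_pos)
      next
        fix x :: "real^'n" assume x: "x \<in> sphere 0 1" "x \<bullet> (K *v x) = 0"
        have "x \<bullet> (L *v x) = 2 * \<sigma> / k"
          unfolding L_def inner_matrix_scaleR using x by (simp add: dot_square_norm)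
        then show "0 < x \<bullet> (K' *v x) + \<epsilon> * (x \<bullet> (L *v x))"
          using g2[OF x] \<epsilon> \<sigma> k5 by (simp add: add_nonneg_pos)
      next
        assume "margin \<sigma> \<theta> S \<Lambda> = 0"
        then show "0 < margin \<sigma> \<theta> S' \<Lambda>' + \<epsilon> * margin \<sigma> \<theta> T 1"
          using g3 \<epsilon> mT by (simp add: add_nonneg_pos)
      qed
      from Ccone_step[OF pos d lin_data_add[OF l' lin_data_scaleR[OF lT]] this]
      obtain \<delta> where \<delta>: "\<delta> > 0" "P + \<delta> *\<^sub>R (Qmap P + \<epsilon> *\<^sub>R assemble T 1 L) \<in> ?C"
        unfolding assemble_add assemble_scaleR Q[symmetric] P'[symmetric] by blast
      have "\<delta> * (N \<bullet> (Qmap P + \<epsilon> *\<^sub>R assemble T 1 L)) \<le> 0"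
        using N[OF \<delta>(2)] by simp
      then show ?thesis using \<delta>(1) by (simp add: mult_le_0_iff)
    qed
    show ?thesis
    proof (rule field_le_epsilon)
      fix e :: real assume e: "0 < e"
      define a where "a = \<bar>N \<bullet> assemble T 1 L\<bar> + 1"
      have a: "0 < a" by (simp add: a_def)
      have "N \<bullet> Qmap P \<le> (e / a) * (- (N \<bullet> assemble T 1 L))"
        using le[of "e / a"] e a by (simp add: inner_add_right)
      also have "\<dots> \<le> (e / a) * a" using e a by (intro mult_left_mono) (auto simp: a_def)
      finally show "N \<bullet> Qmap P \<le> 0 + e" using a by simp
    qed
  qed
  show ?thesis
    unfolding ode_invariant_def
  proof (intro allI impI ballI, elim conjE)
    fix T :: real and R :: "real \<Rightarrow> 'n tensor4" and t
    assume R: "R 0 \<in> ?C" "\<forall>t\<in>{0..T}. (R has_vector_derivative Qmap (R t)) (at t within {0..T})" and t: "t \<in> {0..T}"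
    show "R t \<in> ?C"
    proof (rule closed_convex_flow_invariant[where f = Qmap and R = R and T = T])
      show "closed ?C" using n pos \<sigma> by (intro closed_Ccone) auto
      show "convex ?C" by (rule convex_Ccone(1)[OF pos])
      show "\<exists>L. \<forall>x y :: 'n tensor4. norm x \<le> B \<longrightarrow> norm y \<le> B \<longrightarrow> norm (Qmap x - Qmap y) \<le> L * norm (x - y)" for B
        by (rule Qmap_lipschitz_on_bounded)
    qed (use tangent R t in auto)
  qed
qed

text \<open>Subtracting \<open>Ric U / (n - 2)\<close> odot the identity removes the trace-free
  Ricci part, as in the Weyl decomposition. So every curvature tensor is a direction of the
  parametrisation.\<close>

lemma ACT_decomposition:
  fixes U :: "'n::finite tensor4"
  assumes pos: "0 < real CARD('n) - 2 * \<sigma>" and n: "3 \<le> CARD('n)" and U: "acurv U"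
  obtains S \<Lambda> K where "lin_data \<sigma> S \<Lambda> K" "U = assemble S \<Lambda> K"
proof -
  define H where "H = (1 / (real CARD('n) - 2)) *\<^sub>R Ric U"
  define S where "S = U - odot H (mat 1)"
  have Hs: "transpose H = H" unfolding H_def using symmetric_Ric[OF U] by (simp add: transpose_scaleR)
  have aS: "acurv S" unfolding S_def using U Hs by (intro acurv_diff acurv_odot) auto
  have "Ric S = (- trace H) *\<^sub>R mat 1"
    unfolding S_def Ric_diff Ric_odot_id using n by (simp add: H_def)
  then have "Ric0 S = 0" by (rule Einstein_scal(2))
  from lin_data_of_symmetric(1,2)[OF pos aS this Hs] show ?thesis
    by (intro that) (auto simp: S_def)
qed

text \<open>Strictness gives, for each \<open>U\<close> in \<open>ACT\<close>, some
  \<open>\<eta> > 0\<close> with \<open>Qmap R + \<eta> U\<close> in the tangent cone; for a convex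
  set in finite dimension this already means interior relative to \<open>ACT\<close>.\<close>

lemma Ccone_transv_invariant:
  fixes \<sigma> \<theta> :: real
  assumes n: "5 \<le> CARD('n)" and \<sigma>: "0 < \<sigma>" "\<sigma> < 2" "\<sigma> \<noteq> 1"
    and \<theta>: "0 < \<theta>" "\<theta> \<le> 1 / (8 * (real CARD('n))\<^sup>2)"
  shows "transv_invariant (Ccone \<sigma> \<theta> :: 'n::finite tensor4 set)"
  unfolding transv_invariant_def
proof (intro conjI ballI)
  let ?C = "Ccone \<sigma> \<theta> :: 'n tensor4 set"
  have pos: "0 < real CARD('n) - 2 * \<sigma>" using n \<sigma> by simp
  show clC: "closed ?C" using n pos \<sigma> by (intro closed_Ccone) auto
  show cvC: "convex ?C" and "cone ?C" by (rule convex_Ccone[OF pos])+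
  have CA: "?C \<subseteq> ACT" by (auto simp: Ccone_def ACT_def)
  fix R assume R: "R \<in> top_of_set ACT frontier_of ?C - {0}"
  have "closedin (top_of_set ACT) ?C" using clC CA closed_subset by blast
  then have RC: "R \<in> ?C" using R frontier_of_subset_closedin by blast
  have R0: "R \<noteq> 0" using R by blast
  obtain S \<Lambda> K where d: "cone_data \<sigma> \<theta> S \<Lambda> K" and R': "R = assemble S \<Lambda> K" using RC Ccone_iff[OF pos] by blast
  have S: "S \<in> PIC2" "Ric0 S = 0" and K: "transpose K = K" "psd K" and tr: "trace K = 2 * \<sigma> * \<Lambda>"
    and mar: "0 \<le> margin \<sigma> \<theta> S \<Lambda>"
    using d unfolding cone_data_def lin_data_def by auto
  \<comment> \<open>If \<open>\<Lambda> = 0\<close>, the margin and \<open>\<theta> > 0\<close>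
    force \<open>scal S = 0\<close>, hence \<open>S = 0\<close>, and \<open>K\<close> has trace 0;
    then \<open>R = 0\<close>.\<close>
  have "\<Lambda> \<noteq> 0"
  proof
    assume \<Lambda>: "\<Lambda> = 0"
    then have "\<theta> * scal S \<le> 0" using mar by (simp add: margin_def)
    then have "scal S = 0" using \<theta>(1) PIC2_Einstein_scal_nonneg[OF S] by (simp add: mult_le_0_iff)
    then have "Ric S = 0" using S(2) unfolding Ric0_eq_0_iff by simp
    then have "S = 0" by (rule PIC2_Ric_zero[OF S(1)])
    moreover have "norm K = 0"
      using psd_trace_bounds(2)[OF K] trace_square_symmetric[OF K(1)] unfolding tr \<Lambda> by simp
    ultimately have "R = 0" unfolding R' assemble_def \<Lambda> by (simp add: vec_eq_iff odot_nth)
    then show False using R0 by blast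
  qed
  then have \<Lambda>: "0 < \<Lambda>\<^sup>2" by simp
  \<comment> \<open>Half of the slack between the two constraints on \<open>c\<close>: one half is
    spent on PIC2 and the other on \<open>K\<close>. It is positive since \<open>\<sigma>\<close> is
    neither 1 nor 2.\<close>
  define \<mu> where "\<mu> = min ((1 - \<sigma>)\<^sup>2) ((1 - \<sigma> / 2)\<^sup>2) / 2"
  have \<mu>: "0 < \<mu>" using \<sigma> by (simp add: \<mu>_def)
  obtain S' \<Lambda>' K' where l': "lin_data \<sigma> S' \<Lambda>' K'" and Q: "Qmap R = assemble S' \<Lambda>' K'"
    and st: "strict_dir \<sigma> \<theta> S \<Lambda> K S' \<Lambda>' K'"
  proof (rule Qmap_assemble[OF n \<sigma>(1) less_imp_le[OF \<sigma>(2)] less_imp_le[OF \<theta>(1)] \<theta>(2) d, of \<mu>])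
    fix S' \<Lambda>' K'
    assume *: "lin_data \<sigma> S' \<Lambda>' K'" "Qmap (assemble S \<Lambda> K) = assemble S' \<Lambda>' K'"
        "\<And>p. p \<in> frames \<Longrightarrow> curvq S (fst p) (snd p) = 0 \<Longrightarrow> 8 * \<Lambda>\<^sup>2 * \<mu> \<le> curvq S' (fst p) (snd p)"
        "\<And>x. x \<in> sphere 0 1 \<Longrightarrow> x \<bullet> (K *v x) = 0 \<Longrightarrow> 8 * \<sigma> * \<Lambda>\<^sup>2 * \<mu> \<le> (real CARD('n) - 2 * \<sigma>) * (x \<bullet> (K' *v x))"
        "margin \<sigma> \<theta> S \<Lambda> = 0 \<Longrightarrow> \<theta> * (scal S)\<^sup>2 / real CARD('n) \<le> margin \<sigma> \<theta> S' \<Lambda>'"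
    show thesis
    proof (rule that[OF *(1)])
      show "Qmap R = assemble S' \<Lambda>' K'" using *(2) R' by simp
      show "strict_dir \<sigma> \<theta> S \<Lambda> K S' \<Lambda>' K'"
        unfolding strict_dir_def
      proof (intro conjI ballI impI)
        fix p :: "(complex^'n) \<times> (complex^'n)" assume p: "p \<in> frames" "curvq S (fst p) (snd p) = 0"
        have "0 < 8 * \<Lambda>\<^sup>2 * \<mu>" using \<Lambda> \<mu> by simp
        then show "0 < curvq S' (fst p) (snd p)" using *(3)[OF p] by linarith
      next
        fix x :: "real^'n" assume x: "x \<in> sphere 0 1" "x \<bullet> (K *v x) = 0"
        have "0 < 8 * \<sigma> * \<Lambda>\<^sup>2 * \<mu>" using \<Lambda> \<mu> \<sigma> by simp
        then have "0 < (real CARD('n) - 2 * \<sigma>) * (x \<bullet> (K' *v x))" using *(4)[OF x] by linarith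
        then show "0 < x \<bullet> (K' *v x)" using pos by (simp add: zero_less_mult_iff)
      next
        assume m: "margin \<sigma> \<theta> S \<Lambda> = 0"
        then have "scal S \<noteq> 0" using \<open>\<Lambda> \<noteq> 0\<close> pos by (auto simp: margin_def)
        then have "0 < \<theta> * (scal S)\<^sup>2 / real CARD('n)" using \<theta> by simp
        then show "0 < margin \<sigma> \<theta> S' \<Lambda>'" using *(5)[OF m] by linarith
      qed
    qed
  qed (use \<mu> in \<open>auto simp: \<mu>_def\<close>)
  let ?T = "tangent_cone ?C R"
  have T_eq: "?T = closure (cone hull ((\<lambda>X. X - R) ` ?C))"
    unfolding tangent_cone_def cone_hull_expl by (rule arg_cong[of _ _ closure]) blast
  have cvT: "convex ?T"
    unfolding T_eq by (intro convex_closure convex_cone_hull convex_translation_subtract cvC)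
  have QA: "Qmap R \<in> ACT" unfolding Q ACT_def using acurv_assemble[OF l'] by simp
  have TA: "?T \<subseteq> ACT"
    unfolding tangent_cone_def
  proof (rule closure_minimal)
    show "{c *\<^sub>R (X - R) |c X. 0 \<le> c \<and> X \<in> ?C} \<subseteq> ACT"
      using CA RC subspace_scale[OF subspace_ACT] subspace_diff[OF subspace_ACT] by blast
    show "closed (ACT :: 'n tensor4 set)" by (rule closed_subspace[OF subspace_ACT])
  qed
  have in_T: "c *\<^sub>R (X - R) \<in> ?T" if "X \<in> ?C" "0 \<le> c" for c X
    unfolding tangent_cone_def using that by (intro subsetD[OF closure_subset]) blast
  have dirs: "\<exists>\<eta>>0. Qmap R + \<eta> *\<^sub>R U \<in> ?T" if "U \<in> ACT" for U
  proof -
    have aU: "acurv U" using that by (simp add: ACT_def)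
    obtain S'' \<Lambda>'' K'' where l'': "lin_data \<sigma> S'' \<Lambda>'' K''" and U: "U = assemble S'' \<Lambda>'' K''"
      by (rule ACT_decomposition[OF pos _ aU]) (use n in auto)
    obtain \<eta> where \<eta>: "\<eta> > 0" "strict_dir \<sigma> \<theta> S \<Lambda> K (S' + \<eta> *\<^sub>R S'') (\<Lambda>' + \<eta> * \<Lambda>'') (K' + \<eta> *\<^sub>R K'')"
      using strict_dir_perturb[OF st] by blast
    from Ccone_step[OF pos d lin_data_add[OF l' lin_data_scaleR[OF l'']] \<eta>(2)]
    obtain \<delta> where \<delta>: "\<delta> > 0" "R + \<delta> *\<^sub>R (Qmap R + \<eta> *\<^sub>R U) \<in> ?C"
      unfolding assemble_add assemble_scaleR Q[symmetric] R'[symmetric] U[symmetric] by blast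
    have "(1 / \<delta>) *\<^sub>R ((R + \<delta> *\<^sub>R (Qmap R + \<eta> *\<^sub>R U)) - R) \<in> ?T" using \<delta> by (intro in_T) auto
    then show ?thesis using \<eta>(1) \<delta>(1) by auto
  qed
  have 0: "0 \<in> ?T" using in_T[OF RC, of 0] by simp
  have QT: "Qmap R \<in> ?T" using dirs[of 0] subspace_0[OF subspace_ACT] by auto
  \<comment> \<open>For convex sets, relative interior is prolongation of segments, which
    \<open>dirs\<close> supplies. The affine hull is then shown to contain \<open>ACT\<close>, so
    this is the interior in \<open>ACT\<close>.\<close>
  have "Qmap R \<in> rel_interior ?T"
    unfolding convex_rel_interior_iff[OF cvT ex_in_conv[THEN iffD1, OF exI, OF 0]]
  proof
    fix x assume "x \<in> ?T"
    then have "Qmap R - x \<in> ACT" using TA QA subspace_diff[OF subspace_ACT] by blast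
    then obtain \<eta> where "\<eta> > 0" "Qmap R + \<eta> *\<^sub>R (Qmap R - x) \<in> ?T" using dirs by blast
    then show "\<exists>e>1. (1 - e) *\<^sub>R x + e *\<^sub>R Qmap R \<in> ?T"
      by (intro exI[of _ "1 + \<eta>"]) (simp add: algebra_simps)
  qed
  then obtain V where V: "open V" "Qmap R \<in> V" "V \<inter> affine hull ?T \<subseteq> ?T"
    unfolding mem_rel_interior by blast
  have "ACT \<subseteq> affine hull ?T"
  proof
    fix U :: "'n tensor4" assume "U \<in> ACT"
    then obtain \<eta> where \<eta>: "\<eta> > 0" "Qmap R + \<eta> *\<^sub>R U \<in> ?T" using dirs by blast
    have "(1 / \<eta>) *\<^sub>R ((Qmap R + \<eta> *\<^sub>R U) - Qmap R) \<in> span ?T"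
      using \<eta>(2) QT by (intro span_scale span_diff span_base)
    then have "U \<in> span ?T" using \<eta>(1) by simp
    then show "U \<in> affine hull ?T" using affine_hull_span_0[OF hull_inc[OF 0]] by simp
  qed
  then have "ACT \<inter> V \<subseteq> ?T" using V(3) by blast
  moreover have "openin (top_of_set ACT) (ACT \<inter> V)" using V(1) by (rule openin_open_Int)
  ultimately show "Qmap R \<in> top_of_set ACT interior_of ?T"
    unfolding interior_of_def using QA V(2) by blast
qed

theorem theorem2p5:
  assumes "CARD('n::finite) \<ge> 5"
  shows "\<exists>\<theta>b > 0.
    (\<forall>\<sigma> \<theta>. 0 < \<sigma> \<and> \<sigma> \<le> 2 \<and> 0 \<le> \<theta> \<and> \<theta> \<le> \<theta>b
       \<longrightarrow> ode_invariant (Ccone \<sigma> \<theta> :: 'n tensor4 set)) \<and>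
    (\<forall>\<sigma> \<theta>. ((0 < \<sigma> \<and> \<sigma> < 1) \<or> (1 < \<sigma> \<and> \<sigma> < 2)) \<and> 0 < \<theta> \<and> \<theta> < \<theta>b
       \<longrightarrow> transv_invariant (Ccone \<sigma> \<theta> :: 'n tensor4 set))"
proof (intro exI[of _ "1 / (8 * (real CARD('n))\<^sup>2)"] conjI allI impI)
  show "0 < 1 / (8 * (real CARD('n))\<^sup>2)" using assms by simp
qed (use assms in \<open>auto intro!: Ccone_ode_invariant Ccone_transv_invariant\<close>)

end
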